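(* Let $\gamma>0$. The hierarchical branching process with parameters $$\lambda_j=\gamma\,2^{2-j},\qquad p_K=2^{-K},\qquad T_k=2^{k-1}\qquad(j,K,k\ge1)$$ is distributionally equivalent to the critical binary Galton-Watson tree $\mathsf{GW}(0,\gamma)$ with i.i.d. edge lengths that have a common exponential distribution with rate $2\gamma$ (that is, the random tree in $\mathcal{L}$ generated by the process has the same distribution as $\mathsf{GW}(0,\gamma)$ considered as an element of $\mathcal{L}$). This is a self-similar, critical, and time-invariant process with $$R=4,\quad L=2,\quad\text{and}\quad\zeta=2 .$$
   Context: Trees. $\mathcal{T}$ is the space of finite unlabeled rooted reduced planted binary trees with no planar embedding (the root has degree 1, internal vertices have degree 3, leaves have degree 1), together with the empty tree $\phi$ (a single root vertex). $\mathcal{L}$ is the space of trees from $\mathcal{T}$ with positive edge lengths; $\mathrm{shape}$ forgets the lengths. Pruning $\mathcal{R}$ removes leaves with their parental edges and then performs series reduction (each degree-two vertex is removed by merging its two adjacent edges, adding lengths); $\mathcal{R}(\phi)=\phi$. The (Horton-Strahler) order is $\mathsf{k}(T)=\min\{k\ge0:\mathcal{R}^k(T)=\phi\}$. For a non-root vertex $v$, $T_v$ is the subtree rooted at the parent of $v$ and comprised of $v$ and its descendants with their parental edges; the order of $v$ is $\mathsf{k}(T_v)$; a branch is a maximal connected sequence of vertices of the same order with their parental edges; if $v$ is the vertex of a branch of order $K$ closest to the root, $T_v$ is a complete subtree of order $K$. $\mathsf{GW}(0,\gamma)$: its combinatorial shape is the critical binary Galton-Watson tree (a single progenitor; each vertex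 independently either splits into two with probability $1/2$ or becomes a leaf with probability $1/2$; the tree is planted, i.e. the progenitor is attached to the root by an edge), and given the shape all edge lengths are independent exponential random variables with rate $2\gamma$. Hierarchical branching process. Given nonnegative $\{T_k\}_{k\ge1}$, positive $\{\lambda_j\}_{j\ge1}$ and a probability mass function $\{p_K\}_{K\ge1}$, it is the multi-type continuous-time branching process that starts with a single root branch of order $K$ with probability $p_K$. Independently of the other branches, every branch of order $j$ produces offspring branches of each order $i<j$ with rate $\lambda_jT_{j-i}$, and terminates with rate $\lambda_j$. After termination, a branch of order $j\ge2$ splits into two branches of order $j-1$; a branch of order 1 terminates without leaving offspring. The branching history creates a random tree in $\mathcal{L}$. Self-similarity with scaling exponent $\zeta$ of the law of a random tree $T\in\mathcal{L}$: edges are labeled by depth-first search after a fixed proper planar embedding (one commuting with pruning), $\mathrm{length}(T)$ is the sum of edge lengths and $x_T$ the vector of edge lengths divided by $\mathrm{length}(T)$; $\mu$ is the law of $\mathrm{shape}(T)$, $\mu_K$ its conditional law given order $K$, $\chi_\tau$ the conditional law of $x_T$ given $\mathrm{shape}(T)=\tau$, $F_{\tau,\bar x}(\ell)$ the conditional density of $\mathrm{length}(T)$ given $x_T=\bar x$, $\mathrm{shape}(T)=\tau$. The law is self-similar with exponent $\zeta>0$ if (i)-(ii) (coordination) for every $H\ge K\ge1$, a uniformly chosen complete subtree of order $K$ of the random tree conditioned to have order $H$ has shape law $\mu_K$ and the same conditional laws $\chi_\tau$, $F_{\tau,\bar x}$ for $\tau$ of order $K$; (iii) $\nu(\tau\mid\tau\ne\phi)=\mu(\tau)$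 for $\nu=\mu\circ\mathcal{R}^{-1}$; (iv) given $\mathrm{shape}(\mathcal{R}(T))=\tau$, $x_{\mathcal{R}(T)}$ has law $\chi_\tau$, and the conditional density of $\mathrm{length}(\mathcal{R}(T))$ given $x_{\mathcal{R}(T)}=\bar x$, $\mathrm{shape}(\mathcal{R}(T))=\tau$ is $\zeta^{-1}F_{\tau,\bar x}(\ell/\zeta)$. Criticality and time-invariance. Let $\pi=\sum_{K\ge1}p_Ke_K$, $\Lambda=\mathrm{diag}\{\lambda_1,\lambda_2,\dots\}$ and let $\mathbb{G}$ be the upper triangular Toeplitz operator with $\mathbb{G}_{i,i}=-1$, $\mathbb{G}_{i,i+1}=T_1+2$, $\mathbb{G}_{i,i+k}=T_k$ for $k\ge2$, $\mathbb{G}_{i,j}=0$ for $j<i$. The process is critical if the width function $C(s)=\|e^{\mathbb{G}\Lambda s}\pi\|_1$ (the average number of branches alive at time $s$) equals 1 for all $s\ge0$, and time-invariant if $e^{\mathbb{G}\Lambda s}\pi=\pi$ for all $s\ge0$. $L:=\limsup_{k\to\infty}T_k^{1/k}$; $\hat t(z)=-1+2z+\sum_{j\ge1}z^jT_j$ for $|z|<1/L$; $R:=w_0^{-1}$ where $w_0$ is the unique real root of $\hat t$ in $(0,\tfrac12]$; $\zeta$ is the scaling exponent.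
   Formalization: The fixed proper planar embedding is required, besides commuting with pruning, to be measurable and to commute with rescaling all edge lengths; if left/right choices may depend on absolute lengths, the law of x_T need not be preserved under pruning. *)

theory Defs
  imports "HOL-Probability.Probability" "HOL-Library.Tree"
begin

section \<open>Trees\<close>

text \<open>
  A planted planar tree is encoded by the library's binary trees: every \<^const>\<open>Node\<close> is a non-root
  vertex, labelled with (the length of) its parental edge, and \<^const>\<open>Leaf\<close> means that there is no
  vertex. So \<^term>\<open>Leaf\<close> is the empty tree \<open>\<phi>\<close>, \<^term>\<open>Node Leaf e Leaf\<close> is the tree
  with one edge \<open>e\<close>, and the root itself, which carries no information, is left implicit.
  Nodes with exactly one child are vertices of degree two.
\<close>

inductive swap_iso :: "'e tree \<Rightarrow> 'e tree \<Rightarrow> bool" where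
  "swap_iso Leaf Leaf"
| "swap_iso l l' \<Longrightarrow> swap_iso r r' \<Longrightarrow> swap_iso (Node l e r) (Node l' e r')"
| "swap_iso l r' \<Longrightarrow> swap_iso r l' \<Longrightarrow> swap_iso (Node l e r) (Node l' e r')"

lemma swap_iso_Leaf1 [simp]: "swap_iso Leaf t \<longleftrightarrow> t = Leaf"
  by (subst swap_iso.simps) auto

lemma swap_iso_Leaf2 [simp]: "swap_iso t Leaf \<longleftrightarrow> t = Leaf"
  by (subst swap_iso.simps) auto

lemma swap_iso_refl: "swap_iso t t"
  by (induction t) (auto intro: swap_iso.intros)

lemma swap_iso_sym: "swap_iso s t \<Longrightarrow> swap_iso t s"
  by (induction rule: swap_iso.induct) (auto intro: swap_iso.intros)

lemma swap_iso_trans: "swap_iso s t \<Longrightarrow> swap_iso t u \<Longrightarrow> swap_iso s u"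
proof (induction arbitrary: u rule: swap_iso.induct)
  case 1
  then show ?case by simp
next
  case (2 l l' r r' e)
  from 2(5) show ?case
    by (cases rule: swap_iso.cases) (auto intro: swap_iso.intros 2(3,4))
next
  case (3 l r' r l' e)
  from 3(5) show ?case
    by (cases rule: swap_iso.cases) (auto intro: swap_iso.intros 3(3,4))
qed

quotient_type 'e utree = "'e tree" / swap_iso
  by (rule equivpI)
    (auto simp: reflp_def symp_def transp_def intro: swap_iso_refl swap_iso_sym swap_iso_trans)

text \<open>The tree without its planar embedding.\<close>

abbreviation unordered :: "'e tree \<Rightarrow> 'e utree" where
  "unordered \<equiv> abs_utree"

lift_definition empty_tree :: "'e utree" (\<open>\<phi>\<close>) is Leaf .

lift_definition map_utree :: "('a \<Rightarrow> 'b) \<Rightarrow> 'a utree \<Rightarrow> 'b utree" is map_tree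
  subgoal premises p for f s t
    using p by (induction rule: swap_iso.induct) (auto intro: swap_iso.intros)
  done

abbreviation shape :: "'e utree \<Rightarrow> unit utree" where
  "shape \<equiv> map_utree (\<lambda>_. ())"

lift_definition edge_count :: "'e utree \<Rightarrow> nat" is size
  subgoal premises p for s t
    using p by (induction rule: swap_iso.induct) auto
  done

lift_definition tree_length :: "real utree \<Rightarrow> real" is "\<lambda>t. sum_list (preorder t)"
  subgoal premises p for s t
    using p by (induction rule: swap_iso.induct) auto
  done

primrec reduced_plane :: "'e tree \<Rightarrow> bool" where
  "reduced_plane Leaf \<longleftrightarrow> True"
| "reduced_plane (Node l e r) \<longleftrightarrow> (l = Leaf \<longleftrightarrow> r = Leaf) \<and> reduced_plane l \<and> reduced_plane r"

lift_definition reduced :: "'e utree \<Rightarrow> bool" is reduced_plane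
  subgoal premises p for s t
    using p by (induction rule: swap_iso.induct) auto
  done

lift_definition edge_labels :: "'e utree \<Rightarrow> 'e set" is set_tree
  subgoal premises p for s t
    using p by (induction rule: swap_iso.induct) auto
  done

text \<open>The space \<open>\<L>\<close>: reduced binary trees with positive edge lengths.\<close>

definition length_trees :: "real utree set" where
  "length_trees = {T. reduced T \<and> (\<forall>e\<in>edge_labels T. 0 < e)}"


section \<open>Pruning, order, complete subtrees\<close>

text \<open>Shapes carry trivial edge labels; adding them lets pruning act on shapes as well.\<close>

instantiation unit :: plus
begin
definition plus_unit :: "unit \<Rightarrow> unit \<Rightarrow> unit" where "plus_unit _ _ = ()"
instance ..
end

primrec cut_leaves :: "'e tree \<Rightarrow> 'e tree" where
  "cut_leaves Leaf = Leaf"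
| "cut_leaves (Node l e r) =
    (if l = Leaf \<and> r = Leaf then Leaf else Node (cut_leaves l) e (cut_leaves r))"

fun attach :: "'e::plus \<Rightarrow> 'e tree \<Rightarrow> 'e tree \<Rightarrow> 'e tree" where
  "attach e Leaf (Node l x r) = Node l (e + x) r"
| "attach e (Node l x r) Leaf = Node l (e + x) r"
| "attach e Leaf Leaf = Node Leaf e Leaf"
| "attach e (Node l x r) (Node l' x' r') = Node (Node l x r) e (Node l' x' r')"

primrec series_reduce :: "'e::plus tree \<Rightarrow> 'e tree" where
  "series_reduce Leaf = Leaf"
| "series_reduce (Node l e r) = attach e (series_reduce l) (series_reduce r)"

definition prune_plane :: "'e::plus tree \<Rightarrow> 'e tree" where
  "prune_plane t = series_reduce (cut_leaves t)"

lemma swap_iso_cut_leaves: "swap_iso s t \<Longrightarrow> swap_iso (cut_leaves s) (cut_leaves t)"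
  by (induction rule: swap_iso.induct) (auto intro: swap_iso.intros)

lemma swap_iso_attach:
  assumes "swap_iso l l'" "swap_iso r r'"
  shows "swap_iso (attach e l r) (attach e l' r')" "swap_iso (attach e l r) (attach e r' l')"
  using assms by (cases l; cases r; cases l'; cases r';
      auto intro: swap_iso.intros swap_iso_refl elim: swap_iso.cases)+

lemma swap_iso_series_reduce: "swap_iso s t \<Longrightarrow> swap_iso (series_reduce s) (series_reduce t)"
  by (induction rule: swap_iso.induct) (auto intro: swap_iso.intros swap_iso_attach)

lift_definition prune :: "'e::plus utree \<Rightarrow> 'e utree" is prune_plane
  unfolding prune_plane_def by (intro swap_iso_series_reduce swap_iso_cut_leaves)

definition tree_order :: "'e::plus utree \<Rightarrow> nat" where
  "tree_order T = (LEAST k. (prune ^^ k) T = \<phi>)"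

text \<open>
  \<open>complete_from k t\<close> collects, with multiplicity, the complete subtrees of \<open>t\<close> when the vertex above
  the topmost vertex of \<open>t\<close> has order \<open>k\<close>: a vertex starts a new branch, and hence its descendant
  tree is a complete subtree, iff its order differs from the order of its parent. The value \<open>k = 0\<close>
  stands for the root, since every non-root vertex has order at least one.
\<close>

primrec complete_from :: "nat \<Rightarrow> 'e::plus tree \<Rightarrow> 'e utree multiset" where
  "complete_from k Leaf = {#}"
| "complete_from k (Node l e r) =
    (let T = unordered (Node l e r) in
      (if tree_order T \<noteq> k then {#T#} else {#}) +
        complete_from (tree_order T) l + complete_from (tree_order T) r)"

lemma complete_from_swap_iso: "swap_iso s t \<Longrightarrow> complete_from k s = complete_from k t"
proof (induction arbitrary: k rule: swap_iso.induct)
  case 1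
  show ?case by simp
next
  case (2 l l' r r' e)
  have "unordered (Node l e r) = unordered (Node l' e r')"
    unfolding utree.abs_eq_iff using 2(1,2) by (rule swap_iso.intros)
  with 2(3,4) show ?case by (simp add: Let_def)
next
  case (3 l r' r l' e)
  have "unordered (Node l e r) = unordered (Node l' e r')"
    unfolding utree.abs_eq_iff using 3(1,2) by (rule swap_iso.intros(3))
  with 3(3,4) show ?case by (simp add: Let_def)
qed

lift_definition complete_subtrees :: "'e::plus utree \<Rightarrow> 'e utree multiset" is "complete_from 0"
  by (rule complete_from_swap_iso)


section \<open>Laws of random trees\<close>

abbreviation plane_space :: "real tree measure" where
  "plane_space \<equiv> tree_sigma borel"

text \<open>Quotient \<open>\<sigma>\<close>-algebra of the Borel \<open>\<sigma>\<close>-algebra on planar trees with edge lengths.\<close>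

definition utree_space :: "real utree measure" where
  "utree_space = sigma UNIV {A. unordered -` A \<in> sets plane_space}"

definition tree_law :: "real utree measure \<Rightarrow> bool" where
  "tree_law P \<longleftrightarrow> prob_space P \<and> sets P = sets utree_space \<and> (AE T in P. T \<in> length_trees)"

definition shape_law :: "real utree measure \<Rightarrow> unit utree measure" where
  "shape_law P = distr P (count_space UNIV) shape"

definition given_order :: "real utree measure \<Rightarrow> nat \<Rightarrow> real utree measure" where
  "given_order P K = uniform_measure P {T. tree_order T = K}"

text \<open>The law of a uniformly chosen complete subtree of order \<open>K\<close> of a random tree with law \<open>Q\<close>.\<close>

definition complete_subtree_law :: "real utree measure \<Rightarrow> nat \<Rightarrow> real utree measure" where
  "complete_subtree_law Q K = Q \<bind> (\<lambda>T.
     distr (measure_pmf (pmf_of_multiset {#S \<in># complete_subtrees T. tree_order S = K#})) utree_space (\<lambda>S. S))"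


section \<open>Distributional self-similarity\<close>

text \<open>
  A planar embedding of the trees with edge lengths that commutes with pruning. It is also required
  to be measurable and not to depend on the unit of length; the latter makes the vector of normalized
  edge lengths below a function of the tree up to scaling.
\<close>

definition proper_embedding :: "(real utree \<Rightarrow> real tree) \<Rightarrow> bool" where
  "proper_embedding emb \<longleftrightarrow>
     emb \<in> utree_space \<rightarrow>\<^sub>M plane_space \<and>
     (\<forall>T\<in>length_trees.
        unordered (emb T) = T \<and>
        emb (prune T) = prune_plane (emb T) \<and>
        (\<forall>c>0. emb (map_utree (\<lambda>e. c * e) T) = map_tree (\<lambda>e. c * e) (emb T)))"

text \<open>The vector \<open>x\<^sub>T\<close>; \<^const>\<open>preorder\<close> lists the edges in depth-first order.\<close>

definition rel_lengths :: "(real utree \<Rightarrow> real tree) \<Rightarrow> real utree \<Rightarrow> nat \<Rightarrow> real" where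
  "rel_lengths emb T = (\<lambda>i\<in>{..<edge_count T}. preorder (emb T) ! i / tree_length T)"

abbreviation vec_space :: "unit utree \<Rightarrow> (nat \<Rightarrow> real) measure" where
  "vec_space \<tau> \<equiv> Pi\<^sub>M {..<edge_count \<tau>} (\<lambda>_. borel)"

text \<open>
  For a random tree \<open>T\<close> with law \<open>Q\<close>: given that the shape is \<open>\<tau>\<close>, the vector \<open>x\<^sub>T\<close> has law \<open>X\<close>,
  and given moreover \<open>x\<^sub>T = x\<close>, the length of \<open>T\<close> has density \<open>f x\<close>.
  (No condition if the shape \<open>\<tau>\<close> has probability zero.)
\<close>

definition has_conditional_laws ::
  "(real utree \<Rightarrow> real tree) \<Rightarrow> real utree measure \<Rightarrow> unit utree \<Rightarrow>
    (nat \<Rightarrow> real) measure \<Rightarrow> ((nat \<Rightarrow> real) \<Rightarrow> real \<Rightarrow> real) \<Rightarrow> bool" where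
  "has_conditional_laws emb Q \<tau> X f \<longleftrightarrow>
     (\<forall>A\<in>sets (vec_space \<tau>). \<forall>B\<in>sets borel.
        emeasure Q {T. shape T = \<tau> \<and> rel_lengths emb T \<in> A \<and> tree_length T \<in> B} =
        emeasure Q {T. shape T = \<tau>} *
          (\<integral>\<^sup>+x\<in>A. (\<integral>\<^sup>+y\<in>B. ennreal (f x y) \<partial>lborel) \<partial>X))"

definition conditional_density ::
  "unit utree \<Rightarrow> ((nat \<Rightarrow> real) \<Rightarrow> real \<Rightarrow> real) \<Rightarrow> bool" where
  "conditional_density \<tau> f \<longleftrightarrow>
     (\<lambda>(x, y). f x y) \<in> borel_measurable (vec_space \<tau> \<Otimes>\<^sub>M borel) \<and>
     (\<forall>x\<in>space (vec_space \<tau>).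
        (\<forall>y. 0 \<le> f x y) \<and> (\<integral>\<^sup>+y. ennreal (f x y) \<partial>lborel) = 1)"

text \<open>
  \<open>X \<tau>\<close> and \<open>F \<tau>\<close> are the conditional laws written \<open>\<chi>\<^sub>\<tau>\<close> and \<open>F\<^sub>\<tau>\<^sub>,\<^sub>x\<close> in the literature. Being
  conditional laws they are determined up to null sets, so that another law has ``the same''
  conditional laws iff \<open>X\<close> and \<open>F\<close> are versions of its conditional laws too.
  The empty tree has no edges and thus no density of its length, whence \<open>\<tau> \<noteq> \<phi>\<close>.
\<close>

definition self_similar ::
  "(real utree \<Rightarrow> real tree) \<Rightarrow> real utree measure \<Rightarrow> real \<Rightarrow> bool" where
  "self_similar emb P \<zeta> \<longleftrightarrow>
     tree_law P \<and> 0 < \<zeta> \<and>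
     (\<exists>X F.
        (\<forall>\<tau>. prob_space (X \<tau>) \<and> sets (X \<tau>) = sets (vec_space \<tau>) \<and> conditional_density \<tau> (F \<tau>)) \<and>
        (\<forall>\<tau>. \<tau> \<noteq> \<phi> \<longrightarrow> has_conditional_laws emb P \<tau> (X \<tau>) (F \<tau>)) \<and>
        \<comment> \<open>coordination of shapes and of lengths\<close>
        (\<forall>H K. 1 \<le> K \<longrightarrow> K \<le> H \<longrightarrow> 0 < measure P {T. tree_order T = H} \<longrightarrow>
           shape_law (complete_subtree_law (given_order P H) K) = shape_law (given_order P K) \<and>
           (\<forall>\<tau>. tree_order \<tau> = K \<longrightarrow>
              has_conditional_laws emb (complete_subtree_law (given_order P H) K) \<tau> (X \<tau>) (F \<tau>))) \<and>
        \<comment> \<open>prune-invariance of shapes\<close>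
        uniform_measure (distr (shape_law P) (count_space UNIV) prune) {\<tau>. \<tau> \<noteq> \<phi>} = shape_law P \<and>
        \<comment> \<open>scaling of lengths under pruning\<close>
        (\<forall>\<tau>. \<tau> \<noteq> \<phi> \<longrightarrow>
           has_conditional_laws emb (distr P utree_space prune) \<tau> (X \<tau>) (\<lambda>x y. F \<tau> x (y / \<zeta>) / \<zeta>)))"


section \<open>The critical binary Galton-Watson tree with exponential edge lengths\<close>

text \<open>
  Vertices are addressed by the path leading to them from the progenitor \<open>[]\<close>. The vertex at \<open>u\<close>
  splits iff \<open>c u\<close>, and its parental edge has length \<open>x u\<close>. If the family of a vertex is infinite,
  there is no such tree.
\<close>

inductive gw_family :: "(bool list \<Rightarrow> bool) \<Rightarrow> (bool list \<Rightarrow> real) \<Rightarrow> bool list \<Rightarrow> real tree \<Rightarrow> bool"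
  for c :: "bool list \<Rightarrow> bool" and x :: "bool list \<Rightarrow> real" where
  "\<not> c u \<Longrightarrow> gw_family c x u (Node Leaf (x u) Leaf)"
| "c u \<Longrightarrow> gw_family c x (u @ [False]) l \<Longrightarrow> gw_family c x (u @ [True]) r \<Longrightarrow>
     gw_family c x u (Node l (x u) r)"

text \<open>The default value for infinite families is used with probability zero only.\<close>

definition gw_tree :: "(bool list \<Rightarrow> bool) \<Rightarrow> (bool list \<Rightarrow> real) \<Rightarrow> real tree" where
  "gw_tree c x = (if \<exists>t. gw_family c x [] t then THE t. gw_family c x [] t else Leaf)"

definition gw_law :: "real \<Rightarrow> real utree measure" where
  "gw_law \<gamma> =
     distr
       (Pi\<^sub>M UNIV (\<lambda>_. measure_pmf (bernoulli_pmf (1 / 2))) \<Otimes>\<^sub>M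
        Pi\<^sub>M UNIV (\<lambda>_. density lborel (exponential_density (2 * \<gamma>))))
       utree_space (\<lambda>(c, x). unordered (gw_tree c x))"


section \<open>The hierarchical branching process\<close>

datatype event = Termination | Offspring nat

definition event_rate :: "(nat \<Rightarrow> real) \<Rightarrow> (nat \<Rightarrow> real) \<Rightarrow> nat \<Rightarrow> event \<Rightarrow> real" where
  "event_rate Tk lam j a =
     (case a of
        Termination \<Rightarrow> lam j
      | Offspring i \<Rightarrow> if 1 \<le> i \<and> i < j then lam j * Tk (j - i) else 0)"

text \<open>
  Every edge of the tree is a piece of a branch between two consecutive events. All possible events
  compete: \<open>\<omega> (u, j, a)\<close> is the waiting time, counted from the start of the edge at address \<open>u\<close>, until
  event \<open>a\<close> happens to the branch of order \<open>j\<close> passing through that edge, provided that there is one.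
  The waiting times are independent and exponential with the rates of the events; as these rates do
  not change in time, they start afresh with every edge. Events of rate zero never happen.
\<close>

definition hbp_space ::
  "(nat \<Rightarrow> real) \<Rightarrow> (nat \<Rightarrow> real) \<Rightarrow> (bool list \<times> nat \<times> event \<Rightarrow> real) measure" where
  "hbp_space Tk lam =
     Pi\<^sub>M {(u, j, a). 1 \<le> j \<and> 0 < event_rate Tk lam j a}
       (\<lambda>(u, j, a). density lborel (exponential_density (event_rate Tk lam j a)))"

definition first_event ::
  "(nat \<Rightarrow> real) \<Rightarrow> (nat \<Rightarrow> real) \<Rightarrow> (bool list \<times> nat \<times> event \<Rightarrow> real) \<Rightarrow>
    bool list \<Rightarrow> nat \<Rightarrow> event \<Rightarrow> bool" where
  "first_event Tk lam \<omega> u j a \<longleftrightarrow>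
     0 < event_rate Tk lam j a \<and>
     (\<forall>b. b \<noteq> a \<longrightarrow> 0 < event_rate Tk lam j b \<longrightarrow> \<omega> (u, j, a) < \<omega> (u, j, b))"

text \<open>
  \<open>history Tk lam \<omega> u j t\<close>: the edge at address \<open>u\<close> belongs to a branch of order \<open>j\<close>, and \<open>t\<close> is
  the tree consisting of this edge and everything that descends from it. After an offspring event
  the branch continues in the edge at \<open>u @ [False]\<close> and the new branch starts with the edge at
  \<open>u @ [True]\<close>.
\<close>

inductive history ::
  "(nat \<Rightarrow> real) \<Rightarrow> (nat \<Rightarrow> real) \<Rightarrow> (bool list \<times> nat \<times> event \<Rightarrow> real) \<Rightarrow>
    bool list \<Rightarrow> nat \<Rightarrow> real tree \<Rightarrow> bool"
  for Tk lam :: "nat \<Rightarrow> real" and \<omega> :: "bool list \<times> nat \<times> event \<Rightarrow> real" where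
  "first_event Tk lam \<omega> u 1 Termination \<Longrightarrow>
     history Tk lam \<omega> u 1 (Node Leaf (\<omega> (u, 1, Termination)) Leaf)"
| "first_event Tk lam \<omega> u j Termination \<Longrightarrow> 2 \<le> j \<Longrightarrow>
     history Tk lam \<omega> (u @ [False]) (j - 1) l \<Longrightarrow> history Tk lam \<omega> (u @ [True]) (j - 1) r \<Longrightarrow>
     history Tk lam \<omega> u j (Node l (\<omega> (u, j, Termination)) r)"
| "first_event Tk lam \<omega> u j (Offspring i) \<Longrightarrow>
     history Tk lam \<omega> (u @ [False]) j l \<Longrightarrow> history Tk lam \<omega> (u @ [True]) i r \<Longrightarrow>
     history Tk lam \<omega> u j (Node l (\<omega> (u, j, Offspring i)) r)"

text \<open>Again the default value is used with probability zero only.\<close>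

definition history_tree ::
  "(nat \<Rightarrow> real) \<Rightarrow> (nat \<Rightarrow> real) \<Rightarrow> (bool list \<times> nat \<times> event \<Rightarrow> real) \<Rightarrow> nat \<Rightarrow> real tree" where
  "history_tree Tk lam \<omega> K =
     (if \<exists>t. history Tk lam \<omega> [] K t then THE t. history Tk lam \<omega> [] K t else Leaf)"

definition hbp_law :: "nat pmf \<Rightarrow> (nat \<Rightarrow> real) \<Rightarrow> (nat \<Rightarrow> real) \<Rightarrow> real utree measure" where
  "hbp_law p Tk lam =
     measure_pmf p \<bind>
       (\<lambda>K. distr (hbp_space Tk lam) utree_space (\<lambda>\<omega>. unordered (history_tree Tk lam \<omega> K)))"


section \<open>Criticality and time-invariance\<close>

text \<open>Infinite matrices have rows and columns indexed by \<open>1, 2, \<dots>\<close>.\<close>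

definition generator :: "(nat \<Rightarrow> real) \<Rightarrow> nat \<Rightarrow> nat \<Rightarrow> real" where
  "generator Tk i j =
     (if j < i then 0 else if j = i then -1 else if j = i + 1 then Tk 1 + 2 else Tk (j - i))"

text \<open>
  Powers of an upper triangular matrix (the product is then a finite sum), and its exponential.
  The exponential series converges in each entry, since it only involves the finite block of rows
  and columns between \<open>i\<close> and \<open>j\<close>.
\<close>

primrec triangular_power :: "(nat \<Rightarrow> nat \<Rightarrow> real) \<Rightarrow> nat \<Rightarrow> nat \<Rightarrow> nat \<Rightarrow> real" where
  "triangular_power M 0 i j = (if i = j then 1 else 0)"
| "triangular_power M (Suc n) i j = (\<Sum>k\<in>{i..j}. M i k * triangular_power M n k j)"

definition triangular_exp :: "(nat \<Rightarrow> nat \<Rightarrow> real) \<Rightarrow> nat \<Rightarrow> nat \<Rightarrow> real" where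
  "triangular_exp M i j = (\<Sum>n. triangular_power M n i j / fact n)"

text \<open>\<open>x = exp (\<G> \<Lambda> s) \<pi>\<close>, including convergence of the matrix-vector product.\<close>

definition mean_branches ::
  "nat pmf \<Rightarrow> (nat \<Rightarrow> real) \<Rightarrow> (nat \<Rightarrow> real) \<Rightarrow> real \<Rightarrow> (nat \<Rightarrow> real) \<Rightarrow> bool" where
  "mean_branches p Tk lam s x \<longleftrightarrow>
     (\<forall>i\<ge>1. ((\<lambda>j. triangular_exp (\<lambda>a b. generator Tk a b * lam b * s) i j * pmf p j) has_sum x i) {1..})"

definition critical_hbp :: "nat pmf \<Rightarrow> (nat \<Rightarrow> real) \<Rightarrow> (nat \<Rightarrow> real) \<Rightarrow> bool" where
  "critical_hbp p Tk lam \<longleftrightarrow>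
     (\<forall>s\<ge>0. \<exists>x. mean_branches p Tk lam s x \<and> ((\<lambda>i. \<bar>x i\<bar>) has_sum 1) {1..})"

definition time_invariant_hbp :: "nat pmf \<Rightarrow> (nat \<Rightarrow> real) \<Rightarrow> (nat \<Rightarrow> real) \<Rightarrow> bool" where
  "time_invariant_hbp p Tk lam \<longleftrightarrow> (\<forall>s\<ge>0. mean_branches p Tk lam s (pmf p))"


section \<open>Growth rate and Horton exponent of the Tokunaga sequence\<close>

definition tokunaga_L :: "(nat \<Rightarrow> real) \<Rightarrow> ereal" where
  "tokunaga_L Tk = limsup (\<lambda>k. ereal (root k (Tk k)))"

definition t_hat :: "(nat \<Rightarrow> real) \<Rightarrow> real \<Rightarrow> real" where
  "t_hat Tk z = - 1 + 2 * z + (\<Sum>j. z ^ Suc j * Tk (Suc j))"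

definition horton_root :: "(nat \<Rightarrow> real) \<Rightarrow> real \<Rightarrow> bool" where
  "horton_root Tk w \<longleftrightarrow> 0 < w \<and> w \<le> 1 / 2 \<and> ereal w < 1 / tokunaga_L Tk \<and> t_hat Tk w = 0"

definition horton_R :: "(nat \<Rightarrow> real) \<Rightarrow> real" where
  "horton_R Tk = inverse (THE w. horton_root Tk w)"


section \<open>Existence of a proper embedding\<close>

text \<open>
  Two sibling subtrees \<open>s\<close> and \<open>t\<close> are put in the order of the first difference
  between \<open>(\<dots>, R (R s), R s, s)\<close> and \<open>(\<dots>, R (R t), R t, t)\<close>, where \<open>R\<close> is pruning and
  trees are compared through a planar normal form. If \<open>R s\<close> and \<open>R t\<close> differ, their order
  is thus that of \<open>s\<close> and \<open>t\<close>, which makes the embedding commute with pruning.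
\<close>

primrec label_at :: "bool list \<Rightarrow> real tree \<Rightarrow> ereal" where
  "label_at [] t = (case t of Leaf \<Rightarrow> -\<infinity> | Node l e r \<Rightarrow> ereal e)"
| "label_at (b # u) t = (case t of Leaf \<Rightarrow> -\<infinity> | Node l e r \<Rightarrow> label_at u (if b then r else l))"

lemma label_at_Leaf [simp]: "label_at u Leaf = -\<infinity>"
  by (cases u) auto

lemma label_at_eqD: "(\<And>u. label_at u s = label_at u t) \<Longrightarrow> s = t"
proof (induction s arbitrary: t)
  case Leaf
  have "label_at [] Leaf = label_at [] t" by (rule Leaf)
  then show ?case by (cases t) auto
next
  case (Node l e r)
  obtain l' e' r' where t: "t = Node l' e' r'" using Node.prems[of "[]"] by (cases t) auto
  have "label_at u l = label_at u l'" "label_at u r = label_at u r'" for u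
    using Node.prems[of "False # u"] Node.prems[of "True # u"] t by auto
  then have "l = l'" "r = r'" by (blast intro: Node.IH)+
  then show ?case using Node.prems[of "[]"] t by simp
qed

definition tree_less :: "real tree \<Rightarrow> real tree \<Rightarrow> bool" where
  "tree_less s t \<longleftrightarrow> (\<exists>n. (\<forall>i<n. label_at (from_nat i) s = label_at (from_nat i) t) \<and>
     label_at (from_nat n) s < label_at (from_nat n) t)"

lemma tree_less_asym: "tree_less s t \<Longrightarrow> \<not> tree_less t s"
  unfolding tree_less_def by (metis less_asym linorder_neqE_nat order_less_irrefl)

lemma tree_less_total: "s \<noteq> t \<Longrightarrow> tree_less s t \<or> tree_less t s"
proof -
  assume "s \<noteq> t"
  then obtain u where "label_at u s \<noteq> label_at u t" using label_at_eqD by blast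
  then have ex: "\<exists>n. label_at (from_nat n) s \<noteq> label_at (from_nat n) t" by (metis from_nat_to_nat)
  define n where "n = (LEAST n. label_at (from_nat n) s \<noteq> label_at (from_nat n) t)"
  have "label_at (from_nat n) s \<noteq> label_at (from_nat n) t" unfolding n_def by (rule LeastI_ex[OF ex])
  moreover have "\<forall>i<n. label_at (from_nat i) s = label_at (from_nat i) t"
    unfolding n_def using not_less_Least by blast
  ultimately show ?thesis unfolding tree_less_def by (metis linorder_less_linear)
qed

primrec sort_plane :: "real tree \<Rightarrow> real tree" where
  "sort_plane Leaf = Leaf"
| "sort_plane (Node l e r) =
    (if tree_less (sort_plane r) (sort_plane l)
     then Node (sort_plane r) e (sort_plane l) else Node (sort_plane l) e (sort_plane r))"

lemma swap_iso_sort: "swap_iso (sort_plane t) t"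
  by (induction t) (auto intro: swap_iso.intros)

lemma sort_plane_cong: "swap_iso s t \<Longrightarrow> sort_plane s = sort_plane t"
proof (induction rule: swap_iso.induct)
  case (3 l r' r l' e)
  then show ?case using tree_less_asym tree_less_total by (auto)
qed auto

lemma sort_plane_eq_iff: "sort_plane s = sort_plane t \<longleftrightarrow> swap_iso s t"
  by (metis sort_plane_cong swap_iso_sort swap_iso_sym swap_iso_trans)

definition sort_level :: "nat \<Rightarrow> real tree \<Rightarrow> real tree" where
  "sort_level m t = sort_plane ((prune_plane ^^ m) t)"

definition prune_less :: "real tree \<Rightarrow> real tree \<Rightarrow> bool" where
  "prune_less s t \<longleftrightarrow>
     (\<exists>m. (\<forall>k>m. sort_level k s = sort_level k t) \<and> tree_less (sort_level m s) (sort_level m t))"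

lemma swap_iso_prune: "swap_iso s t \<Longrightarrow> swap_iso (prune_plane s) (prune_plane t)"
  unfolding prune_plane_def by (intro swap_iso_series_reduce swap_iso_cut_leaves)

lemma swap_iso_prune_pow: "swap_iso s t \<Longrightarrow> swap_iso ((prune_plane ^^ m) s) ((prune_plane ^^ m) t)"
  by (induction m) (auto intro: swap_iso_prune)

lemma sort_level_cong: "swap_iso s t \<Longrightarrow> sort_level m s = sort_level m t"
  unfolding sort_level_def by (intro sort_plane_cong swap_iso_prune_pow)

lemma prune_less_cong: "swap_iso s s' \<Longrightarrow> swap_iso t t' \<Longrightarrow> prune_less s t \<longleftrightarrow> prune_less s' t'"
  unfolding prune_less_def by (simp add: sort_level_cong)

lemma size_cut_leaves: "size (cut_leaves t) \<le> size t \<and> (t \<noteq> Leaf \<longrightarrow> size (cut_leaves t) < size t)"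
  by (induction t) auto

lemma size_series_reduce: "size (series_reduce t) \<le> size t"
proof (induction t)
  case (Node l e r)
  then show ?case by (cases "series_reduce l"; cases "series_reduce r") auto
qed auto

lemma size_prune: "size (prune_plane t) \<le> size t - 1"
  unfolding prune_plane_def
  by (cases "t = Leaf") (use size_cut_leaves[of t] size_series_reduce[of "cut_leaves t"] in auto)

lemma prune_pow_Leaf: "size t \<le> m \<Longrightarrow> (prune_plane ^^ m) t = Leaf"
proof -
  have "size ((prune_plane ^^ m) t) \<le> size t - m" for m
  proof (induction m)
    case (Suc m)
    then show ?case using size_prune[of "(prune_plane ^^ m) t"] by simp
  qed simp
  from this[of m] show "size t \<le> m \<Longrightarrow> ?thesis" by simp
qed

lemma prune_less_asym: "prune_less s t \<Longrightarrow> \<not> prune_less t s"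
  unfolding prune_less_def by (metis tree_less_asym linorder_neqE_nat)

lemma prune_less_total:
  assumes "\<not> swap_iso s t"
  shows "prune_less s t \<or> prune_less t s"
proof -
  define D where "D = {m. sort_level m s \<noteq> sort_level m t}"
  have "sort_level m s = sort_level m t" if "size s + size t \<le> m" for m
    using that unfolding sort_level_def by (simp add: prune_pow_Leaf)
  then have "D \<subseteq> {..<size s + size t}"
    unfolding D_def by (metis (mono_tags, lifting) lessThan_iff linorder_not_le mem_Collect_eq subsetI)
  then have fin: "finite D" by (rule finite_subset) simp
  have "0 \<in> D" using assms by (simp add: D_def sort_level_def sort_plane_eq_iff)
  then have "Max D \<in> D" using fin by (intro Max_in) auto
  then have "sort_level (Max D) s \<noteq> sort_level (Max D) t" by (simp add: D_def)
  moreover have "sort_level k s = sort_level k t" if "k > Max D" for k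
    using that Max_ge[OF fin, of k] unfolding D_def by fastforce
  ultimately show ?thesis using tree_less_total unfolding prune_less_def by metis
qed

lemma prune_less_prune: "prune_less (prune_plane s) (prune_plane t) \<Longrightarrow> prune_less s t"
proof -
  assume "prune_less (prune_plane s) (prune_plane t)"
  moreover have "sort_level k (prune_plane s) = sort_level (Suc k) s" for k s
    by (simp add: sort_level_def funpow_swap1)
  ultimately obtain m where "\<forall>k>m. sort_level (Suc k) s = sort_level (Suc k) t"
    "tree_less (sort_level (Suc m) s) (sort_level (Suc m) t)"
    unfolding prune_less_def by auto
  then show ?thesis unfolding prune_less_def
    by (intro exI[of _ "Suc m"]) (metis Suc_lessE)
qed

primrec embed_plane :: "real tree \<Rightarrow> real tree" where
  "embed_plane Leaf = Leaf"
| "embed_plane (Node l e r) =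
    (if prune_less r l then Node (embed_plane r) e (embed_plane l)
     else Node (embed_plane l) e (embed_plane r))"

lemma swap_iso_embed: "swap_iso (embed_plane t) t"
  by (induction t) (auto intro: swap_iso.intros)

lemma embed_Leaf_iff [simp]: "embed_plane t = Leaf \<longleftrightarrow> t = Leaf"
  by (cases t) auto

lemma embed_plane_cong: "swap_iso s t \<Longrightarrow> embed_plane s = embed_plane t"
proof (induction s arbitrary: t)
  case Leaf
  then show ?case by simp
next
  case (Node l e r)
  from Node.prems show ?case
  proof (cases rule: swap_iso.cases)
    case (2 l' r')
    have "embed_plane l = embed_plane l'" "embed_plane r = embed_plane r'"
      using 2 Node.IH by blast+
    then show ?thesis using 2(1) by (simp add: prune_less_cong[OF 2(3,2)])
  next
    case (3 r' l')
    have 1: "prune_less r l \<longleftrightarrow> prune_less l' r'" "prune_less l r \<longleftrightarrow> prune_less r' l'"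
      using 3 prune_less_cong by blast+
    have 2: "embed_plane l = embed_plane r'" "embed_plane r = embed_plane l'"
      using 3 Node.IH by blast+
    have eq: "embed_plane l = embed_plane r" if "\<not> prune_less r l" "\<not> prune_less l r"
      using that prune_less_total Node.IH(1) by blast
    have asym: "\<not> (prune_less r l \<and> prune_less l r)"
      using prune_less_asym by blast
    show ?thesis
    proof (cases "prune_less r l")
      case True
      then have "\<not> prune_less r' l'" using asym 1(2) by simp
      then show ?thesis using True 2 3(1) by simp
    next
      case False
      then show ?thesis using eq 2 1(2) 3(1) by (cases "prune_less l r") simp_all
    qed
  qed
qed

lemma embed_prune:
  "reduced_plane t \<Longrightarrow> embed_plane (prune_plane t) = prune_plane (embed_plane t)"
proof (induction t)
  case Leaf
  show ?case by (simp add: prune_plane_def)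
next
  case (Node l e r)
  show ?case
  proof (cases "l = Leaf")
    case True
    then show ?thesis using Node.prems by (auto simp: prune_plane_def)
  next
    case False
    with Node.prems have ne: "l \<noteq> Leaf" "r \<noteq> Leaf" by auto
    have P: "prune_plane (Node s e t) = attach e (prune_plane s) (prune_plane t)"
      if "s \<noteq> Leaf" for s t
      using that by (simp add: prune_plane_def)
    have IH: "prune_plane (embed_plane l) = embed_plane (prune_plane l)"
      "prune_plane (embed_plane r) = embed_plane (prune_plane r)"
      using Node by auto
    have E: "prune_plane (embed_plane (Node l e r)) =
      (if prune_less r l then attach e (embed_plane (prune_plane r)) (embed_plane (prune_plane l))
       else attach e (embed_plane (prune_plane l)) (embed_plane (prune_plane r)))"
      using ne by (simp add: P IH)
    show ?thesis
    proof (cases "prune_plane l = Leaf \<or> prune_plane r = Leaf")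
      case True
      then show ?thesis unfolding E P[OF ne(1)]
        by (cases "prune_plane l"; cases "prune_plane r") auto
    next
      case False
      have A: "attach e s t = Node s e t" if "s \<noteq> Leaf" "t \<noteq> Leaf" for s t :: "real tree"
        using that by (cases s; cases t) auto
      have "prune_less r l = prune_less (prune_plane r) (prune_plane l) \<or>
        embed_plane (prune_plane l) = embed_plane (prune_plane r)"
        by (metis embed_plane_cong prune_less_asym prune_less_prune prune_less_total)
      then show ?thesis unfolding E P[OF ne(1)] using False by (auto simp: A)
    qed
  qed
qed

lemma label_at_scale: "0 < c \<Longrightarrow> label_at u (map_tree (\<lambda>e. c * e) t) = ereal c * label_at u t"
  by (induction u arbitrary: t) (auto split: tree.split)

lemma tree_less_scale:
  "0 < c \<Longrightarrow> tree_less (map_tree (\<lambda>e. c * e) s) (map_tree (\<lambda>e. c * e) t) \<longleftrightarrow> tree_less s t"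
proof -
  assume c: "0 < c"
  have 1: "ereal c * x < ereal c * y \<longleftrightarrow> x < y" for x y
    using c by (cases x; cases y) auto
  have 2: "ereal c * x = ereal c * y \<longleftrightarrow> x = y" for x y
    using c by (cases x; cases y) auto
  show ?thesis using c by (simp add: tree_less_def label_at_scale 1 2)
qed

lemma sort_scale: "0 < c \<Longrightarrow> sort_plane (map_tree (\<lambda>e. c * e) t) = map_tree (\<lambda>e. c * e) (sort_plane t)"
  by (induction t) (auto simp: tree_less_scale)

lemma cut_scale: "cut_leaves (map_tree f t) = map_tree f (cut_leaves t)"
  by (induction t) auto

lemma attach_scale:
  "attach (c * e) (map_tree (\<lambda>e. c * e) l) (map_tree (\<lambda>e. c * e) r) =
   map_tree (\<lambda>e. c * e) (attach (e::real) l r)"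
  by (cases l; cases r) (auto simp: algebra_simps)

lemma prune_scale:
  "prune_plane (map_tree (\<lambda>e. (c::real) * e) t) = map_tree (\<lambda>e. c * e) (prune_plane t)"
proof -
  have "series_reduce (map_tree (\<lambda>e. c * e) t) = map_tree (\<lambda>e. c * e) (series_reduce t)" for t
    by (induction t) (auto simp: attach_scale)
  then show ?thesis by (simp add: prune_plane_def cut_scale)
qed

lemma sort_level_scale:
  "0 < c \<Longrightarrow> sort_level m (map_tree (\<lambda>e. c * e) t) = map_tree (\<lambda>e. c * e) (sort_level m t)"
proof -
  assume c: "0 < c"
  have "(prune_plane ^^ m) (map_tree (\<lambda>e. c * e) t) = map_tree (\<lambda>e. c * e) ((prune_plane ^^ m) t)"
    by (induction m) (auto simp: prune_scale)
  then show ?thesis by (simp add: sort_level_def sort_scale[OF c])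
qed

lemma embed_scale: "0 < c \<Longrightarrow> embed_plane (map_tree (\<lambda>e. c * e) t) = map_tree (\<lambda>e. c * e) (embed_plane t)"
proof (induction t)
  case (Node l e r)
  have "inj (map_tree (\<lambda>e. c * e))" using Node.prems by (intro tree.inj_map) (auto simp: inj_def)
  then have "prune_less (map_tree (\<lambda>e. c * e) r) (map_tree (\<lambda>e. c * e) l) = prune_less r l"
    using Node.prems by (simp add: prune_less_def sort_level_scale tree_less_scale inj_eq)
  then show ?case using Node by simp
qed simp

lemma measurable_label_at [measurable]: "label_at u \<in> borel_measurable plane_space"
proof (induction u)
  case Nil
  show ?case unfolding label_at.simps by measurable
next
  case (Cons b u)
  note Cons[measurable]
  show ?case unfolding label_at.simps by (cases b) (simp_all, measurable)
qed

lemma measurable_tree_less [measurable]: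
  assumes [measurable]: "f \<in> M \<rightarrow>\<^sub>M plane_space" "g \<in> M \<rightarrow>\<^sub>M plane_space"
  shows "Measurable.pred M (\<lambda>x. tree_less (f x) (g x))"
  unfolding tree_less_def by measurable

lemma tree_eq_label: "s = t \<longleftrightarrow> (\<forall>n. label_at (from_nat n) s = label_at (from_nat n) t)"
  by (metis label_at_eqD from_nat_to_nat)

lemma measurable_tree_eq [measurable]:
  assumes [measurable]: "f \<in> M \<rightarrow>\<^sub>M plane_space" "g \<in> M \<rightarrow>\<^sub>M plane_space"
  shows "Measurable.pred M (\<lambda>x. f x = g x)"
  unfolding tree_eq_label by measurable

lemma measurable_sort [measurable]: "sort_plane \<in> plane_space \<rightarrow>\<^sub>M plane_space"
  unfolding sort_plane_def by measurable

lemma measurable_cut [measurable]: "cut_leaves \<in> plane_space \<rightarrow>\<^sub>M plane_space"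
  unfolding cut_leaves_def by measurable

lemma attach_case:
  "attach e l r = (case l of
     Leaf \<Rightarrow> (case r of Leaf \<Rightarrow> Node Leaf e Leaf | Node a x b \<Rightarrow> Node a (e + x) b)
   | Node a x b \<Rightarrow> (case r of Leaf \<Rightarrow> Node a (e + x) b | Node _ _ _ \<Rightarrow> Node l e r))"
  by (cases l; cases r) auto

lemma measurable_attach [measurable]:
  assumes [measurable]: "h \<in> borel_measurable M" "f \<in> M \<rightarrow>\<^sub>M plane_space" "g \<in> M \<rightarrow>\<^sub>M plane_space"
  shows "(\<lambda>x. attach (h x) (f x) (g x)) \<in> M \<rightarrow>\<^sub>M plane_space"
  unfolding attach_case by measurable

lemma measurable_series [measurable]: "series_reduce \<in> plane_space \<rightarrow>\<^sub>M plane_space"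
  unfolding series_reduce_def by measurable

lemma measurable_prune_plane [measurable]: "prune_plane \<in> plane_space \<rightarrow>\<^sub>M plane_space"
  unfolding prune_plane_def by measurable

lemma measurable_sort_level [measurable]: "sort_level m \<in> plane_space \<rightarrow>\<^sub>M plane_space"
  unfolding sort_level_def by measurable

lemma measurable_prune_less [measurable]:
  assumes [measurable]: "f \<in> M \<rightarrow>\<^sub>M plane_space" "g \<in> M \<rightarrow>\<^sub>M plane_space"
  shows "Measurable.pred M (\<lambda>x. prune_less (f x) (g x))"
  unfolding prune_less_def by measurable

lemma measurable_embed [measurable]: "embed_plane \<in> plane_space \<rightarrow>\<^sub>M plane_space"
  unfolding embed_plane_def by measurable

lift_definition embed :: "real utree \<Rightarrow> real tree" is embed_plane
  by (rule embed_plane_cong)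

lemma sets_utree_space: "sets utree_space = {A :: real utree set. unordered -` A \<in> sets plane_space}"
proof -
  have space: "space plane_space = UNIV" by (simp add: space_tree_sigma)
  have "sigma_algebra UNIV {A :: real utree set. unordered -` A \<in> sets plane_space}"
    unfolding sigma_algebra_iff2
  proof (intro conjI ballI allI impI)
    fix A :: "real utree set" assume "A \<in> {A. unordered -` A \<in> sets plane_space}"
    then have "space plane_space - unordered -` A \<in> sets plane_space" by (intro sets.compl_sets) simp
    then show "UNIV - A \<in> {A. unordered -` A \<in> sets plane_space}" by (simp add: space vimage_Diff)
  next
    fix A :: "nat \<Rightarrow> real utree set" assume "range A \<subseteq> {A. unordered -` A \<in> sets plane_space}"
    then have "(\<Union>i. unordered -` A i) \<in> sets plane_space" by (intro sets.countable_UN) auto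
    then show "(\<Union>i. A i) \<in> {A. unordered -` A \<in> sets plane_space}" by (simp add: vimage_UN)
  qed auto
  then show ?thesis unfolding utree_space_def by (rule sigma_algebra.sets_measure_of_eq)
qed

lemma measurable_embed_utree: "embed \<in> utree_space \<rightarrow>\<^sub>M plane_space"
proof (rule measurableI)
  fix A assume "A \<in> sets plane_space"
  moreover have "unordered -` (embed -` A) = embed_plane -` A \<inter> space plane_space"
    by (auto simp: embed.abs_eq space_tree_sigma)
  ultimately show "embed -` A \<inter> space utree_space \<in> sets utree_space"
    using measurable_sets[OF measurable_embed] by (simp add: sets_utree_space utree_space_def)
qed (simp add: space_tree_sigma)

lemma proper_embedding_exists: "\<exists>emb. proper_embedding emb"
proof
  show "proper_embedding embed"
    unfolding proper_embedding_def
  proof (intro conjI ballI allI impI)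
    show "embed \<in> utree_space \<rightarrow>\<^sub>M plane_space" by (rule measurable_embed_utree)
  next
    fix T assume "T \<in> length_trees"
    moreover obtain t where T: "T = unordered t" using Quotient_abs_rep[OF Quotient_utree] by metis
    ultimately have red: "reduced_plane t" by (simp add: length_trees_def reduced.abs_eq)
    show "unordered (embed T) = T"
      by (simp add: T embed.abs_eq utree.abs_eq_iff swap_iso_embed)
    show "embed (prune T) = prune_plane (embed T)"
      by (simp add: T embed.abs_eq prune.abs_eq embed_prune red)
    fix c :: real assume "0 < c"
    then show "embed (map_utree (\<lambda>e. c * e) T) = map_tree (\<lambda>e. c * e) (embed T)"
      by (simp add: T embed.abs_eq map_utree.abs_eq embed_scale)
  qed
qed

end

theory Submission
  imports Defs
begin

text \<open>
  A branch of order \<open>j\<close> experiences events at total rate \<open>2 \<gamma>\<close>; the next event is the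
  termination with probability \<open>2\<^sup>1\<^sup>-\<^sup>j\<close> and an offspring of order \<open>i < j\<close> with probability
  \<open>2\<^sup>-\<^sup>i\<close>. Mixing over the root order with weights \<open>2\<^sup>-\<^sup>K\<close>, an edge thus ends in a leaf with
  probability \<open>1/2\<close>, and otherwise the pair of subtrees has, up to swapping, the product of two
  copies of the mixture as its law: termination of order \<open>j + 1\<close> contributes the diagonal
  \<open>(j, j)\<close>, offspring events contribute the off-diagonal pairs. This is the recursion of the
  Galton-Watson tree.

  Self-similarity is proved for the Galton-Watson tree. Given its shape, the edge lengths have a
  density that depends on their sum only, which makes the total length independent of all
  scale-invariant quantities. Given everything outside the complete subtrees of order \<open>K\<close>, these
  are independent copies of the tree conditioned to have order \<open>K\<close>. Pruning leaves a nonempty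
  tree with probability \<open>1/2\<close>, which then is the original tree with all lengths doubled, because
  an edge of the pruned tree is a geometric sum of exponential edges.
\<close>

section \<open>Orders of reduced trees\<close>

text \<open>The two laws agree only after the planar embedding is forgotten, since the branching
  process always continues a branch on the left; they are therefore compared on swap-invariant
  functions of planar trees. Both constructions give the value \<open>Leaf\<close> to infinite
  families. Such outcomes are carried along by an absorbing grafting operation until their
  probability turns out to be zero, and the common recursion is exploited by induction on a bound
  for the height. Pruning defeats that induction: when one of the two subtrees at the root
  disappears, the result is the other pruned subtree with a longer root edge, which need not be
  simpler. Induction on the size of the unpruned tree yields an inequality only; comparison of total
  masses makes it an equality. Criticality and time-invariance both rest on
  \<open>lam k * pmf p k\<close> being proportional to \<open>(1 / 4) ^ k\<close>, where 1/4 is the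
  zero of \<open>t_hat\<close>: the generator annihilates this vector, and what remains is the
  convergence of double series.\<close>

primrec strahler :: "'e tree \<Rightarrow> nat" where
  "strahler Leaf = 0"
| "strahler (Node l e r) =
    (if strahler l = strahler r then Suc (strahler l) else max (strahler l) (strahler r))"

lemma strahler_eq_0_iff [simp]: "strahler t = 0 \<longleftrightarrow> t = Leaf"
  by (cases t) (auto simp: max_def)

lemma strahler_map_tree [simp]: "strahler (map_tree f t) = strahler t"
  by (induction t) auto

lemma reduced_plane_map_tree [simp]: "reduced_plane (map_tree f t) \<longleftrightarrow> reduced_plane t"
  by (induction t) auto

text \<open>Merging a vertex with its only child keeps the order, and since \<open>Leaf\<close> has
  order 0 the recursion for \<open>Node\<close> returns the same value. Series reduction is thus
  invisible to orders.\<close>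

lemma strahler_attach: "strahler (attach e l r) = strahler (Node l e r)"
  by (cases l; cases r) auto

lemma reduced_plane_attach:
  "reduced_plane l \<Longrightarrow> reduced_plane r \<Longrightarrow> reduced_plane (attach e l r)"
  by (cases l; cases r) auto

lemma prune_plane_simps [simp]:
  "prune_plane Leaf = Leaf"
  "prune_plane (Node Leaf e Leaf) = Leaf"
  "l \<noteq> Leaf \<Longrightarrow> prune_plane (Node l e r) = attach e (prune_plane l) (prune_plane r)"
  by (auto simp: prune_plane_def)

text \<open>In a reduced tree both children of an inner vertex have order at least 1. Hence the
  truncated subtraction loses nothing and equality of the two orders survives pruning.\<close>

lemma strahler_prune: "reduced_plane t \<Longrightarrow> strahler (prune_plane t) = strahler t - 1"
proof (induction t)
  case (Node l e r)
  show ?case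
  proof (cases "l = Leaf")
    case False
    then have ne: "l \<noteq> Leaf" "r \<noteq> Leaf" using Node.prems by auto
    then have "0 < strahler l" "0 < strahler r" by (metis gr0I strahler_eq_0_iff)+
    moreover have "strahler (prune_plane l) = strahler l - 1" "strahler (prune_plane r) = strahler r - 1"
      using Node by auto
    ultimately show ?thesis using ne by (simp add: strahler_attach max_def del: strahler_eq_0_iff) linarith
  qed (use Node.prems in auto)
qed simp

lemma reduced_plane_prune: "reduced_plane t \<Longrightarrow> reduced_plane (prune_plane t)"
proof (induction t)
  case (Node l e r)
  then show ?case by (cases "l = Leaf") (auto intro: reduced_plane_attach)
qed simp

lemma prune_plane_eq_Leaf_iff:
  "reduced_plane t \<Longrightarrow> prune_plane t = Leaf \<longleftrightarrow> strahler t \<le> 1"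
  using strahler_prune[of t] strahler_eq_0_iff[of "prune_plane t"] by auto

lemma prune_pow_unordered: "(prune ^^ k) (unordered t) = unordered ((prune_plane ^^ k) t)"
  by (induction k) (auto simp: prune.abs_eq)

lemma unordered_eq_phi_iff [simp]: "unordered t = \<phi> \<longleftrightarrow> t = Leaf"
  by (auto simp: empty_tree_def utree.abs_eq_iff)

text \<open>Each pruning lowers the Strahler number by one until the tree is empty, so this number
  counts the prunings. It makes orders computable by recursion on planar representatives.\<close>

lemma tree_order_unordered: "reduced_plane t \<Longrightarrow> tree_order (unordered t) = strahler t"
proof -
  assume t: "reduced_plane t"
  have "reduced_plane ((prune_plane ^^ k) t) \<and> strahler ((prune_plane ^^ k) t) = strahler t - k" for k
    by (induction k) (auto simp: t reduced_plane_prune strahler_prune)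
  then have "(prune_plane ^^ k) t = Leaf \<longleftrightarrow> strahler t \<le> k" for k
    using strahler_eq_0_iff[of "(prune_plane ^^ k) t"] by simp
  then show ?thesis unfolding tree_order_def prune_pow_unordered unordered_eq_phi_iff
    by (simp add: Least_equality)
qed

lemma unordered_surj: obtains t where "T = unordered t"
  using Quotient_abs_rep[OF Quotient_utree] by metis

lemma reduced_unordered [simp]: "reduced (unordered t) = reduced_plane t"
  by (rule reduced.abs_eq)

lemma prune_plane_map_shape:
  "prune_plane (map_tree (\<lambda>_. ()) t) = map_tree (\<lambda>_. ()) (prune_plane t)"
proof -
  have "attach () (map_tree (\<lambda>_. ()) l) (map_tree (\<lambda>_. ()) r) = map_tree (\<lambda>_. ()) (attach e l r)"
    for l r and e :: 'a
    by (cases l; cases r) auto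
  then have "series_reduce (map_tree (\<lambda>_. ()) t) = map_tree (\<lambda>_. ()) (series_reduce t)" for t :: "'a tree"
    by (induction t) auto
  moreover have "cut_leaves (map_tree (\<lambda>_. ()) t) = map_tree (\<lambda>_. ()) (cut_leaves t)"
    by (induction t) auto
  ultimately show ?thesis by (simp add: prune_plane_def)
qed

lemma shape_prune: "shape (prune T) = prune (shape T)"
  by (rule unordered_surj[of T]) (simp add: map_utree.abs_eq prune.abs_eq prune_plane_map_shape)

lemma shape_eq_phi_iff [simp]: "shape T = \<phi> \<longleftrightarrow> T = \<phi>"
  by (rule unordered_surj[of T]) (simp add: map_utree.abs_eq)

lemma tree_order_shape [simp]: "tree_order (shape T) = tree_order T"
proof -
  have "(prune ^^ k) (shape T) = shape ((prune ^^ k) T)" for k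
    by (induction k) (simp_all add: shape_prune)
  then show ?thesis unfolding tree_order_def by simp
qed

lemma edge_count_shape [simp]: "edge_count (shape T) = edge_count T"
  by (rule unordered_surj[of T]) (simp add: map_utree.abs_eq edge_count.abs_eq)

section \<open>Measurability\<close>

lemma space_plane [simp]: "space plane_space = UNIV"
  by (simp add: space_tree_sigma)

lemma space_utree [simp]: "space utree_space = UNIV"
  by (simp add: utree_space_def)

lemma measurable_unordered [measurable]: "unordered \<in> plane_space \<rightarrow>\<^sub>M utree_space"
  by (rule measurableI) (auto simp: sets_utree_space)

text \<open>\<open>utree_space\<close> carries the quotient sigma-algebra, so measurability is
  tested on planar representatives.\<close>

lemma measurable_utree_iff: "f \<in> utree_space \<rightarrow>\<^sub>M M \<longleftrightarrow> (\<lambda>t. f (unordered t)) \<in> plane_space \<rightarrow>\<^sub>M M"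
proof
  assume "f \<in> utree_space \<rightarrow>\<^sub>M M"
  from measurable_compose[OF measurable_unordered this] show "(\<lambda>t. f (unordered t)) \<in> plane_space \<rightarrow>\<^sub>M M" .
next
  assume f: "(\<lambda>t. f (unordered t)) \<in> plane_space \<rightarrow>\<^sub>M M"
  show "f \<in> utree_space \<rightarrow>\<^sub>M M"
  proof (rule measurableI)
    fix T show "f T \<in> space M" using measurable_space[OF f] by (cases T rule: unordered_surj) auto
  next
    fix A assume "A \<in> sets M"
    from measurable_sets[OF f this] show "f -` A \<inter> space utree_space \<in> sets utree_space"
      by (simp add: sets_utree_space vimage_def)
  qed
qed

abbreviation plane_shape :: "'e tree \<Rightarrow> unit tree" where
  "plane_shape \<equiv> map_tree (\<lambda>_. ())"

text \<open>\<open>map_tree\<close> comes from the datatype construction; as an instance of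
  \<open>rec_tree\<close> it is covered by the measurability rule for recursion on trees.\<close>

lemma map_tree_rec: "map_tree f = rec_tree Leaf (\<lambda>l v r l' r'. Node l' (f v) r')"
proof
  show "map_tree f t = rec_tree Leaf (\<lambda>l v r l' r'. Node l' (f v) r') t" for t
    by (induction t) auto
qed

lemma measurable_plane_shape [measurable]: "plane_shape \<in> plane_space \<rightarrow>\<^sub>M count_space UNIV"
  unfolding map_tree_rec by measurable

lemma shape_unordered: "shape (unordered t) = unordered (plane_shape t)"
  by (rule map_utree.abs_eq)

lemma measurable_shape [measurable]: "shape \<in> utree_space \<rightarrow>\<^sub>M count_space UNIV"
  unfolding measurable_utree_iff shape_unordered by measurable

lemma strahler_plane_shape: "strahler (plane_shape t) = strahler t"
  by simp

text \<open>The shape is a measurable map into a discrete space, so everything computed from it is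
  measurable.\<close>

lemma measurable_of_plane_shape:
  assumes "\<And>t. f t = g (plane_shape t)"
  shows "f \<in> plane_space \<rightarrow>\<^sub>M count_space UNIV"
  unfolding assms by measurable

lemma measurable_strahler [measurable]: "strahler \<in> plane_space \<rightarrow>\<^sub>M count_space UNIV"
  by (rule measurable_of_plane_shape[where g = strahler]) simp

lemma measurable_size_tree [measurable]: "size \<in> plane_space \<rightarrow>\<^sub>M count_space UNIV"
  by (rule measurable_of_plane_shape[where g = size]) simp

lemma measurable_reduced_plane [measurable]: "Measurable.pred plane_space reduced_plane"
  by (rule measurable_of_plane_shape[where g = reduced_plane]) simp

lemma measurable_tree_order [measurable]: "tree_order \<in> utree_space \<rightarrow>\<^sub>M count_space UNIV"
proof -
  have "(\<lambda>T. tree_order (shape T)) \<in> utree_space \<rightarrow>\<^sub>M count_space UNIV"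
    by (rule measurable_compose[OF measurable_shape]) simp
  then show ?thesis by simp
qed

lemma measurable_prune [measurable]: "prune \<in> utree_space \<rightarrow>\<^sub>M utree_space"
  unfolding measurable_utree_iff prune.abs_eq by measurable

lemma measurable_map_tree [measurable]:
  assumes "f \<in> borel \<rightarrow>\<^sub>M borel" shows "map_tree f \<in> plane_space \<rightarrow>\<^sub>M plane_space"
  unfolding map_tree_rec using assms[measurable] by measurable

lemma measurable_map_utree [measurable]:
  assumes "f \<in> borel \<rightarrow>\<^sub>M borel" shows "map_utree f \<in> utree_space \<rightarrow>\<^sub>M utree_space"
  unfolding measurable_utree_iff map_utree.abs_eq using assms by measurable

primrec plane_length :: "real tree \<Rightarrow> real" where
  "plane_length Leaf = 0"
| "plane_length (Node l e r) = e + plane_length l + plane_length r"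

lemma plane_length_eq: "plane_length t = sum_list (preorder t)"
  by (induction t) auto

lemma measurable_plane_length [measurable]: "plane_length \<in> borel_measurable plane_space"
  unfolding plane_length_def by measurable

lemma tree_length_unordered [simp]: "tree_length (unordered t) = plane_length t"
  by (simp add: tree_length.abs_eq plane_length_eq)

lemma measurable_tree_length [measurable]: "tree_length \<in> borel_measurable utree_space"
  unfolding measurable_utree_iff tree_length_unordered by measurable

text \<open>Where the right subtree begins in the traversal depends on the size of the left one.
  Once the shape is fixed, the i-th label sits at a fixed vertex; the countably many shapes are
  glued together afterwards.\<close>

lemma preorder_nth_shape:
  "\<exists>g\<in>borel_measurable plane_space. \<forall>t. plane_shape t = s \<longrightarrow> preorder t ! i = g t"
proof (induction s arbitrary: i)
  case Leaf
  \<comment> \<open>\<open>[] ! i\<close> is the unspecified value of an index out of range; being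
    constant, it is measurable.\<close>
  show ?case by (intro bexI[of _ "\<lambda>_. [] ! i"]) auto
next
  case (Node s1 u s2)
  define n1 where "n1 = size s1"
  from Node.IH(1) obtain g1 where g1 [measurable]: "g1 \<in> borel_measurable plane_space"
    "\<And>t. plane_shape t = s1 \<Longrightarrow> preorder t ! (i - 1) = g1 t" by metis
  from Node.IH(2) obtain g2 where g2 [measurable]: "g2 \<in> borel_measurable plane_space"
    "\<And>t. plane_shape t = s2 \<Longrightarrow> preorder t ! (i - 1 - n1) = g2 t" by metis
  define g where "g = (\<lambda>t :: real tree. case t of Leaf \<Rightarrow> 0 | Node l e r \<Rightarrow>
     if i = 0 then e else if i - 1 < n1 then g1 l else g2 r)"
  have "g \<in> borel_measurable plane_space" unfolding g_def by measurable
  moreover have "preorder t ! i = g t" if "plane_shape t = Node s1 u s2" for t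
  proof -
    from that obtain l e r where t: "t = Node l e r" "plane_shape l = s1" "plane_shape r = s2"
      by (cases t) auto
    have "length (preorder l) = n1" using t(2) by (auto simp: n1_def)
    then show ?thesis using g1(2)[OF t(2)] g2(2)[OF t(3)]
      by (cases i) (auto simp: t(1) g_def nth_append)
  qed
  ultimately show ?case by blast
qed

lemma measurable_preorder_nth [measurable]: "(\<lambda>t. preorder t ! i) \<in> borel_measurable plane_space"
proof -
  from preorder_nth_shape[of _ i] obtain g where [measurable]: "\<And>s. g s \<in> borel_measurable plane_space"
    and g: "\<And>s t. plane_shape t = s \<Longrightarrow> preorder t ! i = g s t" by metis
  have "(\<lambda>t. g (plane_shape t) t) \<in> borel_measurable plane_space"
    by (rule measurable_compose_countable[where f = g and g = plane_shape]) measurable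
  then show ?thesis using g by simp
qed

section \<open>Splitting infinite products\<close>

text \<open>The joint law of the coordinates is the product measure, and the law of each coordinate
  is its factor.\<close>

lemma indep_vars_PiM:
  assumes "I \<noteq> {}" "\<And>i. i \<in> I \<Longrightarrow> prob_space (M i)"
  shows "prob_space.indep_vars (PiM I M) M (\<lambda>i \<omega>. \<omega> i) I"
proof -
  interpret prob_space "PiM I M" using assms(2) by (rule prob_space_PiM)
  have "distr (PiM I M) (PiM I M) (\<lambda>\<omega>. \<lambda>i\<in>I. \<omega> i) = distr (PiM I M) (PiM I M) (\<lambda>\<omega>. \<omega>)"
    by (rule distr_cong) (auto simp: space_PiM PiE_def extensional_restrict)
  also have "\<dots> = PiM I M" by (rule distr_id)
  also have "\<dots> = PiM I (\<lambda>i. distr (PiM I M) (M i) (\<lambda>\<omega>. \<omega> i))"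
    by (rule PiM_cong) (auto simp: distr_PiM_component assms(2))
  finally show ?thesis
    by (subst indep_vars_iff_distr_eq_PiM'[OF assms(1)]) auto
qed

text \<open>Restrictions of a product to disjoint sets of coordinates are independent, and
  reindexing along an injection turns each restriction into a product again. The injections later
  prefix a step to an address.\<close>

lemma distr_PiM_split:
  assumes M: "\<And>i. i \<in> I \<Longrightarrow> prob_space (M i)" and ne: "I \<noteq> {}"
    and a: "inj_on a A" "a \<in> A \<rightarrow> I" and b: "inj_on b B" "b \<in> B \<rightarrow> I"
    and disj: "a ` A \<inter> b ` B = {}"
  shows "distr (PiM I M) (PiM A (\<lambda>i. M (a i)) \<Otimes>\<^sub>M PiM B (\<lambda>i. M (b i)))
      (\<lambda>\<omega>. (\<lambda>i\<in>A. \<omega> (a i), \<lambda>i\<in>B. \<omega> (b i))) =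
    PiM A (\<lambda>i. M (a i)) \<Otimes>\<^sub>M PiM B (\<lambda>i. M (b i))"
proof -
  interpret prob_space "PiM I M" using M by (rule prob_space_PiM)
  let ?A = "PiM A (\<lambda>i. M (a i))" and ?B = "PiM B (\<lambda>i. M (b i))"
  interpret B: prob_space ?B using M b by (intro prob_space_PiM) auto
  have [measurable]: "(\<lambda>\<omega>. \<lambda>i\<in>A. \<omega> (a i)) \<in> PiM (a ` A) M \<rightarrow>\<^sub>M ?A"
    "(\<lambda>\<omega>. \<lambda>i\<in>B. \<omega> (b i)) \<in> PiM (b ` B) M \<rightarrow>\<^sub>M ?B"
    by (auto intro!: measurable_restrict measurable_component_singleton)
  have sub: "a ` A \<subseteq> I" "b ` B \<subseteq> I" using a b by auto
  have [measurable]: "(\<lambda>\<omega>. restrict \<omega> (a ` A)) \<in> PiM I M \<rightarrow>\<^sub>M PiM (a ` A) M"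
    "(\<lambda>\<omega>. restrict \<omega> (b ` B)) \<in> PiM I M \<rightarrow>\<^sub>M PiM (b ` B) M"
    using sub by (auto intro: measurable_restrict_subset)
  have eq: "distr (distr (PiM I M) (PiM (a ` A) M) (\<lambda>\<omega>. restrict \<omega> (a ` A))) ?A (\<lambda>\<omega>. \<lambda>i\<in>A. \<omega> (a i)) = ?A"
    "distr (distr (PiM I M) (PiM (b ` B) M) (\<lambda>\<omega>. restrict \<omega> (b ` B))) ?B (\<lambda>\<omega>. \<lambda>i\<in>B. \<omega> (b i)) = ?B"
    using distr_PiM_reindex[of I M a A, OF M a] distr_PiM_reindex[of I M b B, OF M b]
    by (subst distr_distr; (measurable)?; simp add: comp_def cong: restrict_cong)+
  have "indep_var (PiM (a ` A) M) (\<lambda>\<omega>. restrict (\<lambda>i. \<omega> i) (a ` A))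
                  (PiM (b ` B) M) (\<lambda>\<omega>. restrict (\<lambda>i. \<omega> i) (b ` B))"
    using sub by (intro indep_var_restrict[OF indep_vars_PiM[OF ne M]] disj) auto
  then have ind: "distr (PiM I M) (PiM (a ` A) M \<Otimes>\<^sub>M PiM (b ` B) M)
      (\<lambda>\<omega>. (restrict \<omega> (a ` A), restrict \<omega> (b ` B))) =
    distr (PiM I M) (PiM (a ` A) M) (\<lambda>\<omega>. restrict \<omega> (a ` A)) \<Otimes>\<^sub>M
    distr (PiM I M) (PiM (b ` B) M) (\<lambda>\<omega>. restrict \<omega> (b ` B))"
    by (simp add: indep_var_distribution_eq)
  have "distr (PiM I M) (?A \<Otimes>\<^sub>M ?B) (\<lambda>\<omega>. (\<lambda>i\<in>A. \<omega> (a i), \<lambda>i\<in>B. \<omega> (b i))) =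
    distr (distr (PiM I M) (PiM (a ` A) M \<Otimes>\<^sub>M PiM (b ` B) M)
      (\<lambda>\<omega>. (restrict \<omega> (a ` A), restrict \<omega> (b ` B)))) (?A \<Otimes>\<^sub>M ?B)
      (\<lambda>(x, y). (\<lambda>i\<in>A. x (a i), \<lambda>i\<in>B. y (b i)))"
    by (subst distr_distr) (auto simp: comp_def cong: restrict_cong)
  also have "\<dots> = ?A \<Otimes>\<^sub>M ?B"
    unfolding ind by (subst pair_measure_distr[symmetric]) (auto simp: eq B.sigma_finite_measure_axioms)
  finally show ?thesis .
qed

lemma nn_integral_PiM_split:
  assumes M: "\<And>i. i \<in> I \<Longrightarrow> prob_space (M i)" and ne: "I \<noteq> {}"
    and a: "inj_on a A" "a \<in> A \<rightarrow> I" and b: "inj_on b B" "b \<in> B \<rightarrow> I"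
    and disj: "a ` A \<inter> b ` B = {}"
    and f [measurable]: "case_prod f \<in> borel_measurable (PiM A (\<lambda>i. M (a i)) \<Otimes>\<^sub>M PiM B (\<lambda>i. M (b i)))"
  shows "(\<integral>\<^sup>+\<omega>. f (\<lambda>i\<in>A. \<omega> (a i)) (\<lambda>i\<in>B. \<omega> (b i)) \<partial>PiM I M) =
    (\<integral>\<^sup>+x. \<integral>\<^sup>+y. f x y \<partial>PiM B (\<lambda>i. M (b i)) \<partial>PiM A (\<lambda>i. M (a i)))"
proof -
  interpret B: prob_space "PiM B (\<lambda>i. M (b i))" using M b by (intro prob_space_PiM) auto
  have [measurable]: "(\<lambda>\<omega>. (\<lambda>i\<in>A. \<omega> (a i), \<lambda>i\<in>B. \<omega> (b i))) \<in>
      PiM I M \<rightarrow>\<^sub>M PiM A (\<lambda>i. M (a i)) \<Otimes>\<^sub>M PiM B (\<lambda>i. M (b i))"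
    using a b by (intro measurable_Pair measurable_restrict measurable_component_singleton) auto
  have "(\<integral>\<^sup>+\<omega>. f (\<lambda>i\<in>A. \<omega> (a i)) (\<lambda>i\<in>B. \<omega> (b i)) \<partial>PiM I M) =
    (\<integral>\<^sup>+p. case_prod f p \<partial>distr (PiM I M) (PiM A (\<lambda>i. M (a i)) \<Otimes>\<^sub>M PiM B (\<lambda>i. M (b i)))
      (\<lambda>\<omega>. (\<lambda>i\<in>A. \<omega> (a i), \<lambda>i\<in>B. \<omega> (b i))))"
    by (subst nn_integral_distr) (auto simp: case_prod_beta')
  also have "\<dots> = (\<integral>\<^sup>+x. \<integral>\<^sup>+y. f x y \<partial>PiM B (\<lambda>i. M (b i)) \<partial>PiM A (\<lambda>i. M (a i)))"
    by (subst distr_PiM_split[OF M ne a b disj], assumption, subst B.nn_integral_fst[symmetric]) auto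
  finally show ?thesis .
qed

text \<open>The second and third block are packed into one over the disjoint sum
  \<open>B <+> C\<close>, so that the rule for two blocks applies twice.\<close>

lemma nn_integral_PiM_split3:
  assumes M: "\<And>i. i \<in> I \<Longrightarrow> prob_space (M i)" and ne: "I \<noteq> {}" "B \<noteq> {}"
    and a: "inj_on a A" "a \<in> A \<rightarrow> I" and b: "inj_on b B" "b \<in> B \<rightarrow> I" and c: "inj_on c C" "c \<in> C \<rightarrow> I"
    and disj: "a ` A \<inter> b ` B = {}" "a ` A \<inter> c ` C = {}" "b ` B \<inter> c ` C = {}"
    and f [measurable]: "(\<lambda>(x, y, z). f x y z) \<in> borel_measurable
      (PiM A (\<lambda>i. M (a i)) \<Otimes>\<^sub>M (PiM B (\<lambda>i. M (b i)) \<Otimes>\<^sub>M PiM C (\<lambda>i. M (c i))))"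
  shows "(\<integral>\<^sup>+\<omega>. f (\<lambda>i\<in>A. \<omega> (a i)) (\<lambda>i\<in>B. \<omega> (b i)) (\<lambda>i\<in>C. \<omega> (c i)) \<partial>PiM I M) =
    (\<integral>\<^sup>+x. \<integral>\<^sup>+y. \<integral>\<^sup>+z. f x y z \<partial>PiM C (\<lambda>i. M (c i)) \<partial>PiM B (\<lambda>i. M (b i)) \<partial>PiM A (\<lambda>i. M (a i)))"
proof -
  define d where "d = case_sum b c"
  let ?D = "PiM (B <+> C) (\<lambda>i. M (d i))"
  have d: "inj_on d (B <+> C)" "d \<in> B <+> C \<rightarrow> I"
  proof -
    have "b i \<noteq> c j" if "i \<in> B" "j \<in> C" for i j using disj(3) that by blast
    then have ne: "b i \<noteq> c j" "c j \<noteq> b i" if "i \<in> B" "j \<in> C" for i j using that by metis+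
    show "inj_on d (B <+> C)"
      by (rule inj_onI) (auto simp: d_def ne dest: inj_onD[OF b(1)] inj_onD[OF c(1)])
    show "d \<in> B <+> C \<rightarrow> I" using b(2) c(2) by (auto simp: d_def)
  qed
  have ad: "a ` A \<inter> d ` (B <+> C) = {}"
    using disj(1,2) unfolding d_def by auto
  have D: "\<And>i. i \<in> B <+> C \<Longrightarrow> prob_space (M (d i))" using M d(2) by auto
  have l [measurable]: "(\<lambda>w. \<lambda>i\<in>B. w (Inl i)) \<in> ?D \<rightarrow>\<^sub>M PiM B (\<lambda>i. M (b i))"
  proof (rule measurable_restrict)
    fix i assume "i \<in> B"
    then have "(\<lambda>w. w (Inl i)) \<in> ?D \<rightarrow>\<^sub>M M (d (Inl i))" by (intro measurable_component_singleton) auto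
    then show "(\<lambda>w. w (Inl i)) \<in> ?D \<rightarrow>\<^sub>M M (b i)" by (simp add: d_def)
  qed
  have r [measurable]: "(\<lambda>w. \<lambda>i\<in>C. w (Inr i)) \<in> ?D \<rightarrow>\<^sub>M PiM C (\<lambda>i. M (c i))"
  proof (rule measurable_restrict)
    fix i assume "i \<in> C"
    then have "(\<lambda>w. w (Inr i)) \<in> ?D \<rightarrow>\<^sub>M M (d (Inr i))" by (intro measurable_component_singleton) auto
    then show "(\<lambda>w. w (Inr i)) \<in> ?D \<rightarrow>\<^sub>M M (c i)" by (simp add: d_def)
  qed
  have "(\<integral>\<^sup>+\<omega>. f (\<lambda>i\<in>A. \<omega> (a i)) (\<lambda>i\<in>B. \<omega> (b i)) (\<lambda>i\<in>C. \<omega> (c i)) \<partial>PiM I M) =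
    (\<integral>\<^sup>+\<omega>. (\<lambda>x w. f x (\<lambda>i\<in>B. w (Inl i)) (\<lambda>i\<in>C. w (Inr i))) (\<lambda>i\<in>A. \<omega> (a i)) (\<lambda>i\<in>B <+> C. \<omega> (d i)) \<partial>PiM I M)"
  proof (rule nn_integral_cong)
    fix \<omega> :: "'a \<Rightarrow> 'b"
    have "(\<lambda>i\<in>B. (\<lambda>i\<in>B <+> C. \<omega> (d i)) (Inl i)) = (\<lambda>i\<in>B. \<omega> (b i))"
      "(\<lambda>i\<in>C. (\<lambda>i\<in>B <+> C. \<omega> (d i)) (Inr i)) = (\<lambda>i\<in>C. \<omega> (c i))"
      by (auto simp: fun_eq_iff d_def)
    then show "f (\<lambda>i\<in>A. \<omega> (a i)) (\<lambda>i\<in>B. \<omega> (b i)) (\<lambda>i\<in>C. \<omega> (c i)) =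
      (\<lambda>x w. f x (\<lambda>i\<in>B. w (Inl i)) (\<lambda>i\<in>C. w (Inr i))) (\<lambda>i\<in>A. \<omega> (a i)) (\<lambda>i\<in>B <+> C. \<omega> (d i))"
      by simp
  qed
  also have "\<dots> = (\<integral>\<^sup>+x. \<integral>\<^sup>+w. f x (\<lambda>i\<in>B. w (Inl i)) (\<lambda>i\<in>C. w (Inr i)) \<partial>?D \<partial>PiM A (\<lambda>i. M (a i)))"
  proof (rule nn_integral_PiM_split[OF M ne(1) a d ad])
    have "(\<lambda>p. (\<lambda>(x, y, z). f x y z) (fst p, \<lambda>i\<in>B. snd p (Inl i), \<lambda>i\<in>C. snd p (Inr i)))
      \<in> borel_measurable (PiM A (\<lambda>i. M (a i)) \<Otimes>\<^sub>M ?D)"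
      by (rule measurable_compose[OF _ f])
        (intro measurable_Pair measurable_fst measurable_compose[OF measurable_snd l]
          measurable_compose[OF measurable_snd r])
    then show "(\<lambda>(x, w). f x (\<lambda>i\<in>B. w (Inl i)) (\<lambda>i\<in>C. w (Inr i))) \<in>
      borel_measurable (PiM A (\<lambda>i. M (a i)) \<Otimes>\<^sub>M ?D)"
      by (simp add: case_prod_beta')
  qed
  also have "\<dots> = (\<integral>\<^sup>+x. \<integral>\<^sup>+y. \<integral>\<^sup>+z. f x y z \<partial>PiM C (\<lambda>i. M (c i)) \<partial>PiM B (\<lambda>i. M (b i)) \<partial>PiM A (\<lambda>i. M (a i)))"
  proof (rule nn_integral_cong)
    fix x assume x: "x \<in> space (PiM A (\<lambda>i. M (a i)))"
    have "case_prod (f x) \<in> borel_measurable (PiM B (\<lambda>i. M (b i)) \<Otimes>\<^sub>M PiM C (\<lambda>i. M (c i)))"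
      using measurable_compose[OF measurable_Pair1'[OF x] f] by (simp add: case_prod_beta')
    then have "case_prod (f x) \<in> borel_measurable
        (PiM B (\<lambda>i. M (d (Inl i))) \<Otimes>\<^sub>M PiM C (\<lambda>i. M (d (Inr i))))"
      by (simp add: d_def)
    from nn_integral_PiM_split[of "B <+> C" "\<lambda>i. M (d i)" Inl B Inr C "f x", OF D _ _ _ _ _ _ this]
    show "(\<integral>\<^sup>+w. f x (\<lambda>i\<in>B. w (Inl i)) (\<lambda>i\<in>C. w (Inr i)) \<partial>?D) =
      (\<integral>\<^sup>+y. \<integral>\<^sup>+z. f x y z \<partial>PiM C (\<lambda>i. M (c i)) \<partial>PiM B (\<lambda>i. M (b i)))"
      using ne(2) by (auto simp: d_def)
  qed
  finally show ?thesis .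
qed

text \<open>The addresses are the empty one, those beginning with \<open>False\<close> and those
  beginning with \<open>True\<close>; the last two sets are copies of the whole. This is the source
  of the recursion for the Galton-Watson law.\<close>

lemma nn_integral_PiM_bool_list:
  assumes N: "prob_space N"
    and f [measurable]: "(\<lambda>(x, y, z). f x y z) \<in> borel_measurable
      (N \<Otimes>\<^sub>M (PiM UNIV (\<lambda>_. N) \<Otimes>\<^sub>M PiM UNIV (\<lambda>_. N)))"
  shows "(\<integral>\<^sup>+\<omega>. f (\<omega> []) (\<lambda>u. \<omega> (False # u)) (\<lambda>u. \<omega> (True # u)) \<partial>PiM (UNIV :: bool list set) (\<lambda>_. N)) =
    (\<integral>\<^sup>+x. \<integral>\<^sup>+y. \<integral>\<^sup>+z. f x y z \<partial>PiM (UNIV :: bool list set) (\<lambda>_. N) \<partial>PiM (UNIV :: bool list set) (\<lambda>_. N) \<partial>N)"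
proof -
  let ?P = "PiM (UNIV :: bool list set) (\<lambda>_. N)"
  interpret N: prob_space N by fact
  interpret P: prob_space ?P by (intro prob_space_PiM N)
  interpret S: product_sigma_finite "\<lambda>_ :: unit. N" by standard
  have eta: "(\<lambda>(x, y, z). f (x ()) y z) = (\<lambda>p. (\<lambda>(x, y, z). f x y z) (fst p (), fst (snd p), snd (snd p)))"
    by auto
  have [measurable]: "(\<lambda>w. f (fst (fst w)) (snd (fst w)) (snd w)) \<in> borel_measurable ((N \<Otimes>\<^sub>M ?P) \<Otimes>\<^sub>M ?P)"
  proof -
    have "(\<lambda>w. (fst (fst w), snd (fst w), snd w)) \<in> (N \<Otimes>\<^sub>M ?P) \<Otimes>\<^sub>M ?P \<rightarrow>\<^sub>M N \<Otimes>\<^sub>M (?P \<Otimes>\<^sub>M ?P)"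
      by measurable
    from measurable_compose[OF this f] show ?thesis by simp
  qed
  \<comment> \<open>The root coordinate is viewed as a block over the one-point index set
    \<open>{()}\<close>.\<close>
  have "(\<integral>\<^sup>+\<omega>. (\<lambda>x. f (x ())) (\<lambda>i\<in>{()}. \<omega> []) (\<lambda>u\<in>UNIV. \<omega> (False # u)) (\<lambda>u\<in>UNIV. \<omega> (True # u)) \<partial>?P) =
    (\<integral>\<^sup>+x. \<integral>\<^sup>+y. \<integral>\<^sup>+z. f (x ()) y z \<partial>?P \<partial>?P \<partial>PiM {()} (\<lambda>_. N))"
    by (rule nn_integral_PiM_split3[where a = "\<lambda>_. []" and b = "Cons False" and c = "Cons True"])
      (use N in \<open>auto simp: eta\<close>)
  also have "\<dots> = (\<integral>\<^sup>+x. \<integral>\<^sup>+y. \<integral>\<^sup>+z. f x y z \<partial>?P \<partial>?P \<partial>N)"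
    by (rule S.product_nn_integral_singleton[of "\<lambda>x. \<integral>\<^sup>+y. \<integral>\<^sup>+z. f x y z \<partial>?P \<partial>?P"]) measurable
  finally show ?thesis by (simp add: restrict_UNIV)
qed

section \<open>The Galton-Watson tree\<close>

lemma gw_family_shift: "gw_family c x (v @ u) t \<longleftrightarrow> gw_family (\<lambda>w. c (v @ w)) (\<lambda>w. x (v @ w)) u t"
proof
  have "gw_family c x w t \<Longrightarrow> w = v @ u \<Longrightarrow> gw_family (\<lambda>w. c (v @ w)) (\<lambda>w. x (v @ w)) u t" for w
    by (induction arbitrary: u rule: gw_family.induct) (auto intro: gw_family.intros)
  then show "gw_family c x (v @ u) t \<Longrightarrow> gw_family (\<lambda>w. c (v @ w)) (\<lambda>w. x (v @ w)) u t" by simp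
  show "gw_family (\<lambda>w. c (v @ w)) (\<lambda>w. x (v @ w)) u t \<Longrightarrow> gw_family c x (v @ u) t"
    by (induction rule: gw_family.induct) (auto intro: gw_family.intros)
qed

lemma gw_family_unique: "gw_family c x u t \<Longrightarrow> gw_family c x u t' \<Longrightarrow> t = t'"
proof (induction arbitrary: t' rule: gw_family.induct)
  case (1 u)
  from 1(2,1) show ?case by cases auto
next
  case (2 u l r)
  from 2(6,1,4,5) show ?case by cases auto
qed

lemma gw_family_not_Leaf [simp]: "\<not> gw_family c x u Leaf"
  by (auto elim: gw_family.cases)

lemma gw_tree_eq_iff: "t \<noteq> Leaf \<Longrightarrow> gw_tree c x = t \<longleftrightarrow> gw_family c x [] t"
proof -
  assume t: "t \<noteq> Leaf"
  have "gw_family c x [] s \<Longrightarrow> (THE s. gw_family c x [] s) = s" for s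
    using gw_family_unique by blast
  then show ?thesis unfolding gw_tree_def using t by auto
qed

text \<open>A vertex with a child of infinite family has an infinite family itself, so the default
  \<open>Leaf\<close> propagates upwards and the recursion holds for every outcome, not only almost
  surely.\<close>

lemma gw_tree_rec:
  "gw_tree c x =
    (if \<not> c [] then Node Leaf (x []) Leaf
     else let l = gw_tree (\<lambda>u. c (False # u)) (\<lambda>u. x (False # u));
              r = gw_tree (\<lambda>u. c (True # u)) (\<lambda>u. x (True # u))
          in if l = Leaf \<or> r = Leaf then Leaf else Node l (x []) r)" (is "_ = ?R")
proof -
  have shift: "gw_family c x [b] t \<longleftrightarrow> gw_family (\<lambda>u. c (b # u)) (\<lambda>u. x (b # u)) [] t" for b t
    using gw_family_shift[of c x "[b]" "[]" t] by simp
  have fam: "gw_family c x [] t \<longleftrightarrow> (\<not> c [] \<and> t = Node Leaf (x []) Leaf) \<or>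
    (c [] \<and> (\<exists>l r. gw_family (\<lambda>u. c (False # u)) (\<lambda>u. x (False # u)) [] l \<and>
      gw_family (\<lambda>u. c (True # u)) (\<lambda>u. x (True # u)) [] r \<and> t = Node l (x []) r))" for t
    by (subst gw_family.simps) (auto simp: shift)
  have ex: "gw_family (\<lambda>u. c (b # u)) (\<lambda>u. x (b # u)) [] t \<longleftrightarrow>
     t \<noteq> Leaf \<and> gw_tree (\<lambda>u. c (b # u)) (\<lambda>u. x (b # u)) = t" for b t
    by (cases "t = Leaf") (auto simp: gw_tree_eq_iff)
  \<comment> \<open>Both sides take the same nonempty values, hence they also agree when one of them
    is empty.\<close>
  have "t \<noteq> Leaf \<Longrightarrow> gw_tree c x = t \<longleftrightarrow> ?R = t" for t
    unfolding gw_tree_eq_iff fam ex by (auto simp: Let_def)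
  then show ?thesis by (metis)
qed

text \<open>Exploration of finitely many generations, with \<open>Leaf\<close> also for a family
  that is not complete by then. It gives access to the measurability of \<open>gw_tree\<close>,
  which is defined by a description.\<close>

primrec gw_approx :: "nat \<Rightarrow> (bool list \<Rightarrow> bool) \<Rightarrow> (bool list \<Rightarrow> real) \<Rightarrow> real tree" where
  "gw_approx 0 c x = Leaf"
| "gw_approx (Suc n) c x =
    (if \<not> c [] then Node Leaf (x []) Leaf
     else let l = gw_approx n (\<lambda>u. c (False # u)) (\<lambda>u. x (False # u));
              r = gw_approx n (\<lambda>u. c (True # u)) (\<lambda>u. x (True # u))
          in if l = Leaf \<or> r = Leaf then Leaf else Node l (x []) r)"

lemma gw_approx_sound: "gw_approx n c x \<noteq> Leaf \<Longrightarrow> gw_tree c x = gw_approx n c x"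
proof (induction n arbitrary: c x)
  case (Suc n)
  then show ?case by (subst gw_tree_rec) (auto simp: Let_def split: if_splits)
qed simp

lemma gw_approx_complete: "gw_tree c x \<noteq> Leaf \<Longrightarrow> gw_approx (height (gw_tree c x)) c x \<noteq> Leaf"
proof -
  have "gw_tree c x \<noteq> Leaf \<Longrightarrow> height (gw_tree c x) \<le> n \<Longrightarrow> gw_approx n c x \<noteq> Leaf" for n
  proof (induction n arbitrary: c x)
    case 0
    then show ?case by simp
  next
    case (Suc n)
    show ?case
    proof (cases "c []")
      case True
      have "gw_tree (\<lambda>u. c (b # u)) (\<lambda>u. x (b # u)) \<noteq> Leaf \<and>
        height (gw_tree (\<lambda>u. c (b # u)) (\<lambda>u. x (b # u))) \<le> n" for b
        using Suc.prems True by (subst (asm) (1 2) gw_tree_rec)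
          (cases b; auto simp: Let_def split: if_splits)
      then show ?thesis using Suc.IH True by (simp add: Let_def)
    qed simp
  qed
  then show "gw_tree c x \<noteq> Leaf \<Longrightarrow> gw_approx (height (gw_tree c x)) c x \<noteq> Leaf" by simp
qed

text \<open>The first index with a nonempty approximation is a measurable integer, and the limit is
  the approximation at that index.\<close>

lemma measurable_tree_limit:
  assumes [measurable]: "\<And>n :: nat. g n \<in> M \<rightarrow>\<^sub>M plane_space"
    and "\<And>n \<omega>. \<omega> \<in> space M \<Longrightarrow> g n \<omega> \<noteq> Leaf \<Longrightarrow> f \<omega> = g n \<omega>"
    and "\<And>\<omega>. \<omega> \<in> space M \<Longrightarrow> f \<omega> \<noteq> Leaf \<Longrightarrow> \<exists>n. g n \<omega> \<noteq> Leaf"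
  shows "f \<in> M \<rightarrow>\<^sub>M plane_space"
proof -
  have [measurable]: "(\<lambda>\<omega>. LEAST n. g n \<omega> \<noteq> Leaf) \<in> M \<rightarrow>\<^sub>M count_space UNIV" by measurable
  have "(\<lambda>\<omega>. g (LEAST n. g n \<omega> \<noteq> Leaf) \<omega>) \<in> M \<rightarrow>\<^sub>M plane_space"
    by (rule measurable_compose_countable[where f = g]) measurable
  then show ?thesis
  proof (rule measurable_cong[THEN iffD1, rotated])
    fix \<omega> assume "\<omega> \<in> space M"
    then show "g (LEAST n. g n \<omega> \<noteq> Leaf) \<omega> = f \<omega>"
      using assms(2,3) LeastI[of "\<lambda>n. g n \<omega> \<noteq> Leaf"] by metis
  qed
qed

abbreviation gw_splits :: "(bool list \<Rightarrow> bool) measure" where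
  "gw_splits \<equiv> PiM UNIV (\<lambda>_. measure_pmf (bernoulli_pmf (1 / 2)))"

abbreviation edge_law :: "real \<Rightarrow> real measure" where
  "edge_law \<gamma> \<equiv> density lborel (exponential_density (2 * \<gamma>))"

abbreviation gw_lengths :: "real \<Rightarrow> (bool list \<Rightarrow> real) measure" where
  "gw_lengths \<gamma> \<equiv> PiM UNIV (\<lambda>_. edge_law \<gamma>)"

lemma measurable_gw_approx [measurable]:
  "(\<lambda>(c, x). gw_approx n c x) \<in> gw_splits \<Otimes>\<^sub>M gw_lengths \<gamma> \<rightarrow>\<^sub>M plane_space"
proof (induction n)
  case (Suc n)
  have sh: "(\<lambda>p. (\<lambda>u. fst p (b # u), \<lambda>u. snd p (b # u))) \<in>
      gw_splits \<Otimes>\<^sub>M gw_lengths \<gamma> \<rightarrow>\<^sub>M gw_splits \<Otimes>\<^sub>M gw_lengths \<gamma>" for b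
    by (intro measurable_Pair measurable_PiM_single') (auto simp: space_PiM)
  have [measurable]: "(\<lambda>p. gw_approx n (\<lambda>u. fst p (b # u)) (\<lambda>u. snd p (b # u))) \<in>
      gw_splits \<Otimes>\<^sub>M gw_lengths \<gamma> \<rightarrow>\<^sub>M plane_space" for b
    using measurable_compose[OF sh Suc, of b] by simp
  have [measurable]: "(\<lambda>p. snd p []) \<in> borel_measurable (gw_splits \<Otimes>\<^sub>M gw_lengths \<gamma>)"
    "(\<lambda>p. fst p []) \<in> gw_splits \<Otimes>\<^sub>M gw_lengths \<gamma> \<rightarrow>\<^sub>M count_space UNIV"
    using measurable_compose[OF measurable_snd measurable_component_singleton[of "[]" UNIV "\<lambda>_. edge_law \<gamma>"], of gw_splits]
      measurable_compose[OF measurable_fst measurable_component_singleton[of "[]" UNIV "\<lambda>_. measure_pmf (bernoulli_pmf (1 / 2))"], of "gw_lengths \<gamma>"]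
    by (simp_all cong: measurable_cong_sets)
  show ?case
    unfolding gw_approx.simps case_prod_beta' Let_def by measurable
qed simp

lemma measurable_gw_tree [measurable]:
  "(\<lambda>(c, x). gw_tree c x) \<in> gw_splits \<Otimes>\<^sub>M gw_lengths \<gamma> \<rightarrow>\<^sub>M plane_space"
  by (rule measurable_tree_limit[where g = "\<lambda>n (c, x). gw_approx n c x", OF measurable_gw_approx])
    (auto simp: gw_approx_sound dest: gw_approx_complete)

definition plane_gw :: "real \<Rightarrow> real tree measure" where
  "plane_gw \<gamma> = distr (gw_splits \<Otimes>\<^sub>M gw_lengths \<gamma>) plane_space (\<lambda>(c, x). gw_tree c x)"

lemma sets_plane_gw [simp, measurable_cong]: "sets (plane_gw \<gamma>) = sets plane_space"
  by (simp add: plane_gw_def)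

lemma space_plane_gw [simp]: "space (plane_gw \<gamma>) = UNIV"
  by (simp add: plane_gw_def)

lemma gw_law_eq: "gw_law \<gamma> = distr (plane_gw \<gamma>) utree_space unordered"
  unfolding gw_law_def plane_gw_def by (subst distr_distr) (auto simp: comp_def case_prod_beta')

lemma prob_space_edge_law: "0 < \<gamma> \<Longrightarrow> prob_space (edge_law \<gamma>)"
  by (rule prob_space_exponential_density) simp

lemma prob_space_gw_splits: "prob_space gw_splits"
  by (intro prob_space_PiM measure_pmf.prob_space_axioms)

lemma prob_space_gw_lengths: "0 < \<gamma> \<Longrightarrow> prob_space (gw_lengths \<gamma>)"
  by (intro prob_space_PiM prob_space_edge_law)

lemma prob_space_plane_gw: "0 < \<gamma> \<Longrightarrow> prob_space (plane_gw \<gamma>)"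
proof -
  assume "0 < \<gamma>"
  then interpret X: prob_space "gw_lengths \<gamma>" by (rule prob_space_gw_lengths)
  interpret C: prob_space gw_splits by (rule prob_space_gw_splits)
  interpret CX: pair_prob_space gw_splits "gw_lengths \<gamma>" ..
  show ?thesis unfolding plane_gw_def by (rule CX.prob_space_distr) measurable
qed

lemma nn_integral_plane_gw:
  assumes "0 < \<gamma>" and [measurable]: "f \<in> borel_measurable plane_space"
  shows "(\<integral>\<^sup>+t. f t \<partial>plane_gw \<gamma>) = (\<integral>\<^sup>+c. \<integral>\<^sup>+x. f (gw_tree c x) \<partial>gw_lengths \<gamma> \<partial>gw_splits)"
proof -
  interpret X: prob_space "gw_lengths \<gamma>" using assms(1) by (rule prob_space_gw_lengths)
  show ?thesis unfolding plane_gw_def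
    by (subst nn_integral_distr) (auto simp: X.nn_integral_fst[symmetric])
qed

lemma nn_integral_swap:
  assumes "sigma_finite_measure M" "sigma_finite_measure N"
    and "case_prod f \<in> borel_measurable (M \<Otimes>\<^sub>M N)"
  shows "(\<integral>\<^sup>+x. \<integral>\<^sup>+y. f x y \<partial>N \<partial>M) = (\<integral>\<^sup>+y. \<integral>\<^sup>+x. f x y \<partial>M \<partial>N)"
proof -
  interpret pair_sigma_finite M N using assms(1,2) by (simp add: pair_sigma_finite_def)
  show ?thesis using Fubini'[OF assms(3)] by simp
qed

text \<open>Here \<open>Leaf\<close> stands for an infinite family and not for an absent subtree,
  which is why it is absorbing.\<close>

definition graft :: "real tree \<Rightarrow> real \<Rightarrow> real tree \<Rightarrow> real tree" where
  "graft l e r = (if l = Leaf \<or> r = Leaf then Leaf else Node l e r)"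

lemma measurable_graft [measurable (raw)]:
  assumes [measurable]: "f \<in> M \<rightarrow>\<^sub>M plane_space" "g \<in> borel_measurable M" "h \<in> M \<rightarrow>\<^sub>M plane_space"
  shows "(\<lambda>w. graft (f w) (g w) (h w)) \<in> M \<rightarrow>\<^sub>M plane_space"
  unfolding graft_def by measurable

lemma gw_tree_graft:
  "gw_tree c x =
    (if c [] then graft (gw_tree (\<lambda>u. c (False # u)) (\<lambda>u. x (False # u))) (x [])
        (gw_tree (\<lambda>u. c (True # u)) (\<lambda>u. x (True # u)))
     else Node Leaf (x []) Leaf)"
  by (subst gw_tree_rec) (simp add: graft_def Let_def)

declare measurable_gw_tree [measurable del]

lemma space_gw_splits [simp]: "space gw_splits = UNIV"
  by (simp add: space_PiM)

lemma ennreal_half: "ennreal (1 / 2) = inverse 2"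
  using inverse_ennreal[of 2] by simp

section \<open>Integral recursion and almost sure finiteness of the Galton-Watson tree\<close>

locale galton_watson =
  fixes \<gamma> :: real
  assumes \<gamma>_pos: "0 < \<gamma>"
begin

abbreviation "E \<equiv> edge_law \<gamma>"
abbreviation "G \<equiv> plane_gw \<gamma>"

sublocale E: prob_space E using \<gamma>_pos by (rule prob_space_edge_law)
sublocale G: prob_space G using \<gamma>_pos by (rule prob_space_plane_gw)
sublocale C: prob_space gw_splits by (rule prob_space_gw_splits)
sublocale X: prob_space "gw_lengths \<gamma>" using \<gamma>_pos by (rule prob_space_gw_lengths)
sublocale CX: pair_prob_space gw_splits "gw_lengths \<gamma>" ..

lemma emeasure_E_UNIV [simp]: "emeasure E UNIV = 1"
  using E.emeasure_space_1 by (simp only: space_density space_lborel space_borel)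

lemma emeasure_G_UNIV [simp]: "emeasure G UNIV = 1"
  using G.emeasure_space_1 by (simp only: space_plane_gw)

lemma emeasure_gw_splits_UNIV [simp]: "emeasure gw_splits UNIV = 1"
  using C.emeasure_space_1 by (simp only: space_gw_splits)

lemma measurable_gw_tree' [measurable (raw)]:
  assumes "f \<in> M \<rightarrow>\<^sub>M gw_splits" "g \<in> M \<rightarrow>\<^sub>M gw_lengths \<gamma>"
  shows "(\<lambda>w. gw_tree (f w) (g w)) \<in> M \<rightarrow>\<^sub>M plane_space"
  using measurable_compose[OF measurable_Pair[OF assms] measurable_gw_tree] by simp

text \<open>Conditioning on the progenitor: its split and its edge are independent of the data in
  the two subfamilies of addresses, which are copies of the whole family.\<close>

lemma nn_integral_gw_graft:
  assumes [measurable]: "f \<in> borel_measurable plane_space"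
  shows "(\<integral>\<^sup>+t. f t \<partial>G) = (\<integral>\<^sup>+e. f (Node Leaf e Leaf) \<partial>E) / 2 +
    (\<integral>\<^sup>+e. \<integral>\<^sup>+l. \<integral>\<^sup>+r. f (graft l e r) \<partial>G \<partial>G \<partial>E) / 2"
proof -
  define K where "K b y z = (\<integral>\<^sup>+e. \<integral>\<^sup>+p. \<integral>\<^sup>+q.
      f (if b then graft (gw_tree y p) e (gw_tree z q) else Node Leaf e Leaf)
      \<partial>gw_lengths \<gamma> \<partial>gw_lengths \<gamma> \<partial>E)" for b y z
  define \<Phi> where "\<Phi> e l = (\<integral>\<^sup>+r. f (graft l e r) \<partial>G)" for e l
  have [measurable]: "case_prod \<Phi> \<in> borel_measurable (borel \<Otimes>\<^sub>M plane_space)"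
    unfolding \<Phi>_def by measurable
  have \<Phi>: "\<Phi> e l = (\<integral>\<^sup>+z. \<integral>\<^sup>+q. f (graft l e (gw_tree z q)) \<partial>gw_lengths \<gamma> \<partial>gw_splits)" for e l
    unfolding \<Phi>_def by (rule nn_integral_plane_gw[OF \<gamma>_pos]) measurable
  have "(\<integral>\<^sup>+t. f t \<partial>G) = (\<integral>\<^sup>+c. \<integral>\<^sup>+x. f (gw_tree c x) \<partial>gw_lengths \<gamma> \<partial>gw_splits)"
    by (rule nn_integral_plane_gw[OF \<gamma>_pos]) measurable
  also have "\<dots> = (\<integral>\<^sup>+c. K (c []) (\<lambda>u. c (False # u)) (\<lambda>u. c (True # u)) \<partial>gw_splits)"
  proof (rule nn_integral_cong)
    fix c assume "c \<in> space gw_splits"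
    have "(\<integral>\<^sup>+x. f (gw_tree c x) \<partial>gw_lengths \<gamma>) =
      (\<integral>\<^sup>+x. (\<lambda>e p q. f (if c [] then graft (gw_tree (\<lambda>u. c (False # u)) p) e (gw_tree (\<lambda>u. c (True # u)) q)
        else Node Leaf e Leaf)) (x []) (\<lambda>u. x (False # u)) (\<lambda>u. x (True # u)) \<partial>gw_lengths \<gamma>)"
      by (subst gw_tree_graft) simp
    also have "\<dots> = K (c []) (\<lambda>u. c (False # u)) (\<lambda>u. c (True # u))"
      unfolding K_def
      by (rule nn_integral_PiM_bool_list[OF E.prob_space_axioms]) measurable
    finally show "(\<integral>\<^sup>+x. f (gw_tree c x) \<partial>gw_lengths \<gamma>) = \<dots>" .
  qed
  also have "\<dots> = (\<integral>\<^sup>+b. \<integral>\<^sup>+y. \<integral>\<^sup>+z. K b y z \<partial>gw_splits \<partial>gw_splits \<partial>measure_pmf (bernoulli_pmf (1 / 2)))"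
    unfolding K_def
    by (rule nn_integral_PiM_bool_list[OF measure_pmf.prob_space_axioms]) measurable
  also have "\<dots> = (\<integral>\<^sup>+y. \<integral>\<^sup>+z. K False y z \<partial>gw_splits \<partial>gw_splits) / 2 +
      (\<integral>\<^sup>+y. \<integral>\<^sup>+z. K True y z \<partial>gw_splits \<partial>gw_splits) / 2"
    by (simp add: add.commute divide_ennreal_def ennreal_half)
  also have "(\<integral>\<^sup>+y. \<integral>\<^sup>+z. K False y z \<partial>gw_splits \<partial>gw_splits) = (\<integral>\<^sup>+e. f (Node Leaf e Leaf) \<partial>E)"
    by (simp add: K_def X.emeasure_space_1)
  \<comment> \<open>The integrals come in the order y, z, e, p, q. Fubini moves e to the front and
    brings each choice of splits next to its lengths, so that (y, p) and (z, q) each sample one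
    tree.\<close>
  also have "(\<integral>\<^sup>+y. \<integral>\<^sup>+z. K True y z \<partial>gw_splits \<partial>gw_splits) =
     (\<integral>\<^sup>+y. \<integral>\<^sup>+e. \<integral>\<^sup>+z. \<integral>\<^sup>+p. \<integral>\<^sup>+q. f (graft (gw_tree y p) e (gw_tree z q))
       \<partial>gw_lengths \<gamma> \<partial>gw_lengths \<gamma> \<partial>gw_splits \<partial>E \<partial>gw_splits)"
    unfolding K_def if_True
    by (intro nn_integral_cong nn_integral_swap C.sigma_finite_measure_axioms E.sigma_finite_measure_axioms) measurable
  also have "\<dots> = (\<integral>\<^sup>+e. \<integral>\<^sup>+y. \<integral>\<^sup>+z. \<integral>\<^sup>+p. \<integral>\<^sup>+q. f (graft (gw_tree y p) e (gw_tree z q))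
       \<partial>gw_lengths \<gamma> \<partial>gw_lengths \<gamma> \<partial>gw_splits \<partial>gw_splits \<partial>E)"
    by (intro nn_integral_swap C.sigma_finite_measure_axioms E.sigma_finite_measure_axioms) measurable
  also have "\<dots> = (\<integral>\<^sup>+e. \<integral>\<^sup>+y. \<integral>\<^sup>+p. \<integral>\<^sup>+z. \<integral>\<^sup>+q. f (graft (gw_tree y p) e (gw_tree z q))
       \<partial>gw_lengths \<gamma> \<partial>gw_splits \<partial>gw_lengths \<gamma> \<partial>gw_splits \<partial>E)"
    by (intro nn_integral_cong nn_integral_swap C.sigma_finite_measure_axioms X.sigma_finite_measure_axioms) measurable
  also have "\<dots> = (\<integral>\<^sup>+e. \<integral>\<^sup>+l. \<Phi> e l \<partial>G \<partial>E)"
    unfolding \<Phi>[symmetric] by (intro nn_integral_cong nn_integral_plane_gw[OF \<gamma>_pos, symmetric]) measurable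
  finally show ?thesis unfolding \<Phi>_def .
qed

text \<open>The extinction probability solves \<open>q = 1/2 + q\<^sup>2/2\<close>, whose only solution is 1.\<close>

lemma AE_gw_not_Leaf: "AE t in G. t \<noteq> Leaf"
proof -
  define q where "q = emeasure G {t. t \<noteq> Leaf}"
  have meas [measurable]: "{t. t \<noteq> Leaf} \<in> sets plane_space"
    using sets.compl_sets[OF Leaf_in_tree_sigma, of "borel :: real measure"]
    by (simp add: Compl_eq_Diff_UNIV[symmetric] Compl_eq)
  have "q = (\<integral>\<^sup>+t. indicator {t. t \<noteq> Leaf} t \<partial>G)"
    unfolding q_def by simp
  also have "\<dots> = (\<integral>\<^sup>+e. indicator {t. t \<noteq> Leaf} (Node Leaf e Leaf) \<partial>E) / 2 +
    (\<integral>\<^sup>+e. \<integral>\<^sup>+l. \<integral>\<^sup>+r. indicator {t. t \<noteq> Leaf} (graft l e r) \<partial>G \<partial>G \<partial>E) / 2"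
    by (rule nn_integral_gw_graft) measurable
  also have "(\<integral>\<^sup>+e. \<integral>\<^sup>+l. \<integral>\<^sup>+r. indicator {t. t \<noteq> Leaf} (graft l e r) \<partial>G \<partial>G \<partial>E) =
    (\<integral>\<^sup>+e. \<integral>\<^sup>+l. \<integral>\<^sup>+r. indicator {t. t \<noteq> Leaf} l * indicator {t. t \<noteq> Leaf} r \<partial>G \<partial>G \<partial>E)"
    by (intro nn_integral_cong) (auto simp: graft_def indicator_def)
  also have "\<dots> = q * q"
    by (simp add: nn_integral_cmult nn_integral_multc q_def)
  also have "(\<integral>\<^sup>+e. indicator {t. t \<noteq> Leaf} (Node Leaf e Leaf) \<partial>E) = 1"
    by (simp add: E.emeasure_space_1)
  finally have q: "q = 1 / 2 + q * q / 2" .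
  obtain p where p: "q = ennreal p" "0 \<le> p"
    unfolding q_def by (metis G.emeasure_eq_measure measure_nonneg)
  have "q * q / 2 = ennreal (p * p / 2)"
    using divide_ennreal[of "p * p" 2] p by (simp add: ennreal_mult)
  moreover have "1 / 2 = ennreal (1 / 2)" using divide_ennreal[of 1 2] by simp
  ultimately have "ennreal p = ennreal (1 / 2 + p * p / 2)"
    using q p by (simp add: ennreal_plus)
  then have "p = 1 / 2 + p * p / 2" using p(2) by (subst (asm) ennreal_inj) auto
  then have "(p - 1)\<^sup>2 = 0" by (simp add: power2_eq_square algebra_simps)
  then have "q = 1" using p by simp
  then show ?thesis unfolding q_def
    by (intro G.AE_I_eq_1) auto
qed

text \<open>Since infinite families have probability zero, the absorbing default disappears from the
  recursion. Most later computations start from this form.\<close>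

lemma nn_integral_gw:
  assumes [measurable]: "f \<in> borel_measurable plane_space"
  shows "(\<integral>\<^sup>+t. f t \<partial>G) = (\<integral>\<^sup>+e. f (Node Leaf e Leaf) \<partial>E) / 2 +
    (\<integral>\<^sup>+e. \<integral>\<^sup>+l. \<integral>\<^sup>+r. f (Node l e r) \<partial>G \<partial>G \<partial>E) / 2"
proof -
  have inner: "(\<integral>\<^sup>+r. f (graft l e r) \<partial>G) = (\<integral>\<^sup>+r. f (Node l e r) \<partial>G)" if "l \<noteq> Leaf" for l e
  proof (rule nn_integral_cong_AE)
    show "AE r in G. f (graft l e r) = f (Node l e r)"
      using AE_gw_not_Leaf by eventually_elim (simp add: graft_def that)
  qed
  have eq: "(\<integral>\<^sup>+l. \<integral>\<^sup>+r. f (graft l e r) \<partial>G \<partial>G) = (\<integral>\<^sup>+l. \<integral>\<^sup>+r. f (Node l e r) \<partial>G \<partial>G)" for e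
  proof (rule nn_integral_cong_AE)
    show "AE l in G. (\<integral>\<^sup>+r. f (graft l e r) \<partial>G) = (\<integral>\<^sup>+r. f (Node l e r) \<partial>G)"
      using AE_gw_not_Leaf by eventually_elim (rule inner)
  qed
  show ?thesis by (simp only: nn_integral_gw_graft[OF assms] eq)
qed

end

section \<open>Positivity and reducedness\<close>

lemma gw_family_length_trees:
  assumes "gw_family c x u t" "\<And>v. 0 < x v"
  shows "t \<noteq> Leaf \<and> reduced_plane t \<and> (\<forall>e\<in>set_tree t. 0 < e)"
  using assms by (induction rule: gw_family.induct) auto

definition positive_plane :: "real tree \<Rightarrow> bool" where
  "positive_plane t \<longleftrightarrow> reduced_plane t \<and> (\<forall>e\<in>set_tree t. 0 < e)"

lemma length_trees_unordered [simp]: "unordered t \<in> length_trees \<longleftrightarrow> positive_plane t"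
  by (auto simp: length_trees_def positive_plane_def edge_labels.abs_eq)

lemma measurable_positive_plane [measurable]: "Measurable.pred plane_space positive_plane"
proof -
  have "(\<forall>e\<in>set_tree t. 0 < e) = rec_tree True (\<lambda>l v r l' r'. l' \<and> 0 < v \<and> r') t" for t :: "real tree"
    by (induction t) auto
  then have "Measurable.pred plane_space (\<lambda>t. \<forall>e\<in>set_tree t. (0::real) < e)"
    by (simp del: Ball_def) measurable
  then show ?thesis unfolding positive_plane_def by measurable
qed

context galton_watson begin

lemma AE_E_pos: "AE e in E. 0 < e"
proof -
  \<comment> \<open>The exponential density is positive at 0, so this point is removed as a Lebesgue
    null set.\<close>
  have "AE e in lborel. e \<noteq> (0::real)" by (rule AE_lborel_singleton)
  then show ?thesis
    by (subst AE_density) (auto simp: exponential_density_def ennreal_eq_0_iff)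
qed

lemma AE_gw_positive: "AE t in G. positive_plane t"
proof -
  have "AE x in gw_lengths \<gamma>. \<forall>u. 0 < x u"
    unfolding AE_all_countable
    by (intro allI AE_PiM_component[where P = "\<lambda>e. 0 < e"] E.prob_space_axioms AE_E_pos) auto
  then have "AE x in gw_lengths \<gamma>. positive_plane (gw_tree c x)" for c
  proof eventually_elim
    case (elim x)
    then show ?case
      using gw_family_length_trees[of c x "[]" "gw_tree c x"] gw_tree_eq_iff[of "gw_tree c x" c x]
      by (cases "gw_tree c x = Leaf") (auto simp: positive_plane_def)
  qed
  then have "AE p in gw_splits \<Otimes>\<^sub>M gw_lengths \<gamma>. positive_plane (gw_tree (fst p) (snd p))"
    by (intro CX.AE_pair_measure) auto
  moreover have "{t. positive_plane t} \<in> sets plane_space"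
    using measurable_positive_plane by (simp add: pred_def)
  ultimately show ?thesis unfolding plane_gw_def
    by (subst AE_distr_iff) (auto simp: case_prod_beta' measurable_gw_tree)
qed

end

section \<open>Competing exponential clocks\<close>

lemma emeasure_exponential_greaterThan:
  assumes "0 < r" "0 \<le> y"
  shows "emeasure (density lborel (exponential_density r)) {y<..} = ennreal (exp (- r * y))"
proof -
  interpret prob_space "density lborel (exponential_density r)"
    using assms(1) by (rule prob_space_exponential_density)
  have "distributed (density lborel (exponential_density r)) lborel (\<lambda>x. x) (exponential_density r)"
    by (auto simp: distributed_def distr_id2 assms(1) exponential_density_nonneg)
  from exponential_distributedD_gt[OF this assms(2,1)]
  show ?thesis by (simp add: emeasure_eq_measure greaterThan_def mult.commute)
qed

text \<open>If clock \<open>m\<close> rings at time y, all others are later with probability exp (-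
  y r), where r is the sum of their rates. This factor turns the density of clock \<open>m\<close>
  into \<open>r m / sum r J\<close> times the exponential density of the total rate: which clock
  wins is independent of when it rings.\<close>

lemma nn_integral_first_clock:
  assumes J: "finite J" "m \<in> J" and r: "\<And>n. 0 < r n"
    and \<Psi> [measurable]: "\<Psi> \<in> borel_measurable borel"
  shows "(\<integral>\<^sup>+x. indicator {x. \<forall>n\<in>J - {m}. x m < x n} x * \<Psi> (x m)
      \<partial>PiM J (\<lambda>n. density lborel (exponential_density (r n)))) =
    ennreal (r m / sum r J) * (\<integral>\<^sup>+e. \<Psi> e \<partial>density lborel (exponential_density (sum r J)))"
    (is "integral\<^sup>N (PiM J ?D) _ = _")
proof -
  interpret D: prob_space "?D n" for n using r by (intro prob_space_exponential_density) auto
  interpret D: product_sigma_finite ?D by standard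
  let ?I = "J - {m}" and ?R = "sum r J"
  have ins: "insert m ?I = J" using J by auto
  have R: "0 < ?R" using J r by (intro sum_pos) auto
  have RI: "?R = r m + sum r ?I" using J by (simp add: sum.remove)
  have meas: "(\<lambda>x. indicator {x. \<forall>n\<in>?I. x m < x n} x * \<Psi> (x m)) \<in> borel_measurable (PiM (insert m ?I) ?D)"
  proof -
    have comp [measurable]: "(\<lambda>x. x n) \<in> borel_measurable (PiM (insert m ?I) ?D)" if "n \<in> insert m ?I" for n
      using measurable_component_singleton[OF that, of ?D] by simp
    have "Measurable.pred (PiM (insert m ?I) ?D) (\<lambda>x. x m < x n)" if "n \<in> ?I" for n
      using that by (intro borel_measurable_pred_less comp) auto
    then have [measurable]: "Measurable.pred (PiM (insert m ?I) ?D) (\<lambda>x. \<forall>n\<in>?I. x m < x n)"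
      using J by (intro pred_intros_finite) auto
    have "(\<lambda>x. (if \<forall>n\<in>?I. x m < x n then 1 else 0) * \<Psi> (x m)) \<in> borel_measurable (PiM (insert m ?I) ?D)"
      by measurable
    moreover have "(\<lambda>x. indicator {x. \<forall>n\<in>?I. x m < x n} x * \<Psi> (x m)) =
      (\<lambda>x. (if \<forall>n\<in>?I. x m < x n then 1 else 0) * \<Psi> (x m))"
      by (auto simp: fun_eq_iff indicator_def)
    ultimately show ?thesis by simp
  qed
  have "(\<integral>\<^sup>+x. indicator {x. \<forall>n\<in>?I. x m < x n} x * \<Psi> (x m) \<partial>PiM J ?D) =
    (\<integral>\<^sup>+x. indicator {x. \<forall>n\<in>?I. x m < x n} x * \<Psi> (x m) \<partial>PiM (insert m ?I) ?D)"
    by (simp only: ins)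
  also have "\<dots> = (\<integral>\<^sup>+y. \<integral>\<^sup>+x. indicator (Pi\<^sub>E ?I (\<lambda>_. {y<..})) x * \<Psi> y \<partial>PiM ?I ?D \<partial>?D m)"
    by (subst D.product_nn_integral_insert_rev[OF _ _ meas])
      (use J in \<open>auto intro!: nn_integral_cong simp: indicator_def space_PiM PiE_iff\<close>)
  also have "\<dots> = (\<integral>\<^sup>+y. (\<Prod>n\<in>?I. emeasure (?D n) {y<..}) * \<Psi> y \<partial>?D m)"
    using J by (intro nn_integral_cong) (simp add: nn_integral_multc D.emeasure_PiM)
  also have "\<dots> = (\<integral>\<^sup>+y. ennreal (exponential_density (r m) y) *
      ((\<Prod>n\<in>?I. emeasure (?D n) {y<..}) * \<Psi> y) \<partial>lborel)"
  proof (rule nn_integral_density)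
    have "(\<lambda>y. emeasure (?D n) {y<..}) \<in> borel_measurable borel" for n
    proof -
      have "(\<lambda>y. emeasure (?D n) (Pair y -` {p. fst p < snd p})) \<in> borel_measurable borel"
      proof (rule D.measurable_emeasure_Pair)
        have "{p :: real \<times> real. fst p < snd p} \<in> sets (borel \<Otimes>\<^sub>M borel)"
          unfolding borel_prod by (intro borel_open open_Collect_less continuous_intros)
        then show "{p. fst p < snd p} \<in> sets (borel \<Otimes>\<^sub>M ?D n)"
          by (simp cong: sets_pair_measure_cong)
      qed
      moreover have "Pair y -` {p. fst p < snd p} = {y<..}" for y :: real by auto
      ultimately show ?thesis by (simp only:)
    qed
    note this[measurable]
    show "(\<lambda>y. (\<Prod>n\<in>?I. emeasure (?D n) {y<..}) * \<Psi> y) \<in> borel_measurable lborel"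
      by measurable
  qed measurable
  also have "\<dots> = (\<integral>\<^sup>+y. ennreal (r m / ?R) * (ennreal (exponential_density ?R y) * \<Psi> y) \<partial>lborel)"
  proof (rule nn_integral_cong)
    fix y :: real
    show "ennreal (exponential_density (r m) y) * ((\<Prod>n\<in>?I. emeasure (?D n) {y<..}) * \<Psi> y) =
      ennreal (r m / ?R) * (ennreal (exponential_density ?R y) * \<Psi> y)"
    proof (cases "0 \<le> y")
      case True
      have "(\<Prod>n\<in>?I. emeasure (?D n) {y<..}) = (\<Prod>n\<in>?I. ennreal (exp (- r n * y)))"
        using True r by (intro prod.cong refl emeasure_exponential_greaterThan) auto
      also have "\<dots> = ennreal (exp (\<Sum>n\<in>?I. - r n * y))"
        using J by (simp add: prod_ennreal exp_sum)
      also have "(\<Sum>n\<in>?I. - r n * y) = - sum r ?I * y"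
        by (simp add: sum_distrib_right sum_negf)
      finally have P: "(\<Prod>n\<in>?I. emeasure (?D n) {y<..}) = ennreal (exp (- sum r ?I * y))" .
      have "ennreal (exponential_density (r m) y) * ennreal (exp (- sum r ?I * y)) =
        ennreal (r m * exp (- r m * y) * exp (- sum r ?I * y))"
        using True r[of m] by (simp add: exponential_density_def ennreal_mult'' mult.commute)
      also have "r m * exp (- r m * y) * exp (- sum r ?I * y) = r m * exp (- ?R * y)"
        unfolding RI by (simp add: exp_add[symmetric] algebra_simps)
      also have "\<dots> = r m / ?R * exponential_density ?R y"
        using True R by (simp add: exponential_density_def mult.commute)
      also have "ennreal \<dots> = ennreal (r m / ?R) * ennreal (exponential_density ?R y)"
        using R r[of m] by (intro ennreal_mult') simp
      finally show ?thesis unfolding P by (simp only: mult.assoc[symmetric])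
    qed (simp add: exponential_density_def)
  qed
  also have "\<dots> = ennreal (r m / ?R) * (\<integral>\<^sup>+e. \<Psi> e \<partial>density lborel (exponential_density ?R))"
    by (subst nn_integral_cmult) (auto simp: nn_integral_density)
  finally show ?thesis .
qed

section \<open>The hierarchical branching process\<close>

text \<open>A numbering of the events that can happen to a branch of order \<open>j\<close>: those with number less than \<open>j\<close>.\<close>

definition evt :: "nat \<Rightarrow> event" where
  "evt n = (if n = 0 then Termination else Offspring n)"

lemma inj_evt: "inj evt"
  by (auto simp: inj_def evt_def)

text \<open>Orders of the edges starting at the end of the current one, at \<open>False\<close> and
  at \<open>True\<close>. After an offspring event the first component is the order of the
  continuing branch; \<open>None\<close> means that the edge ends in a leaf of the tree.\<close>

definition offspring_orders :: "nat \<Rightarrow> nat \<Rightarrow> (nat \<times> nat) option" where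
  "offspring_orders j n =
     (if n = 0 then (if j = 1 then None else Some (j - 1, j - 1)) else Some (j, n))"

definition subfamily :: "bool \<Rightarrow> (bool list \<times> nat \<times> event \<Rightarrow> real) \<Rightarrow> bool list \<times> nat \<times> event \<Rightarrow> real" where
  "subfamily b \<omega> = (\<lambda>(u, i). \<omega> (b # u, i))"

locale hbp = galton_watson +
  fixes lam Tk :: "nat \<Rightarrow> real"
  assumes lam: "\<And>j. 1 \<le> j \<Longrightarrow> lam j = \<gamma> * 2 powr (2 - real j)"
    and Tk: "\<And>k. 1 \<le> k \<Longrightarrow> Tk k = 2 ^ (k - 1)"
begin

abbreviation "rate j n \<equiv> event_rate Tk lam j (evt n)"
abbreviation "W \<equiv> hbp_space Tk lam"
abbreviation "tree \<omega> j \<equiv> history_tree Tk lam \<omega> j"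

lemma lam_pos: "1 \<le> j \<Longrightarrow> 0 < lam j"
  using \<gamma>_pos by (simp add: lam)

lemma event_rate_pos_iff: "1 \<le> j \<Longrightarrow> 0 < event_rate Tk lam j a \<longleftrightarrow> (\<exists>n<j. a = evt n)"
proof (cases a)
  case Termination
  moreover assume "1 \<le> j"
  ultimately show ?thesis using lam_pos by (auto simp: event_rate_def evt_def intro!: exI[of _ 0])
next
  case (Offspring i)
  moreover assume "1 \<le> j"
  ultimately show ?thesis using lam_pos[of j] by (auto simp: event_rate_def evt_def Tk intro!: exI[of _ i])
qed

lemma rate_pos_iff: "1 \<le> j \<Longrightarrow> 0 < rate j n \<longleftrightarrow> n < j"
  using inj_evt by (auto simp: event_rate_pos_iff dest: injD)

text \<open>The powers of 2 in \<open>lam j\<close> and \<open>Tk (j - n)\<close> cancel in such a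
  way that offspring of order n arrive at a rate that does not depend on the order j of the parent.
  This is what makes the parameters special.\<close>

lemma rate_eq:
  assumes "n < j"
  shows "rate j n = 2 * \<gamma> * (if n = 0 then 2 powr (1 - real j) else 2 powr (- real n))"
proof (cases "n = 0")
  case True
  have "2 powr (2 - real j) = 2 * 2 powr (1 - real j)"
    by (simp add: powr_diff)
  then show ?thesis using True assms by (simp add: event_rate_def evt_def lam)
next
  case False
  have "(2::real) ^ (j - n - 1) = 2 powr (real j - real n - 1)"
    using assms False by (subst powr_realpow[symmetric]) (auto simp: of_nat_diff algebra_simps)
  then have "2 powr (2 - real j) * 2 ^ (j - n - 1) = 2 powr (1 - real n)"
    by (simp add: powr_add[symmetric])
  also have "\<dots> = 2 * 2 powr (- real n)" by (simp add: powr_diff powr_minus divide_inverse)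
  finally show ?thesis using False assms by (simp add: event_rate_def evt_def lam Tk)
qed

text \<open>The termination weight \<open>2 powr (1 - real j)\<close> is exactly the tail that the
  geometric sum of the offspring weights is missing.\<close>

lemma sum_rate: "1 \<le> j \<Longrightarrow> (\<Sum>n<j. rate j n) = 2 * \<gamma>"
proof -
  assume j: "1 \<le> j"
  have geo: "2 powr (- real k) + (\<Sum>n=1..<Suc k. 2 powr (- real n)) = 1" for k
  proof (induction k)
    case (Suc k)
    have "2 powr (- real k) = 2 * 2 powr (- real (Suc k))"
      using powr_add[of "2::real" 1 "- real (Suc k)"] by simp
    then show ?case using Suc by simp
  qed simp
  have "(\<Sum>n<j. rate j n) = (\<Sum>n<j. 2 * \<gamma> * (if n = 0 then 2 powr (1 - real j) else 2 powr (- real n)))"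
    by (rule sum.cong) (auto simp: rate_eq)
  also have "\<dots> = 2 * \<gamma> * (\<Sum>n<j. (if n = 0 then 2 powr (1 - real j) else 2 powr (- real n)))"
    by (simp add: sum_distrib_left)
  also have "(\<Sum>n<j. (if n = 0 then 2 powr (1 - real j) else 2 powr (- real n))) =
     2 powr (1 - real j) + (\<Sum>n=1..<j. 2 powr (- real n))"
  proof -
    have "{..<j} = insert 0 {1..<j}" using j by auto
    then show ?thesis by simp
  qed
  also have "\<dots> = 1" using geo[of "j - 1"] j by (simp add: of_nat_diff)
  finally show ?thesis by simp
qed

lemma first_event_iff:
  assumes "1 \<le> j"
  shows "first_event Tk lam \<omega> u j (evt n) \<longleftrightarrow> n < j \<and> (\<forall>k\<in>{..<j} - {n}. \<omega> (u, j, evt n) < \<omega> (u, j, evt k))"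
  unfolding first_event_def event_rate_pos_iff[OF assms]
  using injD[OF inj_evt] by (fastforce)

lemma first_event_subfamily:
  "first_event Tk lam (subfamily b \<omega>) u j a \<longleftrightarrow> first_event Tk lam \<omega> (b # u) j a"
  by (simp add: first_event_def subfamily_def)

lemma history_subfamily:
  "history Tk lam \<omega> (b # u) j t \<longleftrightarrow> history Tk lam (subfamily b \<omega>) u j t"
proof
  have "history Tk lam \<omega> w j t \<Longrightarrow> w = b # u \<Longrightarrow> history Tk lam (subfamily b \<omega>) u j t" for w
  proof (induction arbitrary: u rule: history.induct)
    case (1 w)
    then have "history Tk lam (subfamily b \<omega>) u 1 (Node Leaf (subfamily b \<omega> (u, 1, Termination)) Leaf)"
      by (intro history.intros) (auto simp: first_event_subfamily)
    then show ?case using 1 by (simp add: subfamily_def)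
  next
    case (2 w j l r)
    then have "history Tk lam (subfamily b \<omega>) u j (Node l (subfamily b \<omega> (u, j, Termination)) r)"
      by (intro history.intros) (auto simp: first_event_subfamily)
    then show ?case using 2 by (simp add: subfamily_def)
  next
    case (3 w j i l r)
    then have "history Tk lam (subfamily b \<omega>) u j (Node l (subfamily b \<omega> (u, j, Offspring i)) r)"
      by (intro history.intros) (auto simp: first_event_subfamily)
    then show ?case using 3 by (simp add: subfamily_def)
  qed
  then show "history Tk lam \<omega> (b # u) j t \<Longrightarrow> history Tk lam (subfamily b \<omega>) u j t" by simp
  show "history Tk lam (subfamily b \<omega>) u j t \<Longrightarrow> history Tk lam \<omega> (b # u) j t"
  proof (induction rule: history.induct)
    case (1 u)
    then have "history Tk lam \<omega> (b # u) 1 (Node Leaf (\<omega> (b # u, 1, Termination)) Leaf)"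
      by (intro history.intros) (auto simp: first_event_subfamily)
    then show ?case by (simp add: subfamily_def)
  next
    case (2 u j l r)
    then have "history Tk lam \<omega> (b # u) j (Node l (\<omega> (b # u, j, Termination)) r)"
      by (intro history.intros) (auto simp: first_event_subfamily)
    then show ?case by (simp add: subfamily_def)
  next
    case (3 u j i l r)
    then have "history Tk lam \<omega> (b # u) j (Node l (\<omega> (b # u, j, Offspring i)) r)"
      by (intro history.intros) (auto simp: first_event_subfamily)
    then show ?case by (simp add: subfamily_def)
  qed
qed

lemma first_event_unique:
  "first_event Tk lam \<omega> u j a \<Longrightarrow> first_event Tk lam \<omega> u j b \<Longrightarrow> a = b"
  unfolding first_event_def by (metis less_asym)

lemma history_unique: "history Tk lam \<omega> u j t \<Longrightarrow> history Tk lam \<omega> u j t' \<Longrightarrow> t = t'"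
proof (induction arbitrary: t' rule: history.induct)
  case (1 u)
  from 1(2,1) show ?case by cases (auto dest: first_event_unique)
next
  case (2 u j l r)
  from 2(7,1,2,5,6) show ?case by cases (auto dest: first_event_unique)
next
  case (3 u j i l r)
  from 3(6,1,4,5) show ?case by cases (auto dest: first_event_unique)
qed

lemma history_order_pos: "history Tk lam \<omega> u j t \<Longrightarrow> 1 \<le> j"
  by (cases rule: history.cases) (auto simp: first_event_def event_rate_def split: if_splits)

lemma history_not_Leaf [simp]: "\<not> history Tk lam \<omega> u j Leaf"
  by (auto elim: history.cases)

lemma tree_eq_iff: "t \<noteq> Leaf \<Longrightarrow> tree \<omega> j = t \<longleftrightarrow> history Tk lam \<omega> [] j t"
proof -
  assume t: "t \<noteq> Leaf"
  have "history Tk lam \<omega> [] j s \<Longrightarrow> (THE s. history Tk lam \<omega> [] j s) = s" for s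
    using history_unique by blast
  then show ?thesis unfolding history_tree_def using t by auto
qed

text \<open>\<open>L\<close> and \<open>R\<close> are indexed by the starting order: the waiting
  times below an address determine a tree for every order, and the event at the root selects which
  one is used.\<close>

definition grown :: "(bool list \<times> nat \<times> event \<Rightarrow> real) \<Rightarrow> nat \<Rightarrow> nat \<Rightarrow>
    (nat \<Rightarrow> real tree) \<Rightarrow> (nat \<Rightarrow> real tree) \<Rightarrow> real tree" where
  "grown \<omega> j n L R = (case offspring_orders j n of None \<Rightarrow> Node Leaf (\<omega> ([], j, evt n)) Leaf
     | Some (k, i) \<Rightarrow> graft (L k) (\<omega> ([], j, evt n)) (R i))"

lemma history_Nil_iff:
  "history Tk lam \<omega> [] j t \<longleftrightarrow> 1 \<le> j \<and> (\<exists>n<j. first_event Tk lam \<omega> [] j (evt n) \<and>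
     (case offspring_orders j n of None \<Rightarrow> t = Node Leaf (\<omega> ([], j, evt n)) Leaf
      | Some (k, i) \<Rightarrow> \<exists>l r. history Tk lam (subfamily False \<omega>) [] k l \<and>
          history Tk lam (subfamily True \<omega>) [] i r \<and> t = Node l (\<omega> ([], j, evt n)) r))" (is "?l \<longleftrightarrow> ?r")
proof
  assume l: ?l
  then have j: "1 \<le> j" by (rule history_order_pos)
  from l show ?r
  proof (cases rule: history.cases)
    case 1
    then show ?thesis by (auto simp: offspring_orders_def evt_def intro!: exI[of _ 0])
  next
    case (2 l r)
    then show ?thesis by (auto simp: offspring_orders_def evt_def history_subfamily intro!: exI[of _ 0])
  next
    case (3 i l r)
    have "0 < event_rate Tk lam j (Offspring i)" using 3(2) by (simp add: first_event_def)
    then have "1 \<le> i" "i < j" by (auto simp: event_rate_def split: if_splits)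
    then show ?thesis using 3 j by (auto simp: offspring_orders_def evt_def history_subfamily intro!: exI[of _ i])
  qed
next
  assume ?r
  then obtain n where n: "1 \<le> j" "n < j" "first_event Tk lam \<omega> [] j (evt n)"
    "case offspring_orders j n of None \<Rightarrow> t = Node Leaf (\<omega> ([], j, evt n)) Leaf
      | Some (k, i) \<Rightarrow> \<exists>l r. history Tk lam (subfamily False \<omega>) [] k l \<and>
          history Tk lam (subfamily True \<omega>) [] i r \<and> t = Node l (\<omega> ([], j, evt n)) r" by blast
  show ?l
  proof (cases "n = 0")
    case True
    show ?thesis
    proof (cases "j = 1")
      case True
      with n \<open>n = 0\<close> history.intros(1)[of Tk lam \<omega> "[]"] show ?thesis
        by (simp add: offspring_orders_def evt_def)
    next
      case False
      with n \<open>n = 0\<close> show ?thesis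
        by (auto simp: offspring_orders_def evt_def history_subfamily[symmetric] intro!: history.intros)
    qed
  next
    case False
    then show ?thesis using n
      by (auto simp: offspring_orders_def evt_def history_subfamily[symmetric] intro!: history.intros)
  qed
qed

text \<open>As for the Galton-Watson tree, an infinite history below one child makes the whole
  history infinite, so the recursion holds for every outcome that has a first event.\<close>

lemma tree_first_event:
  assumes "1 \<le> j" "first_event Tk lam \<omega> [] j (evt n)"
  shows "tree \<omega> j = grown \<omega> j n (tree (subfamily False \<omega>)) (tree (subfamily True \<omega>))"
proof -
  have n: "n < j" using assms by (simp add: first_event_iff)
  have uniq: "first_event Tk lam \<omega> [] j (evt k) \<longleftrightarrow> k = n" for k
    using first_event_unique[OF assms(2)] assms(2) injD[OF inj_evt] by metis
  have ex: "history Tk lam \<omega>' [] k t \<longleftrightarrow> t \<noteq> Leaf \<and> tree \<omega>' k = t" for \<omega>' k t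
    by (cases "t = Leaf") (auto simp: tree_eq_iff)
  have "t \<noteq> Leaf \<Longrightarrow> tree \<omega> j = t \<longleftrightarrow>
      grown \<omega> j n (tree (subfamily False \<omega>)) (tree (subfamily True \<omega>)) = t" for t
    by (subst tree_eq_iff, assumption, subst history_Nil_iff)
      (use n assms(1) in \<open>auto simp: uniq grown_def graft_def ex split: option.splits prod.splits\<close>)
  then show ?thesis by metis
qed

text \<open>Covers ties between clocks as well as the meaningless order 0.\<close>

lemma tree_no_event:
  assumes "\<And>n. 1 \<le> j \<Longrightarrow> \<not> first_event Tk lam \<omega> [] j (evt n)"
  shows "tree \<omega> j = Leaf"
  using assms tree_eq_iff[of "tree \<omega> j" \<omega> j] history_Nil_iff[of \<omega> j "tree \<omega> j"]
  by (cases "tree \<omega> j = Leaf") auto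

end

section \<open>Law of the planar tree grown from a branch of given order\<close>

context hbp begin

abbreviation "clocks \<equiv> {(u :: bool list, j, a). 1 \<le> j \<and> 0 < event_rate Tk lam j a}"
abbreviation "clock_law \<equiv> (\<lambda>(u :: bool list, j, a). density lborel (exponential_density (event_rate Tk lam j a)))"

lemma prob_space_clock: "i \<in> clocks \<Longrightarrow> prob_space (clock_law i)"
  by (auto intro: prob_space_exponential_density)

sublocale W: prob_space W
  unfolding hbp_space_def by (intro prob_space_PiM prob_space_clock)

lemma measurable_clock:
  assumes "1 \<le> j" "n < j"
  shows "(\<lambda>\<omega>. \<omega> (u, j, evt n)) \<in> borel_measurable W"
proof -
  have "(\<lambda>\<omega>. \<omega> (u, j, evt n)) \<in> W \<rightarrow>\<^sub>M clock_law (u, j, evt n)"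
    unfolding hbp_space_def
    by (rule measurable_component_singleton) (use assms in \<open>auto simp: rate_pos_iff\<close>)
  then show ?thesis by simp
qed

lemma space_W: "space W = PiE clocks (\<lambda>_. UNIV)"
  unfolding hbp_space_def space_PiM by (rule PiE_cong) auto

text \<open>Prefixing an address does not change whether a clock exists, and outcomes in
  \<open>W\<close> are undefined off the clocks; \<open>subfamily\<close> is therefore a mere
  reindexing of coordinates.\<close>

lemma subfamily_restrict: "\<omega> \<in> space W \<Longrightarrow> subfamily b \<omega> = (\<lambda>i\<in>clocks. \<omega> (b # fst i, snd i))"
  by (auto simp: subfamily_def space_W fun_eq_iff PiE_def extensional_def)

lemma measurable_subfamily [measurable]: "subfamily b \<in> W \<rightarrow>\<^sub>M W"
proof -
  have "(\<lambda>\<omega>. \<lambda>i\<in>clocks. \<omega> (b # fst i, snd i)) \<in> W \<rightarrow>\<^sub>M W"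
    unfolding hbp_space_def
  proof (rule measurable_restrict)
    fix i assume "i \<in> clocks"
    then have "(\<lambda>\<omega>. \<omega> (b # fst i, snd i)) \<in> PiM clocks clock_law \<rightarrow>\<^sub>M clock_law (b # fst i, snd i)"
      by (intro measurable_component_singleton) auto
    then show "(\<lambda>\<omega>. \<omega> (b # fst i, snd i)) \<in> PiM clocks clock_law \<rightarrow>\<^sub>M clock_law i"
      by (cases i) simp
  qed
  then show ?thesis by (subst measurable_cong[OF subfamily_restrict])
qed

lemma pred_first_event [measurable]:
  assumes "1 \<le> j"
  shows "Measurable.pred W (\<lambda>\<omega>. first_event Tk lam \<omega> u j (evt n))"
proof (cases "n < j")
  case True
  have "Measurable.pred W (\<lambda>\<omega>. \<omega> (u, j, evt n) < \<omega> (u, j, evt k))" if "k \<in> {..<j} - {n}" for k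
    using that True assms by (intro borel_measurable_pred_less measurable_clock) auto
  then have "Measurable.pred W (\<lambda>\<omega>. \<forall>k\<in>{..<j} - {n}. \<omega> (u, j, evt n) < \<omega> (u, j, evt k))"
    by (intro pred_intros_finite) auto
  then show ?thesis using True by (simp add: first_event_iff[OF assms])
qed (simp add: first_event_iff[OF assms])

primrec tree_approx :: "nat \<Rightarrow> (bool list \<times> nat \<times> event \<Rightarrow> real) \<Rightarrow> nat \<Rightarrow> real tree" where
  "tree_approx 0 \<omega> j = Leaf"
| "tree_approx (Suc m) \<omega> j =
    (if 1 \<le> j \<and> (\<exists>n. first_event Tk lam \<omega> [] j (evt n))
     then grown \<omega> j (LEAST n. first_event Tk lam \<omega> [] j (evt n))
       (tree_approx m (subfamily False \<omega>)) (tree_approx m (subfamily True \<omega>))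
     else Leaf)"

lemma LEAST_first_event:
  "first_event Tk lam \<omega> u j (evt n) \<Longrightarrow> (LEAST n. first_event Tk lam \<omega> u j (evt n)) = n"
  using first_event_unique injD[OF inj_evt] by (metis (mono_tags, lifting) LeastI)

lemma tree_approx_sound: "tree_approx m \<omega> j \<noteq> Leaf \<Longrightarrow> tree \<omega> j = tree_approx m \<omega> j"
proof (induction m arbitrary: \<omega> j)
  case (Suc m)
  then obtain n where n: "1 \<le> j" "first_event Tk lam \<omega> [] j (evt n)" by (auto split: if_splits)
  have "tree_approx (Suc m) \<omega> j =
      grown \<omega> j n (tree_approx m (subfamily False \<omega>)) (tree_approx m (subfamily True \<omega>))"
    using n by (auto simp: LEAST_first_event)
  then show ?case using Suc unfolding tree_first_event[OF n]
    by (auto simp: grown_def graft_def split: option.splits prod.splits if_splits)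
qed simp

lemma tree_approx_complete: "tree \<omega> j \<noteq> Leaf \<Longrightarrow> height (tree \<omega> j) \<le> m \<Longrightarrow> tree_approx m \<omega> j \<noteq> Leaf"
proof (induction m arbitrary: \<omega> j)
  case (Suc m)
  then obtain n where n: "1 \<le> j" "first_event Tk lam \<omega> [] j (evt n)"
    using tree_no_event by blast
  have "tree_approx (Suc m) \<omega> j =
      grown \<omega> j n (tree_approx m (subfamily False \<omega>)) (tree_approx m (subfamily True \<omega>))"
    using n by (auto simp: LEAST_first_event)
  then show ?case using Suc unfolding tree_first_event[OF n]
    by (auto simp: grown_def graft_def split: option.splits prod.splits if_splits)
qed simp

lemma measurable_tree_approx [measurable]: "(\<lambda>\<omega>. tree_approx m \<omega> j) \<in> W \<rightarrow>\<^sub>M plane_space"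
proof (induction m arbitrary: j)
  case (Suc m)
  have sub [measurable]: "(\<lambda>\<omega>. tree_approx m (subfamily b \<omega>) k) \<in> W \<rightarrow>\<^sub>M plane_space" for b k
    by (rule measurable_compose[OF measurable_subfamily Suc])
  show ?case
  proof (cases "1 \<le> j")
    case True
    have g: "(\<lambda>\<omega>. grown \<omega> j n (tree_approx m (subfamily False \<omega>)) (tree_approx m (subfamily True \<omega>)))
      \<in> W \<rightarrow>\<^sub>M plane_space" if n: "n < j" for n
    proof -
      note measurable_clock[OF True n, measurable]
      show ?thesis unfolding grown_def
        by (cases "offspring_orders j n") (auto simp: case_prod_beta)
    qed
    have [measurable]: "(\<lambda>\<omega>. if n < j then grown \<omega> j n (tree_approx m (subfamily False \<omega>))
        (tree_approx m (subfamily True \<omega>)) else Leaf) \<in> W \<rightarrow>\<^sub>M plane_space" for n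
      using g by (cases "n < j") auto
    note pred_first_event[OF True, measurable]
    have [measurable]: "(\<lambda>\<omega>. LEAST n. first_event Tk lam \<omega> [] j (evt n)) \<in> W \<rightarrow>\<^sub>M count_space UNIV"
      by measurable
    \<comment> \<open>The cut-off at j keeps every \<open>F n\<close> measurable, as no coordinate
      of \<open>W\<close> belongs to an event number from j on.\<close>
    define F where "F n \<omega> = (if n < j then grown \<omega> j n (tree_approx m (subfamily False \<omega>))
        (tree_approx m (subfamily True \<omega>)) else Leaf)" for n \<omega>
    have F: "(\<lambda>\<omega>. F (LEAST n. first_event Tk lam \<omega> [] j (evt n)) \<omega>) \<in> W \<rightarrow>\<^sub>M plane_space"
      by (rule measurable_compose_countable[where f = F]) (unfold F_def, measurable)
    have eq: "tree_approx (Suc m) \<omega> j =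
      (if \<exists>n. first_event Tk lam \<omega> [] j (evt n)
       then F (LEAST n. first_event Tk lam \<omega> [] j (evt n)) \<omega> else Leaf)" for \<omega>
    proof (cases "\<exists>n. first_event Tk lam \<omega> [] j (evt n)")
      case ex: True
      then obtain n where n: "first_event Tk lam \<omega> [] j (evt n)" ..
      then have "n < j" by (simp add: first_event_iff[OF True])
      then show ?thesis using ex True by (simp add: LEAST_first_event[OF n] F_def)
    qed simp
    note F[measurable]
    show ?thesis unfolding eq by measurable
  qed simp
qed simp

lemma measurable_tree [measurable]: "(\<lambda>\<omega>. tree \<omega> j) \<in> W \<rightarrow>\<^sub>M plane_space"
  by (rule measurable_tree_limit[where g = "\<lambda>m \<omega>. tree_approx m \<omega> j", OF measurable_tree_approx])
    (auto simp: tree_approx_sound dest: tree_approx_complete[OF _ order_refl])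

text \<open>This planar law is not symmetric, because the continuing branch is always on the left.
  It is compared with \<open>G\<close> through swap-invariant functions only.\<close>

definition H :: "nat \<Rightarrow> real tree measure" where
  "H j = distr W plane_space (\<lambda>\<omega>. tree \<omega> j)"

lemma sets_H [simp, measurable_cong]: "sets (H j) = sets plane_space"
  by (simp add: H_def)

lemma space_H [simp]: "space (H j) = UNIV"
  by (simp add: H_def)

sublocale H: prob_space "H j" for j
  unfolding H_def by (rule W.prob_space_distr) measurable

lemma nn_integral_H:
  "f \<in> borel_measurable plane_space \<Longrightarrow> (\<integral>\<^sup>+t. f t \<partial>H j) = (\<integral>\<^sup>+\<omega>. f (tree \<omega> j) \<partial>W)"
  unfolding H_def by (subst nn_integral_distr) auto

definition event_prob :: "nat \<Rightarrow> nat \<Rightarrow> real" where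
  "event_prob j n = (if n = 0 then 2 powr (1 - real j) else 2 powr (- real n))"

text \<open>The clocks of order j at the root and the waiting times in the two subfamilies form
  three independent blocks. The subfamilies produce two independent trees; the root clocks produce
  the event with its probability and, independently, an edge with total rate
  \<open>2 * \<gamma>\<close>.\<close>

lemma nn_integral_first_event:
  assumes j: "1 \<le> j" "n < j" and [measurable]: "f \<in> borel_measurable plane_space"
  shows "(\<integral>\<^sup>+\<omega>. indicator {\<omega>. first_event Tk lam \<omega> [] j (evt n)} \<omega> *
        f (grown \<omega> j n (tree (subfamily False \<omega>)) (tree (subfamily True \<omega>))) \<partial>W) =
    ennreal (event_prob j n) * (\<integral>\<^sup>+e. (case offspring_orders j n of None \<Rightarrow> f (Node Leaf e Leaf)
      | Some (k, i) \<Rightarrow> \<integral>\<^sup>+l. \<integral>\<^sup>+r. f (graft l e r) \<partial>H i \<partial>H k) \<partial>E)"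
proof -
  define g where "g e y z = (case offspring_orders j n of None \<Rightarrow> f (Node Leaf e Leaf)
     | Some (k, i) \<Rightarrow> f (graft (tree y k) e (tree z i)))" for e y z
  define \<Psi> where "\<Psi> e = (case offspring_orders j n of None \<Rightarrow> f (Node Leaf e Leaf)
      | Some (k, i) \<Rightarrow> \<integral>\<^sup>+l. \<integral>\<^sup>+r. f (graft l e r) \<partial>H i \<partial>H k)" for e
  have [measurable]: "\<Psi> \<in> borel_measurable borel"
    unfolding \<Psi>_def by (cases "offspring_orders j n") (auto simp: case_prod_beta)
  have \<Psi>: "(\<integral>\<^sup>+y. \<integral>\<^sup>+z. g e y z \<partial>W \<partial>W) = \<Psi> e" for e
  proof (cases "offspring_orders j n")
    case None
    then show ?thesis by (simp add: g_def \<Psi>_def W.emeasure_space_1)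
  next
    case (Some p)
    obtain k i where "p = (k, i)" by fastforce
    then show ?thesis using Some by (simp add: g_def \<Psi>_def nn_integral_H)
  qed
  let ?J = "{..<j}" and ?D = "\<lambda>k. density lborel (exponential_density (rate j k))"
  \<comment> \<open>The value 1 outside \<open>{..<j}\<close> is a filler, since
    \<open>nn_integral_first_clock\<close> asks for positive rates everywhere.\<close>
  define r where "r k = (if k < j then rate j k else 1)" for k
  have r: "0 < r k" for k using j by (simp add: r_def rate_pos_iff)
  let ?X = "\<lambda>x :: nat \<Rightarrow> real. indicator {x. \<forall>k\<in>?J - {n}. x n < x k} x :: ennreal"
  have comp [measurable]: "(\<lambda>x. x k) \<in> borel_measurable (PiM ?J ?D)" if "k < j" for k
    using measurable_component_singleton[of k ?J ?D] that by simp
  have X [measurable]: "?X \<in> borel_measurable (PiM ?J ?D)"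
  proof -
    have "Measurable.pred (PiM ?J ?D) (\<lambda>x. \<forall>k\<in>?J - {n}. x n < x k)"
      using j by (intro pred_intros_finite borel_measurable_pred_less comp) auto
    then have [measurable]: "Measurable.pred (PiM ?J ?D) (\<lambda>x. \<forall>k\<in>?J - {n}. x n < x k)" .
    have "(\<lambda>x. if \<forall>k\<in>?J - {n}. x n < x k then 1 else 0 :: ennreal) \<in> borel_measurable (PiM ?J ?D)"
      by measurable
    then show ?thesis by (simp add: indicator_def of_bool_def)
  qed
  have g: "(\<lambda>(x, y, z). ?X x * g (x n) y z) \<in> borel_measurable (PiM ?J ?D \<Otimes>\<^sub>M (W \<Otimes>\<^sub>M W))"
    unfolding g_def case_prod_beta'
    by (cases "offspring_orders j n") (use j in \<open>auto simp: case_prod_beta\<close>)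
  have "(\<integral>\<^sup>+\<omega>. indicator {\<omega>. first_event Tk lam \<omega> [] j (evt n)} \<omega> *
        f (grown \<omega> j n (tree (subfamily False \<omega>)) (tree (subfamily True \<omega>))) \<partial>W) =
      (\<integral>\<^sup>+\<omega>. (\<lambda>x y z. ?X x * g (x n) y z) (\<lambda>k\<in>?J. \<omega> ([], j, evt k))
        (\<lambda>i\<in>clocks. \<omega> (False # fst i, snd i)) (\<lambda>i\<in>clocks. \<omega> (True # fst i, snd i)) \<partial>W)"
    using j by (intro nn_integral_cong)
      (auto simp: subfamily_restrict g_def grown_def first_event_iff indicator_def case_prod_beta split: option.split)
  also have "\<dots> = (\<integral>\<^sup>+x. \<integral>\<^sup>+y. \<integral>\<^sup>+z. ?X x * g (x n) y z \<partial>W \<partial>W \<partial>PiM ?J ?D)"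
  proof -
    have eq: "PiM clocks (\<lambda>i. clock_law (b # fst i, snd i)) = W" for b
      unfolding hbp_space_def by (rule PiM_cong) auto
    have ne: "clocks \<noteq> {}"
      using j rate_pos_iff[of j n] by blast
    have a: "inj_on (\<lambda>k. ([] :: bool list, j, evt k)) ?J" "(\<lambda>k. ([], j, evt k)) \<in> ?J \<rightarrow> clocks"
      using j(1) by (auto simp: inj_on_def rate_pos_iff dest: injD[OF inj_evt])
    have b: "inj_on (\<lambda>i. (b # fst i, snd i)) clocks" "(\<lambda>i. (b # fst i, snd i)) \<in> clocks \<rightarrow> clocks" for b
      by (auto simp: inj_on_def)
    have d: "(\<lambda>k. ([], j, evt k)) ` ?J \<inter> (\<lambda>i. (b # fst i, snd i)) ` clocks = {}"
      "(\<lambda>i. (False # fst i, snd i)) ` clocks \<inter> (\<lambda>i. (True # fst i, snd i)) ` clocks = {}" for b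
      by auto
    have g': "(\<lambda>(x, y, z). ?X x * g (x n) y z) \<in> borel_measurable
        (PiM ?J (\<lambda>k. clock_law ([], j, evt k)) \<Otimes>\<^sub>M
         (PiM clocks (\<lambda>i. clock_law (False # fst i, snd i)) \<Otimes>\<^sub>M PiM clocks (\<lambda>i. clock_law (True # fst i, snd i))))"
      using g unfolding eq by simp
    from nn_integral_PiM_split3[OF prob_space_clock ne ne a b b d(1) d(1) d(2) g']
    show ?thesis unfolding eq hbp_space_def[symmetric] by (simp only: prod.case)
  qed
  also have "\<dots> = (\<integral>\<^sup>+x. ?X x * \<Psi> (x n) \<partial>PiM ?J ?D)"
  proof (rule nn_integral_cong)
    fix x :: "nat \<Rightarrow> real"
    have [measurable]: "(\<lambda>z. g e y z) \<in> borel_measurable W" for e y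
      unfolding g_def by (cases "offspring_orders j n") (auto simp: case_prod_beta)
    have [measurable]: "(\<lambda>y. \<integral>\<^sup>+z. g e y z \<partial>W) \<in> borel_measurable W" for e
      unfolding g_def by (cases "offspring_orders j n") (auto simp: case_prod_beta)
    show "(\<integral>\<^sup>+y. \<integral>\<^sup>+z. ?X x * g (x n) y z \<partial>W \<partial>W) = ?X x * \<Psi> (x n)"
      by (simp add: nn_integral_cmult \<Psi> del: indicator_simps mem_Collect_eq)
  qed
  also have "\<dots> = (\<integral>\<^sup>+x. ?X x * \<Psi> (x n) \<partial>PiM ?J (\<lambda>k. density lborel (exponential_density (r k))))"
    by (intro nn_integral_cong_simp arg_cong2[where f = nn_integral] PiM_cong) (auto simp: r_def)
  also have "\<dots> = ennreal (r n / sum r ?J) * (\<integral>\<^sup>+e. \<Psi> e \<partial>density lborel (exponential_density (sum r ?J)))"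
    by (rule nn_integral_first_clock) (use j r in auto)
  also have "sum r ?J = 2 * \<gamma>"
    using sum_rate[OF j(1)] by (simp add: r_def)
  also have "r n / (2 * \<gamma>) = event_prob j n"
    using \<gamma>_pos j by (simp add: r_def rate_eq event_prob_def)
  finally show ?thesis unfolding \<Psi>_def .
qed

text \<open>First events exclude each other, and in their absence the tree is \<open>Leaf\<close>,
  where f vanishes. Ties between clocks thus contribute nothing to either side.\<close>

lemma nn_integral_H_rec:
  assumes j: "1 \<le> j" and [measurable]: "f \<in> borel_measurable plane_space" and f: "f Leaf = 0"
  shows "(\<integral>\<^sup>+t. f t \<partial>H j) = (\<Sum>n<j. ennreal (event_prob j n) *
    (\<integral>\<^sup>+e. (case offspring_orders j n of None \<Rightarrow> f (Node Leaf e Leaf)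
      | Some (k, i) \<Rightarrow> \<integral>\<^sup>+l. \<integral>\<^sup>+r. f (graft l e r) \<partial>H i \<partial>H k) \<partial>E))"
proof -
  let ?h = "\<lambda>n \<omega>. indicator {\<omega>. first_event Tk lam \<omega> [] j (evt n)} \<omega> *
        f (grown \<omega> j n (tree (subfamily False \<omega>)) (tree (subfamily True \<omega>)))"
  have pw: "f (tree \<omega> j) = (\<Sum>n<j. ?h n \<omega>)" for \<omega>
  proof (cases "\<exists>n. first_event Tk lam \<omega> [] j (evt n)")
    case True
    then obtain n where n: "first_event Tk lam \<omega> [] j (evt n)" ..
    then have uniq: "first_event Tk lam \<omega> [] j (evt k) \<longleftrightarrow> k = n" for k
      using first_event_unique[OF n] injD[OF inj_evt] by metis
    have "n < j" using n j by (simp add: first_event_iff)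
    then show ?thesis using tree_first_event[OF j n]
      by (simp add: uniq indicator_def of_bool_def if_distrib if_distribR cong: if_cong)
  next
    case False
    then show ?thesis using tree_no_event[of j \<omega>] f by simp
  qed
  have meas: "?h n \<in> borel_measurable W" if n: "n < j" for n
  proof -
    note measurable_clock[OF j n, measurable] pred_first_event[OF j, measurable]
    have [measurable]: "(\<lambda>\<omega>. tree (subfamily b \<omega>) k) \<in> W \<rightarrow>\<^sub>M plane_space" for b k
      by (rule measurable_compose[OF measurable_subfamily measurable_tree])
    have [measurable]: "(\<lambda>\<omega>. grown \<omega> j n (tree (subfamily False \<omega>)) (tree (subfamily True \<omega>))) \<in> W \<rightarrow>\<^sub>M plane_space"
      unfolding grown_def by (cases "offspring_orders j n") (auto simp: case_prod_beta)
    have "(\<lambda>\<omega>. (if first_event Tk lam \<omega> [] j (evt n) then 1 else 0) *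
        f (grown \<omega> j n (tree (subfamily False \<omega>)) (tree (subfamily True \<omega>)))) \<in> borel_measurable W"
      by measurable
    then show ?thesis by (simp add: indicator_def of_bool_def)
  qed
  have "(\<integral>\<^sup>+t. f t \<partial>H j) = (\<integral>\<^sup>+\<omega>. (\<Sum>n<j. ?h n \<omega>) \<partial>W)"
    by (simp add: nn_integral_H pw)
  also have "\<dots> = (\<Sum>n<j. \<integral>\<^sup>+\<omega>. ?h n \<omega> \<partial>W)"
    by (rule nn_integral_sum) (auto intro: meas)
  also have "\<dots> = (\<Sum>n<j. ennreal (event_prob j n) *
    (\<integral>\<^sup>+e. (case offspring_orders j n of None \<Rightarrow> f (Node Leaf e Leaf)
      | Some (k, i) \<Rightarrow> \<integral>\<^sup>+l. \<integral>\<^sup>+r. f (graft l e r) \<partial>H i \<partial>H k) \<partial>E))"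
    using j by (intro sum.cong refl nn_integral_first_event) auto
  finally show ?thesis .
qed

end

section \<open>Equality of the two laws\<close>

definition swap_invariant :: "('e tree \<Rightarrow> 'a) \<Rightarrow> bool" where
  "swap_invariant f \<longleftrightarrow> (\<forall>s t. swap_iso s t \<longrightarrow> f s = f t)"

lemma swap_invariantD: "swap_invariant f \<Longrightarrow> swap_iso s t \<Longrightarrow> f s = f t"
  by (simp add: swap_invariant_def)

lemma swap_iso_graft:
  assumes "swap_iso l l'" "swap_iso r r'"
  shows "swap_iso (graft l e r) (graft l' e r')" "swap_iso (graft l e r) (graft r' e l')"
  using assms by (auto simp: graft_def intro: swap_iso.intros)

lemma swap_iso_height: "swap_iso s t \<Longrightarrow> height s = height t"
  by (induction rule: swap_iso.induct) auto

lemma measurable_height [measurable]: "(height :: real tree \<Rightarrow> nat) \<in> plane_space \<rightarrow>\<^sub>M count_space UNIV"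
  by (rule measurable_of_plane_shape[where g = height]) simp

lemma nn_integral_pmf_nat:
  "(\<integral>\<^sup>+k. f k \<partial>measure_pmf (p :: nat pmf)) = (\<Sum>k. ennreal (pmf p k) * f k)"
  by (simp add: nn_integral_measure_pmf nn_integral_count_space_nat)

lemma suminf_ennreal_head: "(\<Sum>n. f n) = f 0 + (\<Sum>n. f (Suc n))" for f :: "nat \<Rightarrow> ennreal"
  using suminf_offset[of f 1] by (simp add: add.commute)

lemma measurable_pmf_pair:
  "case_prod f \<in> borel_measurable (measure_pmf (p :: nat pmf) \<Otimes>\<^sub>M measure_pmf (q :: nat pmf))"
proof -
  have "case_prod f \<in> count_space UNIV \<Otimes>\<^sub>M count_space UNIV \<rightarrow>\<^sub>M borel"
    by (rule measurable_pair_measure_countable1) auto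
  then show ?thesis by (simp cong: measurable_cong_sets sets_pair_measure_cong)
qed

text \<open>The square of pairs consists of the diagonal and two triangles that mirror each
  other.\<close>

lemma nn_integral_pmf_symmetric:
  assumes sym: "\<And>k i. D k i = D i k"
  shows "(\<integral>\<^sup>+k. \<integral>\<^sup>+i. D k i \<partial>measure_pmf p \<partial>measure_pmf (p :: nat pmf)) =
    (\<Sum>k. ennreal (pmf p k) * (ennreal (pmf p k) * D k k)) +
    2 * (\<integral>\<^sup>+k. \<integral>\<^sup>+i. (if i < k then D k i else 0) \<partial>measure_pmf p \<partial>measure_pmf p)"
proof -
  let ?lt = "\<integral>\<^sup>+k. \<integral>\<^sup>+i. (if i < k then D k i else 0) \<partial>measure_pmf p \<partial>measure_pmf p"
  have "(\<integral>\<^sup>+k. \<integral>\<^sup>+i. D k i \<partial>measure_pmf p \<partial>measure_pmf p) =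
    (\<integral>\<^sup>+k. \<integral>\<^sup>+i. (if i = k then D k i else 0) + ((if i < k then D k i else 0) + (if k < i then D k i else 0))
      \<partial>measure_pmf p \<partial>measure_pmf p)"
    by (intro nn_integral_cong) auto
  also have "\<dots> = (\<integral>\<^sup>+k. \<integral>\<^sup>+i. (if i = k then D k i else 0) \<partial>measure_pmf p \<partial>measure_pmf p) +
     (?lt + (\<integral>\<^sup>+k. \<integral>\<^sup>+i. (if k < i then D k i else 0) \<partial>measure_pmf p \<partial>measure_pmf p))"
    by (simp add: nn_integral_add)
  also have "(\<integral>\<^sup>+k. \<integral>\<^sup>+i. (if k < i then D k i else 0) \<partial>measure_pmf p \<partial>measure_pmf p) = ?lt"
    by (subst nn_integral_swap)
      (auto simp: measurable_pmf_pair measure_pmf.sigma_finite_measure_axioms sym cong: if_cong)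
  also have "(\<integral>\<^sup>+k. \<integral>\<^sup>+i. (if i = k then D k i else 0) \<partial>measure_pmf p \<partial>measure_pmf p) =
     (\<Sum>k. ennreal (pmf p k) * (ennreal (pmf p k) * D k k))"
  proof -
    have "(\<integral>\<^sup>+i. (if i = k then D k i else 0) \<partial>measure_pmf p) = ennreal (pmf p k) * D k k" for k
      unfolding nn_integral_pmf_nat by (subst suminf_finite[of "{k}"]) auto
    then show ?thesis by (simp add: nn_integral_pmf_nat)
  qed
  finally show ?thesis by (simp add: mult_2)
qed

section \<open>The geometric mixture over root orders satisfies the Galton-Watson recursion\<close>

locale geometric_hbp = hbp +
  fixes p :: "nat pmf"
  assumes p: "\<And>K. 1 \<le> K \<Longrightarrow> pmf p K = 2 powr (- real K)"
begin

lemma p_Suc: "pmf p (Suc n) = (1 / 2) ^ Suc n"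
  using p[of "Suc n"] powr_realpow[of 2 "Suc n"]
  by (simp add: powr_minus power_one_over inverse_eq_divide del: of_nat_Suc power_Suc)

text \<open>The prescribed masses on 1, 2, ... already sum to 1.\<close>

lemma p_0 [simp]: "pmf p 0 = 0"
proof -
  have "(\<Sum>n. ennreal (pmf p n)) = 1"
    using nn_integral_pmf_nat[of p "\<lambda>_. 1"] by simp
  moreover have "(\<Sum>n. ennreal (pmf p n)) = ennreal (pmf p 0) + (\<Sum>n. ennreal (pmf p (Suc n)))"
    by (rule suminf_ennreal_head)
  moreover have "(\<Sum>n. ennreal (pmf p (Suc n))) = 1"
    unfolding p_Suc using power_half_series
    by (simp add: suminf_ennreal2 sums_iff)
  ultimately have "1 + ennreal (pmf p 0) = 1" by (simp add: add.commute)
  then have "ennreal (pmf p 0) = 0"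
    using ennreal_add_left_cancel[of 1 "ennreal (pmf p 0)" 0] by simp
  then show ?thesis by simp
qed

text \<open>All weights match: termination of order k + 1 occurs with weight
  \<open>pmf p k * pmf p k / 2\<close> for k \<ge> 1, and an offspring of order i in a branch of
  order k with weight \<open>pmf p k * pmf p i\<close>. The latter stands for both pairs (k, i) and
  (i, k) of weight one half each, which swap-invariance of f identifies.\<close>

lemma nn_integral_mixture:
  assumes [measurable]: "f \<in> borel_measurable plane_space" and f0: "f Leaf = 0" and f: "swap_invariant f"
  shows "(\<integral>\<^sup>+K. \<integral>\<^sup>+t. f t \<partial>H K \<partial>measure_pmf p) = (\<integral>\<^sup>+e. f (Node Leaf e Leaf) \<partial>E) / 2 +
    (\<integral>\<^sup>+k. \<integral>\<^sup>+i. \<integral>\<^sup>+e. \<integral>\<^sup>+l. \<integral>\<^sup>+r. f (graft l e r) \<partial>H i \<partial>H k \<partial>E \<partial>measure_pmf p \<partial>measure_pmf p) / 2"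
proof -
  define D where "D k i = (\<integral>\<^sup>+e. \<integral>\<^sup>+l. \<integral>\<^sup>+r. f (graft l e r) \<partial>H i \<partial>H k \<partial>E)" for k i
  define L where "L = (\<integral>\<^sup>+e. f (Node Leaf e Leaf) \<partial>E)"
  let ?P = "\<lambda>k. ennreal (pmf p k)"
  let ?h = "\<lambda>K. \<integral>\<^sup>+t. f t \<partial>H K"
  let ?lt = "\<lambda>K. \<integral>\<^sup>+i. (if i < K then D K i else 0) \<partial>measure_pmf p"
  have sym: "D k i = D i k" for k i
  proof -
    have "D k i = (\<integral>\<^sup>+e. \<integral>\<^sup>+r. \<integral>\<^sup>+l. f (graft l e r) \<partial>H k \<partial>H i \<partial>E)"
      unfolding D_def
      by (intro nn_integral_cong nn_integral_swap H.sigma_finite_measure_axioms) measurable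
    also have "\<dots> = (\<integral>\<^sup>+e. \<integral>\<^sup>+r. \<integral>\<^sup>+l. f (graft r e l) \<partial>H k \<partial>H i \<partial>E)"
      by (intro nn_integral_cong swap_invariantD[OF f] swap_iso_graft(2) swap_iso_refl)
    finally show ?thesis unfolding D_def .
  qed
  \<comment> \<open>The conditional probability of an offspring of order i does not involve the
    order of the parent and equals \<open>pmf p i\<close>; the sum over offspring events is thus an
    integral against p cut off at the parent.\<close>
  have h: "?h (Suc n) = ennreal (2 powr (- real n)) * (if n = 0 then L else D n n) + ?lt (Suc n)" for n
  proof -
    have cs: "(\<integral>\<^sup>+e. (case offspring_orders (Suc n) m of None \<Rightarrow> f (Node Leaf e Leaf)
      | Some (k, i) \<Rightarrow> \<integral>\<^sup>+l. \<integral>\<^sup>+r. f (graft l e r) \<partial>H i \<partial>H k) \<partial>E) =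
      (if m = 0 then (if n = 0 then L else D n n) else D (Suc n) m)" for m
      by (auto simp: offspring_orders_def L_def D_def)
    have "?h (Suc n) = (\<Sum>m<Suc n. ennreal (event_prob (Suc n) m) *
        (if m = 0 then (if n = 0 then L else D n n) else D (Suc n) m))"
      by (subst nn_integral_H_rec) (simp_all add: f0 cs del: sum.lessThan_Suc)
    also have "\<dots> = ennreal (2 powr (- real n)) * (if n = 0 then L else D n n) +
        (\<Sum>m<n. ?P (Suc m) * D (Suc n) (Suc m))"
      by (subst sum.lessThan_Suc_shift) (simp add: event_prob_def p)
    also have "(\<Sum>m<n. ?P (Suc m) * D (Suc n) (Suc m)) = (\<Sum>m<Suc n. ?P m * D (Suc n) m)"
      by (subst sum.lessThan_Suc_shift) simp
    also have "\<dots> = ?lt (Suc n)"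
      unfolding nn_integral_pmf_nat by (subst suminf_finite[of "{..<Suc n}"]) auto
    finally show ?thesis .
  qed
  have shift: "(\<Sum>k. ?P k * g k) = (\<Sum>n. ?P (Suc n) * g (Suc n))" for g
    by (subst suminf_ennreal_head) simp
  \<comment> \<open>Root order n + 1 has probability half of 2 to the power -n, and it terminates
    first with probability 2 to the power -n. For n = 0 the product 1/2 is the weight of the single
    edge.\<close>
  have w: "?P (Suc n) * ennreal (2 powr (- real n)) = (if n = 0 then 1 else ?P n * ?P n) / 2" for n
  proof -
    have "2 powr (- real (Suc n)) = 2 powr (- real n) * (1 / 2)"
      using powr_add[of "2::real" "- 1" "- real n"] by (simp add: powr_minus)
    then have "?P (Suc n) * ennreal (2 powr (- real n)) = ennreal (2 powr (- real n) * 2 powr (- real n) * (1 / 2))"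
      using p[of "Suc n"] by (simp add: ennreal_mult[symmetric] mult_ac del: of_nat_Suc)
    also have "\<dots> = (ennreal (2 powr (- real n)) * ennreal (2 powr (- real n))) / 2"
      using divide_ennreal[of "2 powr (- real n) * 2 powr (- real n)" 2] by (simp add: ennreal_mult)
    also have "\<dots> = (if n = 0 then 1 else ?P n * ?P n) / 2" by (simp add: p)
    finally show ?thesis .
  qed
  have "(\<integral>\<^sup>+K. ?h K \<partial>measure_pmf p) = (\<Sum>n. ?P (Suc n) * ?h (Suc n))"
    unfolding nn_integral_pmf_nat by (rule shift)
  also have "\<dots> = (\<Sum>n. (if n = 0 then 1 else ?P n * ?P n) / 2 * (if n = 0 then L else D n n)) +
      (\<Sum>n. ?P (Suc n) * ?lt (Suc n))"
    unfolding h distrib_left mult.assoc[symmetric] w by (rule suminf_add[symmetric]) auto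
  also have "(\<Sum>n. ?P (Suc n) * ?lt (Suc n)) = (\<integral>\<^sup>+K. ?lt K \<partial>measure_pmf p)"
    unfolding nn_integral_pmf_nat[of p ?lt] by (rule shift[symmetric])
  also have "(\<Sum>n. (if n = 0 then 1 else ?P n * ?P n) / 2 * (if n = 0 then L else D n n)) =
      L / 2 + (\<Sum>k. ?P k * (?P k * D k k)) / 2"
  proof -
    have "(\<Sum>n. (if n = 0 then 1 else ?P n * ?P n) / 2 * (if n = 0 then L else D n n)) =
      (\<Sum>n. (if n = 0 then L / 2 else 0) + (?P n * (?P n * D n n)) / 2)"
      by (intro suminf_cong) (auto simp: divide_ennreal_def mult_ac)
    also have "\<dots> = (\<Sum>n. (if n = (0::nat) then L / 2 else 0)) + (\<Sum>n. (?P n * (?P n * D n n)) / 2)"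
      by (rule suminf_add[symmetric]) auto
    also have "(\<Sum>n. (if n = (0::nat) then L / 2 else 0)) = L / 2"
      by (subst suminf_finite[of "{0}"]) auto
    also have "(\<Sum>n. (?P n * (?P n * D n n)) / 2) = (\<Sum>k. ?P k * (?P k * D k k)) / 2"
      by (simp add: divide_ennreal_def)
    finally show ?thesis .
  qed
  also have "L / 2 + (\<Sum>k. ?P k * (?P k * D k k)) / 2 + (\<integral>\<^sup>+K. ?lt K \<partial>measure_pmf p) =
      L / 2 + ((\<Sum>k. ?P k * (?P k * D k k)) + 2 * (\<integral>\<^sup>+K. ?lt K \<partial>measure_pmf p)) / 2"
    by (simp add: add_divide_distrib_ennreal add.assoc ennreal_mult_divide_eq mult.commute[of 2])
  also have "((\<Sum>k. ?P k * (?P k * D k k)) + 2 * (\<integral>\<^sup>+K. ?lt K \<partial>measure_pmf p)) =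
      (\<integral>\<^sup>+k. \<integral>\<^sup>+i. D k i \<partial>measure_pmf p \<partial>measure_pmf p)"
    by (rule nn_integral_pmf_symmetric[OF sym, symmetric])
  finally show ?thesis unfolding D_def L_def .
qed

text \<open>Both laws obey the same recursion, and grafting raises the height. With a bound on the
  height of the support of f, both subtrees fall under the smaller bound, so the mixture is replaced
  by \<open>G\<close> first on the right and then on the left.\<close>

lemma nn_integral_mixture_height:
  assumes "f \<in> borel_measurable plane_space" and "f Leaf = 0" and "swap_invariant f"
    and "\<And>t. n < height t \<Longrightarrow> f t = 0"
  shows "(\<integral>\<^sup>+K. \<integral>\<^sup>+t. f t \<partial>H K \<partial>measure_pmf p) = (\<integral>\<^sup>+t. f t \<partial>G)"
  using assms
proof (induction n arbitrary: f)
  case 0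
  have "f t = 0" for t using 0(2,4) by (cases t) auto
  then show ?case by simp
next
  case (Suc n)
  note [measurable] = Suc.prems(1)
  define g where "g e l = (\<integral>\<^sup>+r. f (graft l e r) \<partial>G)" for e l
  have gr: "graft l e r \<noteq> Leaf \<Longrightarrow> height (graft l e r) = Suc (max (height l) (height r))" for l e r
    by (auto simp: graft_def)
  have inner: "(\<integral>\<^sup>+i. \<integral>\<^sup>+r. f (graft l e r) \<partial>H i \<partial>measure_pmf p) = g e l" for e l
    unfolding g_def
  proof (rule Suc.IH)
    show "f (graft l e Leaf) = 0" using Suc.prems(2) by (simp add: graft_def)
    show "swap_invariant (\<lambda>r. f (graft l e r))"
      unfolding swap_invariant_def
      by (intro allI impI swap_invariantD[OF Suc.prems(3)] swap_iso_graft(1) swap_iso_refl)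
    show "f (graft l e r) = 0" if "n < height r" for r
      using gr[of l e r] that Suc.prems(2) Suc.prems(4)[of "graft l e r"] by (cases "graft l e r = Leaf") auto
  qed measurable
  have outer: "(\<integral>\<^sup>+k. \<integral>\<^sup>+l. g e l \<partial>H k \<partial>measure_pmf p) = (\<integral>\<^sup>+l. g e l \<partial>G)" for e
  proof (rule Suc.IH)
    show "g e Leaf = 0" using Suc.prems(2) by (simp add: graft_def g_def)
    show "swap_invariant (g e)" unfolding swap_invariant_def g_def
      by (intro allI impI nn_integral_cong swap_invariantD[OF Suc.prems(3)] swap_iso_graft(1) swap_iso_refl)
    show "g e l = 0" if "n < height l" for l
    proof -
      have "f (graft l e r) = 0" for r
        using gr[of l e r] that Suc.prems(2) Suc.prems(4)[of "graft l e r"] by (cases "graft l e r = Leaf") auto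
      then show ?thesis by (simp add: g_def)
    qed
    show "g e \<in> borel_measurable plane_space" unfolding g_def by measurable
  qed
  have swp: "(\<integral>\<^sup>+i. \<integral>\<^sup>+x. q i x \<partial>M \<partial>measure_pmf p) = (\<integral>\<^sup>+x. \<integral>\<^sup>+i. q i x \<partial>measure_pmf p \<partial>M)"
    if "sigma_finite_measure M" "\<And>i. q i \<in> borel_measurable M" for M :: "'x measure" and q
  proof (rule nn_integral_swap)
    have "case_prod q \<in> count_space UNIV \<Otimes>\<^sub>M M \<rightarrow>\<^sub>M borel"
      by (rule measurable_pair_measure_countable1) (use that in auto)
    then show "case_prod q \<in> borel_measurable (measure_pmf p \<Otimes>\<^sub>M M)"
      by (simp cong: measurable_cong_sets sets_pair_measure_cong)
  qed (auto simp: that measure_pmf.sigma_finite_measure_axioms)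
  \<comment> \<open>Each average over an order has to stand directly outside the integral over its
    tree before the induction hypothesis applies.\<close>
  have "(\<integral>\<^sup>+k. \<integral>\<^sup>+i. \<integral>\<^sup>+e. \<integral>\<^sup>+l. \<integral>\<^sup>+r. f (graft l e r) \<partial>H i \<partial>H k \<partial>E \<partial>measure_pmf p \<partial>measure_pmf p) =
    (\<integral>\<^sup>+k. \<integral>\<^sup>+e. \<integral>\<^sup>+i. \<integral>\<^sup>+l. \<integral>\<^sup>+r. f (graft l e r) \<partial>H i \<partial>H k \<partial>measure_pmf p \<partial>E \<partial>measure_pmf p)"
    by (intro nn_integral_cong swp E.sigma_finite_measure_axioms) measurable
  also have "\<dots> = (\<integral>\<^sup>+k. \<integral>\<^sup>+e. \<integral>\<^sup>+l. g e l \<partial>H k \<partial>E \<partial>measure_pmf p)"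
    unfolding inner[symmetric] by (intro nn_integral_cong swp H.sigma_finite_measure_axioms) measurable
  also have "\<dots> = (\<integral>\<^sup>+e. \<integral>\<^sup>+k. \<integral>\<^sup>+l. g e l \<partial>H k \<partial>measure_pmf p \<partial>E)"
    by (intro swp E.sigma_finite_measure_axioms) (unfold g_def, measurable)
  also have "\<dots> = (\<integral>\<^sup>+e. \<integral>\<^sup>+l. \<integral>\<^sup>+r. f (graft l e r) \<partial>G \<partial>G \<partial>E)"
    unfolding outer by (simp add: g_def[abs_def])
  finally show ?case
    unfolding nn_integral_mixture[OF Suc.prems(1-3)] nn_integral_gw_graft[OF Suc.prems(1)] by simp
qed

text \<open>Planar trees are finite, so f is the sum of its parts supported on one height
  each.\<close>

lemma nn_integral_mixture_eq:
  assumes [measurable]: "f \<in> borel_measurable plane_space" and f: "f Leaf = 0" "swap_invariant f"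
  shows "(\<integral>\<^sup>+K. \<integral>\<^sup>+t. f t \<partial>H K \<partial>measure_pmf p) = (\<integral>\<^sup>+t. f t \<partial>G)"
proof -
  define g where "g n t = (if height t = n then f t else 0)" for n :: nat and t :: "real tree"
  have [measurable]: "g n \<in> borel_measurable plane_space" for n
    unfolding g_def by measurable
  have g: "f t = (\<Sum>n. g n t)" for t
    unfolding g_def by (subst suminf_finite[of "{height t}"]) auto
  have ex: "(\<integral>\<^sup>+t. f t \<partial>M) = (\<Sum>n. \<integral>\<^sup>+t. g n t \<partial>M)" if M: "sets M = sets plane_space" for M
  proof -
    have "g n \<in> borel_measurable M" for n
      unfolding measurable_cong_sets[OF M refl] by measurable
    then show ?thesis by (simp only: g nn_integral_suminf)
  qed
  have "(\<integral>\<^sup>+K. \<integral>\<^sup>+t. f t \<partial>H K \<partial>measure_pmf p) = (\<Sum>n. \<integral>\<^sup>+K. \<integral>\<^sup>+t. g n t \<partial>H K \<partial>measure_pmf p)"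
    by (simp only: ex[OF sets_H]) (rule nn_integral_suminf, simp)
  also have "\<dots> = (\<Sum>n. \<integral>\<^sup>+t. g n t \<partial>G)"
  proof (intro suminf_cong nn_integral_mixture_height)
    show "swap_invariant (g n)" for n
      unfolding swap_invariant_def g_def
      by (metis swap_invariantD[OF f(2)] swap_iso_height)
  qed (auto simp: g_def f(1))
  also have "\<dots> = (\<integral>\<^sup>+t. f t \<partial>G)"
    by (rule ex[OF sets_plane_gw, symmetric])
  finally show ?thesis .
qed

lemma emeasure_hbp_law:
  assumes "A \<in> sets utree_space"
  shows "emeasure (hbp_law p Tk lam) A = (\<integral>\<^sup>+K. emeasure (H K) (unordered -` A) \<partial>measure_pmf p)"
proof -
  have U [measurable]: "(\<lambda>\<omega>. unordered (tree \<omega> K)) \<in> W \<rightarrow>\<^sub>M utree_space" for K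
    by (rule measurable_compose[OF measurable_tree measurable_unordered])
  have "(\<lambda>K. distr W utree_space (\<lambda>\<omega>. unordered (tree \<omega> K))) \<in> measure_pmf p \<rightarrow>\<^sub>M subprob_algebra utree_space"
    by (auto simp: space_subprob_algebra intro!: prob_space_imp_subprob_space W.prob_space_distr)
  then have bind: "emeasure (hbp_law p Tk lam) A =
      (\<integral>\<^sup>+K. emeasure (distr W utree_space (\<lambda>\<omega>. unordered (tree \<omega> K))) A \<partial>measure_pmf p)"
    unfolding hbp_law_def using assms by (intro emeasure_bind) auto
  have "emeasure (distr W utree_space (\<lambda>\<omega>. unordered (tree \<omega> K))) A = emeasure (H K) (unordered -` A)" for K
    using assms unfolding H_def
    by (subst (1 2) emeasure_distr) (auto simp: sets_utree_space vimage_def)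
  then show ?thesis unfolding bind by simp
qed

lemma sets_hbp_law: "sets (hbp_law p Tk lam) = sets utree_space"
  unfolding hbp_law_def by (rule sets_bind) auto

text \<open>The integral identity concerns functions vanishing at \<open>Leaf\<close>, so the mass
  of \<open>Leaf\<close> is treated separately; a set of unordered trees is then tested by the
  indicator of its planar preimage.\<close>

theorem hbp_law_eq_gw_law: "hbp_law p Tk lam = gw_law \<gamma>"
proof (rule measure_eqI)
  show "sets (hbp_law p Tk lam) = sets (gw_law \<gamma>)"
    by (simp add: sets_hbp_law gw_law_eq)
  have leaf: "{Leaf} \<in> sets plane_space" by simp
  have main: "(\<integral>\<^sup>+K. emeasure (H K) (unordered -` A - {Leaf}) \<partial>measure_pmf p) = emeasure G (unordered -` A - {Leaf})"
    if "A \<in> sets utree_space" for A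
  proof -
    have meas: "unordered -` A - {Leaf} \<in> sets plane_space"
      using that by (auto simp: sets_utree_space)
    have "(\<integral>\<^sup>+K. \<integral>\<^sup>+t. indicator (unordered -` A - {Leaf}) t \<partial>H K \<partial>measure_pmf p) =
      (\<integral>\<^sup>+t. indicator (unordered -` A - {Leaf}) t \<partial>G)"
    proof (rule nn_integral_mixture_eq)
      show "swap_invariant (indicator (unordered -` A - {Leaf}))"
        unfolding swap_invariant_def
        by (metis (no_types, lifting) DiffD1 DiffD2 DiffI indicator_simps insertCI singletonD
            swap_iso_Leaf1 swap_iso_Leaf2 utree.abs_eq_iff vimage_eq)
    qed (use meas in auto)
    then show ?thesis using meas by simp
  qed
  \<comment> \<open>That the branching process almost surely yields a finite tree follows by
    comparison: its nonempty outcomes have the same mass as those of \<open>G\<close>, namely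
    1.\<close>
  have "(\<integral>\<^sup>+K. emeasure (H K) {Leaf} \<partial>measure_pmf p) = 0"
  proof -
    have G1: "emeasure G (UNIV - {Leaf}) = 1"
    proof -
      have "AE t in G. t \<in> UNIV - {Leaf}" using AE_gw_not_Leaf by simp
      moreover have "UNIV - {Leaf} \<in> sets G" using sets.compl_sets[OF leaf] by simp
      ultimately show ?thesis by (intro G.emeasure_eq_1_AE)
    qed
    have sum1: "emeasure (H K) {Leaf} + emeasure (H K) (UNIV - {Leaf}) = 1" for K
    proof -
      have "UNIV - {Leaf} \<in> sets plane_space" using sets.compl_sets[OF leaf] by simp
      then show ?thesis
        using H.emeasure_space_1[of K] by (subst plus_emeasure) (auto simp: insert_absorb Un_Diff_cancel)
    qed
    have "(\<integral>\<^sup>+K. emeasure (H K) {Leaf} \<partial>measure_pmf p) +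
       (\<integral>\<^sup>+K. emeasure (H K) (UNIV - {Leaf}) \<partial>measure_pmf p) =
       (\<integral>\<^sup>+K. emeasure (H K) {Leaf} + emeasure (H K) (UNIV - {Leaf}) \<partial>measure_pmf p)"
      by (rule nn_integral_add[symmetric]) simp_all
    also have "\<dots> = 1" unfolding sum1 by simp
    also have "(\<integral>\<^sup>+K. emeasure (H K) (UNIV - {Leaf}) \<partial>measure_pmf p) = 1"
    proof -
      have "UNIV \<in> sets utree_space" using sets.top[of utree_space] by simp
      from main[OF this] G1 show ?thesis by (simp only: vimage_UNIV)
    qed
    finally show ?thesis
      using ennreal_add_left_cancel[of 1 "\<integral>\<^sup>+K. emeasure (H K) {Leaf} \<partial>measure_pmf p" 0]
      by (simp add: add.commute)
  qed
  then have H0: "AE K in measure_pmf p. emeasure (H K) {Leaf} = 0"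
    by (subst (asm) nn_integral_0_iff_AE) auto
  have G0: "emeasure G {Leaf} = 0"
    using AE_gw_not_Leaf leaf by (simp add: AE_iff_measurable[of "{Leaf}"])
  have drop: "emeasure M (B - {Leaf}) = emeasure M B"
    if "emeasure M {Leaf} = 0" "sets M = sets plane_space" "B \<in> sets plane_space" for M B
    using that by (intro emeasure_Diff_null_set) (auto simp: null_sets_def)
  fix A assume "A \<in> sets (hbp_law p Tk lam)"
  then have A: "A \<in> sets utree_space" by (simp add: sets_hbp_law)
  then have uA: "unordered -` A \<in> sets plane_space" by (simp add: sets_utree_space)
  have "emeasure (hbp_law p Tk lam) A = (\<integral>\<^sup>+K. emeasure (H K) (unordered -` A - {Leaf}) \<partial>measure_pmf p)"
    unfolding emeasure_hbp_law[OF A] using H0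
    by (intro nn_integral_cong_AE) (auto elim!: eventually_mono simp: drop uA)
  also have "\<dots> = emeasure (gw_law \<gamma>) A"
    using A unfolding main[OF A] gw_law_eq
    by (subst emeasure_distr) (simp_all add: drop[OF G0] uA)
  finally show "emeasure (hbp_law p Tk lam) A = emeasure (gw_law \<gamma>) A" .
qed

end

section \<open>Criticality and time-invariance\<close>

text \<open>Fubini for double series: summable absolute row sums q make the family absolutely
  summable over \<open>A \<times> B\<close>. The last conclusion keeps the bound that an iteration
  of the exchange needs.\<close>

lemma has_sum_exchange:
  fixes f :: "'a \<Rightarrow> 'b \<Rightarrow> real"
  assumes rows: "\<And>a. a \<in> A \<Longrightarrow> ((\<lambda>b. f a b) has_sum r a) B"
    and abs: "\<And>a. a \<in> A \<Longrightarrow> ((\<lambda>b. \<bar>f a b\<bar>) has_sum q a) B" "q summable_on A"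
    and S: "(r has_sum S) A"
    and cols: "\<And>b. b \<in> B \<Longrightarrow> ((\<lambda>a. f a b) has_sum c b) A"
  shows "(c has_sum S) B" "(\<lambda>b. \<bar>c b\<bar>) summable_on B" "(\<Sum>\<^sub>\<infinity>b\<in>B. \<bar>c b\<bar>) \<le> (\<Sum>\<^sub>\<infinity>a\<in>A. q a)"
proof -
  let ?F = "\<lambda>(a, b). f a b"
  have q: "(\<Sum>\<^sub>\<infinity>b\<in>B. \<bar>f a b\<bar>) = q a" if "a \<in> A" for a
    using abs(1)[OF that] by (rule infsumI)
  have q0: "0 \<le> q a" if "a \<in> A" for a
    unfolding q[OF that, symmetric] by (rule infsum_nonneg) simp
  have asum: "(\<lambda>x. norm (?F x)) summable_on A \<times> B"
  proof (rule Infinite_Sum.abs_summable_on_Sigma_iff[THEN iffD2], intro conjI ballI)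
    show "(\<lambda>b. norm (case (a, b) of (a, b) \<Rightarrow> f a b)) summable_on B" if "a \<in> A" for a
      using abs(1)[OF that] by (auto simp: summable_on_def)
    have "(\<lambda>a. norm (\<Sum>\<^sub>\<infinity>b\<in>B. norm (f a b))) summable_on A \<longleftrightarrow> q summable_on A"
      by (rule summable_on_cong) (simp add: q q0)
    then show "(\<lambda>a. norm (\<Sum>\<^sub>\<infinity>b\<in>B. norm (case (a, b) of (a, b) \<Rightarrow> f a b))) summable_on A"
      using abs(2) by simp
  qed
  then obtain S' where S': "(?F has_sum S') (A \<times> B)"
    using Infinite_Sum.abs_summable_summable summable_on_def by blast
  have "(r has_sum S') A"
    by (rule has_sum_SigmaD[OF S']) (simp add: rows)
  then have "S' = S" using S by (rule has_sum_unique)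
  then have sw: "((\<lambda>(b, a). f a b) has_sum S) (B \<times> A)"
    using S' has_sum_swap[of ?F A B S] by (simp add: case_prod_beta')
  show "(c has_sum S) B"
    by (rule has_sum_SigmaD[OF sw]) (simp add: cols)
  from asum obtain Q where Q: "((\<lambda>(a, b). \<bar>f a b\<bar>) has_sum Q) (A \<times> B)"
    by (auto simp: summable_on_def case_prod_beta')
  have "(q has_sum Q) A"
    by (rule has_sum_SigmaD[OF Q]) (simp add: abs)
  then have Q': "Q = (\<Sum>\<^sub>\<infinity>a\<in>A. q a)" by (simp add: infsumI)
  have swQ: "((\<lambda>(b, a). \<bar>f a b\<bar>) has_sum Q) (B \<times> A)"
    using Q has_sum_swap[of "\<lambda>(a, b). \<bar>f a b\<bar>" A B Q] by (simp add: case_prod_beta')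
  have col: "(\<lambda>a. \<bar>f a b\<bar>) summable_on A" if "b \<in> B" for b
    using cols[OF that] summable_on_iff_abs_summable_on_real[of "\<lambda>a. f a b" A]
    by (auto simp: summable_on_def)
  define d where "d b = (\<Sum>\<^sub>\<infinity>a\<in>A. \<bar>f a b\<bar>)" for b
  have d: "(d has_sum Q) B"
    by (rule has_sum_SigmaD[OF swQ]) (simp add: d_def col)
  have le: "\<bar>c b\<bar> \<le> d b" if "b \<in> B" for b
    using norm_infsum_bound[of "\<lambda>a. f a b" A] col[OF that] cols[OF that] by (simp add: d_def infsumI)
  show cs: "(\<lambda>b. \<bar>c b\<bar>) summable_on B"
    by (rule summable_on_comparison_test[of d]) (use d le in \<open>auto simp: summable_on_def\<close>)
  have "(\<Sum>\<^sub>\<infinity>b\<in>B. \<bar>c b\<bar>) \<le> (\<Sum>\<^sub>\<infinity>b\<in>B. d b)"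
    using cs d le by (intro infsum_mono) (auto simp: summable_on_def)
  also have "\<dots> = (\<Sum>\<^sub>\<infinity>a\<in>A. q a)" using d Q' by (simp add: infsumI)
  finally show "(\<Sum>\<^sub>\<infinity>b\<in>B. \<bar>c b\<bar>) \<le> (\<Sum>\<^sub>\<infinity>a\<in>A. q a)" .
qed

lemma triangular_power_eq_0: "j < i \<Longrightarrow> triangular_power M n i j = 0"
  by (cases n) auto

lemma has_sum_finite_support:
  assumes "finite F" "F \<subseteq> A" "\<And>x. x \<in> A - F \<Longrightarrow> f x = (0::real)"
  shows "(f has_sum sum f F) A"
proof -
  have "(f has_sum sum f F) F" using assms(1) by (rule has_sum_finite)
  then show ?thesis
    by (rule has_sum_cong_neutral[THEN iffD1, rotated -1]) (use assms in auto)
qed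

section \<open>The generator annihilates the vector of rates times root probabilities\<close>

context geometric_hbp begin

text \<open>The ratio 1/4 of this geometric vector is the zero of \<open>t_hat\<close>, that is, the
  reciprocal of R.\<close>

lemma lam_p: "1 \<le> k \<Longrightarrow> lam k * pmf p k = 4 * \<gamma> * (1 / 4) ^ k"
proof -
  assume k: "1 \<le> k"
  have "lam k * pmf p k = \<gamma> * (2 powr (2 - real k) * 2 powr (- real k))"
    using k by (simp add: lam p)
  also have "2 powr (2 - real k) * 2 powr (- real k) = 4 * ((1 / 2) ^ k * (1 / 2) ^ k)"
    using powr_realpow[of 2 k]
    by (simp add: powr_diff powr_minus power_one_over inverse_eq_divide)
  also have "(1 / 2) ^ k * (1 / 2) ^ k = (1 / 4 :: real) ^ k"
    by (simp add: power_mult_distrib[symmetric])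
  finally show ?thesis by simp
qed

lemma lam_le: "1 \<le> k \<Longrightarrow> lam k \<le> 2 * \<gamma>"
proof -
  assume k: "1 \<le> k"
  have "2 powr (2 - real k) \<le> 2 powr 1" using k by (intro powr_mono) auto
  then show ?thesis using k \<gamma>_pos by (simp add: lam)
qed

text \<open>A row of a Toeplitz matrix acts on a geometric vector of ratio z as multiplication by
  its symbol, here \<open>t_hat Tk z\<close>, which vanishes at z = 1/4. Explicitly, 3/4 + 1/8 +
  1/16 + ... = 1 stands against the diagonal -1, so that the absolute values add up to 2.\<close>

lemma generator_row:
  assumes "1 \<le> i"
  shows "((\<lambda>k. \<bar>generator Tk i k\<bar> * (lam k * pmf p k)) has_sum (2 * (lam i * pmf p i))) {1..}"
    "((\<lambda>k. generator Tk i k * (lam k * pmf p k)) has_sum 0) {1..}"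
proof -
  define a where "a = 4 * \<gamma> * (1 / 4) ^ i"
  have a: "lam i * pmf p i = a" using assms by (simp add: lam_p a_def)
  define F where "F k = \<bar>generator Tk i k\<bar> * (lam k * pmf p k)" for k
  \<comment> \<open>The geometric term is the generic off-diagonal entry. The diagonal has 1 in
    place of 1/2, and the first superdiagonal has the additional 2 times 1/4; this explains the two
    corrections by 1/2.\<close>
  have shift: "F (m + i) = a * ((1 / 2) * (1 / 2) ^ m + (if m = 0 then 1 / 2 else 0) + (if m = 1 then 1 / 2 else 0))" for m
  proof -
    have "lam (m + i) * pmf p (m + i) = a * (1 / 4) ^ m"
      using assms by (simp add: lam_p a_def power_add)
    then have F: "F (m + i) = \<bar>generator Tk i (m + i)\<bar> * (a * (1 / 4) ^ m)" by (simp add: F_def)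
    consider "m = 0" | "m = 1" | k where "m = Suc (Suc k)" by (metis One_nat_def not0_implies_Suc)
    then show ?thesis
    proof cases
      case 1
      then show ?thesis using F by (simp add: generator_def)
    next
      case 2
      then show ?thesis using F by (simp add: generator_def Tk)
    next
      case 3
      have "(2::real) * 2 ^ k * (1 / 4) ^ Suc (Suc k) = (1 / 2) * (1 / 2) ^ Suc (Suc k)"
        by (simp add: power_divide field_simps power_mult_distrib[symmetric])
      then show ?thesis using 3 unfolding F by (simp add: generator_def Tk)
    qed
  qed
  have s: "(\<lambda>m. a * ((1 / 2) * (1 / 2) ^ m + (if m = 0 then 1 / 2 else 0) + (if m = 1 then 1 / 2 else 0))) sums
      (a * ((1 / 2) * (1 / (1 - 1 / 2)) + 1 / 2 + 1 / 2))"
    by (intro sums_mult sums_add geometric_sums sums_single[of _ "\<lambda>_. 1 / 2"]) auto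
  have a0: "0 < a" using \<gamma>_pos by (simp add: a_def)
  have "((\<lambda>m. F (m + i)) has_sum (2 * a)) UNIV"
    using sums_nonneg_imp_has_sum[OF s] a0 unfolding shift by (simp add: mult.commute[of 2])
  then have "(F has_sum (2 * a)) (range (\<lambda>m. m + i))"
    by (subst has_sum_reindex) (auto simp: comp_def inj_def)
  then have F: "(F has_sum (2 * a)) {1..}"
  proof (rule has_sum_cong_neutral[THEN iffD1, rotated -1])
    show "F k = 0" if "k \<in> {1..} - range (\<lambda>m. m + i)" for k
    proof -
      have "k < i" using that le_Suc_ex[of i k] by (force simp: add.commute)
      then show ?thesis by (simp add: F_def generator_def)
    qed
  qed (use assms in auto)
  then show "((\<lambda>k. \<bar>generator Tk i k\<bar> * (lam k * pmf p k)) has_sum (2 * (lam i * pmf p i))) {1..}"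
    by (simp add: F_def[abs_def] a)
  have single: "((\<lambda>k. if k = i then - 2 * a else 0) has_sum (- 2 * a)) {1..}"
    using has_sum_finite_support[of "{i}" "{1..}" "\<lambda>k. if k = i then - 2 * a else 0"] assms by simp
  \<comment> \<open>Only the diagonal entry is negative; restoring its sign costs 2 a.\<close>
  have "generator Tk i k * (lam k * pmf p k) = F k + (if k = i then - 2 * a else 0)" if "1 \<le> k" for k
  proof (cases "k \<le> i")
    case True
    then show ?thesis using a by (auto simp: F_def generator_def)
  next
    case False
    then have "0 \<le> generator Tk i k" by (simp add: generator_def Tk)
    then show ?thesis using False by (simp add: F_def)
  qed
  then show "((\<lambda>k. generator Tk i k * (lam k * pmf p k)) has_sum 0) {1..}"
    using has_sum_add[OF F single] by (subst has_sum_cong[of _ _ "\<lambda>k. F k + (if k = i then - 2 * a else 0)"]) auto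
qed

text \<open>Every positive power annihilates \<open>pmf p\<close> because \<open>M\<close> does. The
  bound supplies the absolute convergence needed to reassociate the infinite matrix products: the
  absolute values of \<open>M\<close> map \<open>pmf p\<close> below \<open>4 * \<gamma> * s\<close>
  times itself, as \<open>lam i\<close> is at most \<open>2 * \<gamma>\<close>.\<close>

lemma power_row:
  assumes "0 \<le> s" "1 \<le> i"
  defines "M \<equiv> \<lambda>a b. generator Tk a b * lam b * s"
  shows "((\<lambda>j. triangular_power M n i j * pmf p j) has_sum (if n = 0 then pmf p i else 0)) {1..} \<and>
    (\<lambda>j. \<bar>triangular_power M n i j * pmf p j\<bar>) summable_on {1..} \<and>
    (\<Sum>\<^sub>\<infinity>j\<in>{1..}. \<bar>triangular_power M n i j * pmf p j\<bar>) \<le> (4 * \<gamma> * s) ^ n * pmf p i"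
  using assms(2)
proof (induction n arbitrary: i)
  case 0
  have 1: "((\<lambda>j. triangular_power M 0 i j * pmf p j) has_sum pmf p i) {1..}"
    using has_sum_finite_support[of "{i}" "{1..}" "\<lambda>j. triangular_power M 0 i j * pmf p j"] 0 by simp
  moreover have "\<bar>triangular_power M 0 i j * pmf p j\<bar> = triangular_power M 0 i j * pmf p j" for j
    by simp
  ultimately show ?case using infsumI[OF 1] by (auto simp: summable_on_def simp del: triangular_power.simps)
next
  case (Suc n)
  let ?N = "\<lambda>k. \<Sum>\<^sub>\<infinity>j\<in>{1..}. \<bar>triangular_power M n k j * pmf p j\<bar>"
  define f where "f k j = M i k * (triangular_power M n k j * pmf p j)" for k j
  have absrow: "((\<lambda>k. \<bar>M i k\<bar> * pmf p k) has_sum (s * (2 * (lam i * pmf p i)))) {1..}"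
  proof -
    have "\<bar>M i k\<bar> * pmf p k = s * (\<bar>generator Tk i k\<bar> * (lam k * pmf p k))" if "1 \<le> k" for k
      using lam_pos[OF that] assms(1) by (simp add: M_def abs_mult)
    then show ?thesis using has_sum_cmult_right[OF generator_row(1)[OF Suc.prems], of s]
      by (subst has_sum_cong[of _ _ "\<lambda>k. s * (\<bar>generator Tk i k\<bar> * (lam k * pmf p k))"]) auto
  qed
  have row: "((\<lambda>k. M i k * pmf p k) has_sum 0) {1..}"
    using has_sum_cmult_right[OF generator_row(2)[OF Suc.prems], of s]
    by (simp add: M_def mult_ac)
  have N: "\<bar>M i k\<bar> * ?N k \<le> (4 * \<gamma> * s) ^ n * (\<bar>M i k\<bar> * pmf p k)" if "1 \<le> k" for k
    using mult_left_mono[of "?N k" "(4 * \<gamma> * s) ^ n * pmf p k" "\<bar>M i k\<bar>"] Suc.IH[OF that] by (simp add: mult_ac)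
  have N0: "0 \<le> \<bar>M i k\<bar> * ?N k" for k by (intro mult_nonneg_nonneg infsum_nonneg) auto
  have bs: "(\<lambda>k. (4 * \<gamma> * s) ^ n * (\<bar>M i k\<bar> * pmf p k)) summable_on {1..}"
    using has_sum_cmult_right[OF absrow] by (auto simp: summable_on_def)
  have qs: "(\<lambda>k. \<bar>M i k\<bar> * ?N k) summable_on {1..}"
    by (rule summable_on_comparison_test[OF bs]) (use N N0 in auto)
  have rs: "((\<lambda>k. M i k * (if n = 0 then pmf p k else 0)) has_sum 0) {1..}"
    using row by (cases "n = 0") auto
  have ex: "((\<lambda>j. triangular_power M (Suc n) i j * pmf p j) has_sum 0) {1..}"
    "(\<lambda>j. \<bar>triangular_power M (Suc n) i j * pmf p j\<bar>) summable_on {1..}"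
    "(\<Sum>\<^sub>\<infinity>j\<in>{1..}. \<bar>triangular_power M (Suc n) i j * pmf p j\<bar>) \<le> (\<Sum>\<^sub>\<infinity>k\<in>{1..}. \<bar>M i k\<bar> * ?N k)"
  proof -
    have rows: "((\<lambda>j. f k j) has_sum (M i k * (if n = 0 then pmf p k else 0))) {1..}" if "k \<in> {1..}" for k
      unfolding f_def using Suc.IH[of k] that by (intro has_sum_cmult_right) simp
    have absr: "((\<lambda>j. \<bar>f k j\<bar>) has_sum (\<bar>M i k\<bar> * ?N k)) {1..}" if "k \<in> {1..}" for k
      unfolding f_def abs_mult[of "M i k"] using Suc.IH[of k] that
      by (intro has_sum_cmult_right) (simp add: has_sum_infsum)
    have cols: "((\<lambda>k. f k j) has_sum (triangular_power M (Suc n) i j * pmf p j)) {1..}" if "j \<in> {1..}" for j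
    proof -
      have "((\<lambda>k. f k j) has_sum (\<Sum>k\<in>{i..j}. f k j)) {1..}"
      proof (rule has_sum_finite_support)
        show "f k j = 0" if "k \<in> {1..} - {i..j}" for k
          using that by (cases "k < i") (auto simp: f_def M_def generator_def triangular_power_eq_0)
      qed (use Suc.prems in auto)
      then show ?thesis by (simp add: f_def sum_distrib_right mult.assoc)
    qed
    note has_sum_exchange[of "{1..}" f, OF rows absr qs rs cols]
    then show "((\<lambda>j. triangular_power M (Suc n) i j * pmf p j) has_sum 0) {1..}"
    "(\<lambda>j. \<bar>triangular_power M (Suc n) i j * pmf p j\<bar>) summable_on {1..}"
    "(\<Sum>\<^sub>\<infinity>j\<in>{1..}. \<bar>triangular_power M (Suc n) i j * pmf p j\<bar>) \<le> (\<Sum>\<^sub>\<infinity>k\<in>{1..}. \<bar>M i k\<bar> * ?N k)"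
      by blast+
  qed
  note ex(3)
  also have "(\<Sum>\<^sub>\<infinity>k\<in>{1..}. \<bar>M i k\<bar> * ?N k) \<le> (\<Sum>\<^sub>\<infinity>k\<in>{1..}. (4 * \<gamma> * s) ^ n * (\<bar>M i k\<bar> * pmf p k))"
    by (rule infsum_mono[OF qs bs]) (use N in auto)
  also have "\<dots> = (4 * \<gamma> * s) ^ n * (s * (2 * (lam i * pmf p i)))"
    by (rule infsumI) (rule has_sum_cmult_right[OF absrow])
  also have "\<dots> \<le> (4 * \<gamma> * s) ^ n * ((4 * \<gamma> * s) * pmf p i)"
  proof (rule mult_left_mono)
    have "lam i * pmf p i \<le> 2 * \<gamma> * pmf p i"
      using lam_le[OF Suc.prems] by (rule mult_right_mono) simp
    then have "s * (2 * (lam i * pmf p i)) \<le> s * (2 * (2 * \<gamma> * pmf p i))"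
      using assms(1) by (intro mult_left_mono) auto
    then show "s * (2 * (lam i * pmf p i)) \<le> 4 * \<gamma> * s * pmf p i" by (simp add: mult_ac)
  qed (use \<gamma>_pos assms(1) in auto)
  finally show ?case using ex(1,2) by (simp only: power_Suc2 mult.assoc nat.simps if_False)
qed

text \<open>Of the exponential series applied to \<open>pmf p\<close> only the term n = 0 survives.
  Summation over powers and over columns may be exchanged, the absolute sums being dominated by the
  terms of the exponential series at \<open>4 * \<gamma> * s\<close>.\<close>

lemma mean_branches_pmf:
  assumes "0 \<le> s"
  shows "mean_branches p Tk lam s (pmf p)"
  unfolding mean_branches_def
proof (intro allI impI)
  fix i :: nat assume i: "1 \<le> i"
  define M where "M = (\<lambda>a b. generator Tk a b * lam b * s)"
  note row = power_row[OF assms i, folded M_def]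
  let ?c = "4 * \<gamma> * s"
  define f where "f n j = triangular_power M n i j * pmf p j / fact n" for n j
  let ?q = "\<lambda>n. (\<Sum>\<^sub>\<infinity>j\<in>{1..}. \<bar>triangular_power M n i j * pmf p j\<bar>) / fact n"
  have es: "(\<lambda>n. ?c ^ n * pmf p i / fact n) summable_on UNIV"
  proof -
    have "(\<lambda>n. ?c ^ n /\<^sub>R fact n * pmf p i) sums (exp ?c * pmf p i)"
      by (intro sums_mult2 exp_converges)
    then have "(\<lambda>n. ?c ^ n * pmf p i / fact n) sums (exp ?c * pmf p i)"
      by (simp add: divide_inverse scaleR_conv_of_real mult_ac)
    then show ?thesis
      using sums_nonneg_imp_has_sum \<gamma>_pos assms by (fastforce simp: summable_on_def)
  qed
  have q: "?q n \<le> ?c ^ n * pmf p i / fact n" for n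
    using row[of n] by (simp add: divide_right_mono)
  have "((\<lambda>j. triangular_exp M i j * pmf p j) has_sum pmf p i) {1..}"
  proof (rule has_sum_exchange(1)[of UNIV f])
    show "((\<lambda>j. f n j) has_sum (if n = 0 then pmf p i else 0)) {1..}" for n
      using has_sum_divide_const[OF conjunct1[OF row[of n]], of "fact n"]
      by (cases "n = 0") (simp_all add: f_def del: triangular_power.simps)
    show "((\<lambda>j. \<bar>f n j\<bar>) has_sum ?q n) {1..}" for n
      using has_sum_divide_const[OF has_sum_infsum[OF conjunct1[OF conjunct2[OF row[of n]]]], of "fact n"]
      by (simp add: f_def)
    show "?q summable_on UNIV"
      by (rule summable_on_comparison_test[OF es]) (use q in \<open>auto intro!: divide_nonneg_pos infsum_nonneg\<close>)
    show "((\<lambda>n. if n = 0 then pmf p i else 0) has_sum pmf p i) (UNIV :: nat set)"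
      using has_sum_finite_support[of "{0}" UNIV "\<lambda>n :: nat. if n = 0 then pmf p i else 0"] by simp
    show "((\<lambda>n. f n j) has_sum (triangular_exp M i j * pmf p j)) UNIV" if j: "j \<in> {1..}" for j
    proof -
      have "\<bar>f n j\<bar> \<le> ?c ^ n * pmf p i / fact n" for n
      proof -
        have "\<bar>triangular_power M n i j * pmf p j\<bar> \<le> (\<Sum>\<^sub>\<infinity>j\<in>{1..}. \<bar>triangular_power M n i j * pmf p j\<bar>)"
          using finite_sum_le_infsum[of "\<lambda>j. \<bar>triangular_power M n i j * pmf p j\<bar>" "{1..}" "{j}"] row[of n] j by simp
        also have "\<dots> \<le> ?c ^ n * pmf p i" using row[of n] by simp
        finally show ?thesis by (simp add: f_def divide_right_mono)
      qed
      then have "(\<lambda>n. norm (f n j)) summable_on UNIV"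
        by (intro summable_on_comparison_test[OF es]) auto
      then have fs: "(\<lambda>n. f n j) summable_on UNIV" by (rule Infinite_Sum.abs_summable_summable)
      then have hs: "((\<lambda>n. f n j) has_sum (\<Sum>\<^sub>\<infinity>n. f n j)) UNIV" by (rule has_sum_infsum)
      show ?thesis
      \<comment> \<open>Convergence of the entry of the matrix exponential is read off from that of
        its multiple by \<open>pmf p j\<close>, so this factor is divided out; if it is 0, so are
        both sides.\<close>
      proof (cases "pmf p j = 0")
        case True
        then show ?thesis by (simp add: f_def)
      next
        case False
        have "(\<lambda>n. f n j / pmf p j) sums ((\<Sum>\<^sub>\<infinity>n. f n j) / pmf p j)"
          by (intro sums_divide has_sum_imp_sums hs)
        then have "(\<lambda>n. triangular_power M n i j / fact n) sums ((\<Sum>\<^sub>\<infinity>n. f n j) / pmf p j)"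
          using False by (simp add: f_def)
        then have "triangular_exp M i j = (\<Sum>\<^sub>\<infinity>n. f n j) / pmf p j"
          unfolding triangular_exp_def by (rule sums_unique[symmetric])
        then show ?thesis using hs False by simp
      qed
    qed
  qed
  then show "((\<lambda>j. triangular_exp (\<lambda>a b. generator Tk a b * lam b * s) i j * pmf p j) has_sum pmf p i) {1..}"
    by (simp add: M_def)
qed

lemma time_invariant: "time_invariant_hbp p Tk lam"
  by (simp add: time_invariant_hbp_def mean_branches_pmf)

lemma pmf_has_sum: "((\<lambda>i. \<bar>pmf p i\<bar>) has_sum 1) {1..}"
proof -
  have "((\<lambda>n. pmf p (Suc n)) has_sum 1) UNIV"
    using power_half_series by (intro sums_nonneg_imp_has_sum) (auto simp: p_Suc)
  then have "(pmf p has_sum 1) (range Suc)"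
    by (subst has_sum_reindex) (auto simp: comp_def)
  moreover have "range Suc = {1..}" by (auto simp: image_iff Suc_le_eq gr0_conv_Suc)
  ultimately show ?thesis by simp
qed

lemma critical: "critical_hbp p Tk lam"
  unfolding critical_hbp_def using mean_branches_pmf pmf_has_sum by blast

section \<open>The growth rate and the Horton exponent\<close>

lemma tokunaga_L_eq: "tokunaga_L Tk = 2"
proof -
  have "(\<lambda>k. 2 powr (1 - 1 / real k)) \<longlonglongrightarrow> 2 powr (1 - 0)"
    by (intro tendsto_intros lim_1_over_n) auto
  moreover have "\<forall>\<^sub>F k in sequentially. 2 powr (1 - 1 / real k) = root k (Tk k)"
  proof (rule eventually_sequentiallyI[of 1])
    fix k :: nat assume k: "1 \<le> k"
    then have "root k (Tk k) = (2 powr (real k - 1)) powr (1 / real k)"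
      using powr_realpow[of 2 "k - 1"] by (simp add: Tk root_powr_inverse of_nat_diff)
    also have "\<dots> = 2 powr (1 - 1 / real k)"
      using k by (simp add: powr_powr field_simps)
    finally show "2 powr (1 - 1 / real k) = root k (Tk k)" ..
  qed
  ultimately have "(\<lambda>k. root k (Tk k)) \<longlonglongrightarrow> 2"
    by (subst (asm) tendsto_cong) auto
  then have "(\<lambda>k. ereal (root k (Tk k))) \<longlonglongrightarrow> ereal 2" by simp
  then show ?thesis unfolding tokunaga_L_def
    by (subst lim_imp_Limsup[OF sequentially_bot]) (assumption, simp)
qed

text \<open>Multiplied by 1 - 2 w, the equation becomes quadratic with zeros 1/4 and 1, of which
  only the first lies within the radius of convergence 1/2.\<close>

lemma horton_root_iff: "horton_root Tk w \<longleftrightarrow> w = 1 / 4"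
proof -
  have half: "ereal w < 1 / tokunaga_L Tk \<longleftrightarrow> w < 1 / 2"
  proof -
    have "1 / tokunaga_L Tk = ereal (1 / 2)" unfolding tokunaga_L_eq
      by (metis ereal_divide numeral_eq_ereal one_ereal_def zero_neq_numeral)
    then show ?thesis by simp
  qed
  have th: "t_hat Tk w = - 1 + 2 * w + w / (1 - 2 * w)" if "0 < w" "w < 1 / 2" for w
  proof -
    have "(\<lambda>j. w * (2 * w) ^ j) sums (w * (1 / (1 - 2 * w)))"
      using that by (intro sums_mult geometric_sums) auto
    moreover have "w * (2 * w) ^ j = w ^ Suc j * Tk (Suc j)" for j
      by (simp add: Tk power_mult_distrib)
    ultimately have "(\<lambda>j. w ^ Suc j * Tk (Suc j)) sums (w * (1 / (1 - 2 * w)))" by (simp only:)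
    then show ?thesis unfolding t_hat_def by (simp add: sums_iff del: power_Suc)
  qed
  have root: "- 1 + 2 * w + w / (1 - 2 * w) = 0 \<longleftrightarrow> w = 1 / 4" if "0 < w" "w < 1 / 2" for w :: real
  proof -
    have "- 1 + 2 * w + w / (1 - 2 * w) = 0 \<longleftrightarrow> (w - 1) * (4 * w - 1) = 0"
      using that by (auto simp: field_simps)
    then show ?thesis using that by auto
  qed
  show ?thesis unfolding horton_root_def half using th[of w] root[of w] by auto
qed

lemma horton_R_eq: "horton_R Tk = 4"
proof -
  have "(THE w. horton_root Tk w) = 1 / 4" by (rule the_equality) (auto simp: horton_root_iff)
  from this show ?thesis unfolding horton_R_def by (simp only: inverse_eq_divide) simp
qed

end

section \<open>Total length and relative lengths\<close>

abbreviation scale_plane :: "real \<Rightarrow> real tree \<Rightarrow> real tree" where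
  "scale_plane c \<equiv> map_tree (\<lambda>e. c * e)"

lemma plane_length_scale [simp]: "plane_length (scale_plane c t) = c * plane_length t"
  by (induction t) (auto simp: algebra_simps)

lemma positive_plane_length: "positive_plane t \<Longrightarrow> t \<noteq> Leaf \<Longrightarrow> 0 < plane_length t"
proof -
  have "reduced_plane t \<Longrightarrow> \<forall>e\<in>set_tree t. 0 < e \<Longrightarrow> 0 \<le> plane_length t \<and> (t \<noteq> Leaf \<longrightarrow> 0 < plane_length t)"
    by (induction t) auto
  then show "positive_plane t \<Longrightarrow> t \<noteq> Leaf \<Longrightarrow> 0 < plane_length t"
    by (simp add: positive_plane_def)
qed

lemma measurable_scale_plane [measurable]: "scale_plane c \<in> plane_space \<rightarrow>\<^sub>M plane_space"
  by (rule measurable_map_tree) measurable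

text \<open>Allows arguments shape by shape and, later, skeleton by skeleton.\<close>

lemma nn_integral_fibres:
  fixes h :: "'a \<Rightarrow> 'c :: countable"
  assumes M: "sigma_finite_measure M" and [measurable]: "f \<in> borel_measurable M" "h \<in> M \<rightarrow>\<^sub>M count_space UNIV"
  shows "(\<integral>\<^sup>+t. f t \<partial>M) = (\<integral>\<^sup>+s. \<integral>\<^sup>+t. (if h t = s then f t else 0) \<partial>M \<partial>count_space UNIV)"
proof -
  have "(\<integral>\<^sup>+t. f t \<partial>M) = (\<integral>\<^sup>+t. \<integral>\<^sup>+s. (if h t = s then f t else 0) \<partial>count_space UNIV \<partial>M)"
  proof (rule nn_integral_cong)
    fix t
    have "(\<integral>\<^sup>+s. (if h t = s then f t else 0) \<partial>count_space UNIV) =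
       (\<integral>\<^sup>+s. f t * indicator {h t} s \<partial>count_space UNIV)"
      by (intro nn_integral_cong) (auto simp: indicator_def)
    then show "f t = (\<integral>\<^sup>+s. (if h t = s then f t else 0) \<partial>count_space UNIV)"
      by (simp add: nn_integral_cmult_indicator)
  qed
  also have "\<dots> = (\<integral>\<^sup>+s. \<integral>\<^sup>+t. (if h t = s then f t else 0) \<partial>M \<partial>count_space UNIV)"
  proof (rule nn_integral_swap[symmetric])
    show "(\<lambda>(s, t). if h t = s then f t else 0) \<in> borel_measurable (count_space UNIV \<Otimes>\<^sub>M M)"
      by (rule measurable_pair_measure_countable1) auto
  qed (auto intro: sigma_finite_measure_count_space_countable M)
  finally show ?thesis .
qed

section \<open>Scaling of the weighted tree law and the Erlang law of the total length\<close>

context galton_watson begin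

text \<open>With the weight \<open>exp (2 \<gamma> e)\<close> the edge law becomes a multiple of Lebesgue measure.\<close>

lemma nn_integral_E_scale:
  assumes [measurable]: "h \<in> borel_measurable borel" and c: "0 < c"
  shows "(\<integral>\<^sup>+e. ennreal (exp (2 * \<gamma> * e)) * h (c * e) \<partial>E) =
    ennreal (1 / c) * (\<integral>\<^sup>+e. ennreal (exp (2 * \<gamma> * e)) * h e \<partial>E)"
proof -
  have w: "(\<integral>\<^sup>+e. ennreal (exp (2 * \<gamma> * e)) * g e \<partial>E) =
      (\<integral>\<^sup>+e. ennreal (2 * \<gamma>) * (indicator {0..} e * g e) \<partial>lborel)"
    if [measurable]: "g \<in> borel_measurable borel" for g
  proof -
    have "(\<integral>\<^sup>+e. ennreal (exp (2 * \<gamma> * e)) * g e \<partial>E) =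
      (\<integral>\<^sup>+e. ennreal (exponential_density (2 * \<gamma>) e) * (ennreal (exp (2 * \<gamma> * e)) * g e) \<partial>lborel)"
      by (rule nn_integral_density) measurable
    also have "\<dots> = (\<integral>\<^sup>+e. ennreal (2 * \<gamma>) * (indicator {0..} e * g e) \<partial>lborel)"
    proof (rule nn_integral_cong)
      fix e :: real
      have "ennreal (exponential_density (2 * \<gamma>) e) * ennreal (exp (2 * \<gamma> * e)) =
        ennreal (2 * \<gamma>) * indicator {0..} e"
        using \<gamma>_pos
        by (auto simp: exponential_density_def indicator_def ennreal_mult[symmetric] exp_add[symmetric] mult.assoc)
      then show "ennreal (exponential_density (2 * \<gamma>) e) * (ennreal (exp (2 * \<gamma> * e)) * g e) =
        ennreal (2 * \<gamma>) * (indicator {0..} e * g e)"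
        by (simp only: mult.assoc[symmetric])
    qed
    finally show ?thesis .
  qed
  have "(\<integral>\<^sup>+e. ennreal (2 * \<gamma>) * (indicator {0..} e * h e) \<partial>lborel) =
     ennreal \<bar>c\<bar> * (\<integral>\<^sup>+e. ennreal (2 * \<gamma>) * (indicator {0..} (0 + c * e) * h (0 + c * e)) \<partial>lborel)"
    using c by (intro nn_integral_real_affine) auto
  also have "(\<integral>\<^sup>+e. ennreal (2 * \<gamma>) * (indicator {0..} (0 + c * e) * h (0 + c * e)) \<partial>lborel) =
     (\<integral>\<^sup>+e. ennreal (2 * \<gamma>) * (indicator {0..} e * h (c * e)) \<partial>lborel)"
    using c by (intro nn_integral_cong) (auto simp: indicator_def zero_le_mult_iff)
  finally have eq: "(\<integral>\<^sup>+e. ennreal (exp (2 * \<gamma> * e)) * h e \<partial>E) =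
      ennreal \<bar>c\<bar> * (\<integral>\<^sup>+e. ennreal (exp (2 * \<gamma> * e)) * h (c * e) \<partial>E)"
    by (simp only: w[OF assms(1)] w[of "\<lambda>e. h (c * e)", simplified])
  have "ennreal (1 / c) * ennreal \<bar>c\<bar> = 1"
    using c by (simp add: ennreal_mult[symmetric])
  then show ?thesis unfolding eq by (simp add: mult.assoc[symmetric])
qed

text \<open>On one shape the edge lengths have a density proportional to the exponential of
  \<open>- 2 * \<gamma>\<close> times their sum. The weight cancels it and leaves a multiple of
  Lebesgue measure on the positive orthant.\<close>

definition weight :: "unit tree \<Rightarrow> real tree \<Rightarrow> ennreal" where
  "weight s t = (if plane_shape t = s then ennreal (exp (2 * \<gamma> * plane_length t)) else 0)"

lemma measurable_weight [measurable]: "weight s \<in> borel_measurable plane_space"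
  unfolding weight_def by measurable

lemma weight_Node:
  "weight (Node s1 u s2) (Node l e r) = ennreal (exp (2 * \<gamma> * e)) * (weight s1 l * weight s2 r)"
  by (auto simp: weight_def ennreal_mult[symmetric] exp_add[symmetric] algebra_simps)

text \<open>Under the weighted law the edges are Lebesgue distributed, so each of them contributes a
  Jacobian factor 1 / c.\<close>

lemma nn_integral_weight_scale:
  assumes "f \<in> borel_measurable plane_space" and c: "0 < c"
  shows "(\<integral>\<^sup>+t. weight s t * f (scale_plane c t) \<partial>G) = ennreal (1 / c) ^ size s * (\<integral>\<^sup>+t. weight s t * f t \<partial>G)"
  using assms(1)
proof (induction s arbitrary: f)
  case Leaf
  \<comment> \<open>The empty shape has probability zero, so both sides vanish.\<close>
  have "AE t in G. weight Leaf t = 0"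
    using AE_gw_not_Leaf by eventually_elim (simp add: weight_def)
  then have "(\<integral>\<^sup>+t. weight Leaf t * f (scale_plane c t) \<partial>G) = (\<integral>\<^sup>+t. weight Leaf t * f t \<partial>G)"
    by (intro nn_integral_cong_AE) auto
  then show ?case by simp
next
  case (Node s1 u s2)
  note [measurable] = Node.prems
  let ?W = "\<lambda>e. ennreal (exp (2 * \<gamma> * e))"
  let ?\<kappa> = "ennreal (1 / c)"
  have leaf: "(\<integral>\<^sup>+e. weight (Node s1 u s2) (Node Leaf e Leaf) * f (Node Leaf (c * e) Leaf) \<partial>E) =
    ?\<kappa> ^ Suc (size s1 + size s2) * (\<integral>\<^sup>+e. weight (Node s1 u s2) (Node Leaf e Leaf) * f (Node Leaf e Leaf) \<partial>E)"
  proof (cases "s1 = Leaf \<and> s2 = Leaf")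
    case True
    have "(\<integral>\<^sup>+e. ?W e * f (Node Leaf (c * e) Leaf) \<partial>E) = ?\<kappa> * (\<integral>\<^sup>+e. ?W e * f (Node Leaf e Leaf) \<partial>E)"
      by (rule nn_integral_E_scale[of "\<lambda>e. f (Node Leaf e Leaf)"]) (use c in auto)
    then show ?thesis using True by (simp add: weight_Node, simp add: weight_def)
  qed (auto simp: weight_def)
  have r: "(\<integral>\<^sup>+r. weight s2 r * f (Node l e (scale_plane c r)) \<partial>G) =
      ?\<kappa> ^ size s2 * (\<integral>\<^sup>+r. weight s2 r * f (Node l e r) \<partial>G)" for l e
    by (rule Node.IH(2)[of "\<lambda>r. f (Node l e r)"]) measurable
  define g where "g e l = (\<integral>\<^sup>+r. weight s2 r * f (Node l e r) \<partial>G)" for e l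
  have [measurable]: "case_prod g \<in> borel_measurable (borel \<Otimes>\<^sub>M plane_space)"
    unfolding g_def by measurable
  have l: "(\<integral>\<^sup>+l. weight s1 l * g e (scale_plane c l) \<partial>G) = ?\<kappa> ^ size s1 * (\<integral>\<^sup>+l. weight s1 l * g e l \<partial>G)" for e
    by (rule Node.IH(1)[of "g e"]) measurable
  define h where "h e = (\<integral>\<^sup>+l. weight s1 l * g e l \<partial>G)" for e
  have [measurable]: "h \<in> borel_measurable borel"
    unfolding h_def by measurable
  \<comment> \<open>The factor c' is a variable because the identity is used for c and, to undo the
    rewriting, for 1.\<close>
  have node: "(\<integral>\<^sup>+e. \<integral>\<^sup>+l. \<integral>\<^sup>+r. weight (Node s1 u s2) (Node l e r) *
        f (Node (scale_plane c' l) (c' * e) (scale_plane c' r)) \<partial>G \<partial>G \<partial>E) =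
      (\<integral>\<^sup>+e. ?W e * (\<integral>\<^sup>+l. weight s1 l * (\<integral>\<^sup>+r. weight s2 r *
        f (Node (scale_plane c' l) (c' * e) (scale_plane c' r)) \<partial>G) \<partial>G) \<partial>E)" for c'
    unfolding weight_Node by (simp add: nn_integral_cmult[symmetric] mult.assoc)
  have lr: "(\<integral>\<^sup>+l. weight s1 l * (?\<kappa> ^ size s2 * g e (scale_plane c l)) \<partial>G) =
      ?\<kappa> ^ size s2 * (?\<kappa> ^ size s1 * h e)" for e
  proof -
    have "(\<integral>\<^sup>+l. weight s1 l * (?\<kappa> ^ size s2 * g e (scale_plane c l)) \<partial>G) =
      (\<integral>\<^sup>+l. ?\<kappa> ^ size s2 * (weight s1 l * g e (scale_plane c l)) \<partial>G)"
      by (simp only: mult.left_commute)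
    also have "\<dots> = ?\<kappa> ^ size s2 * (\<integral>\<^sup>+l. weight s1 l * g e (scale_plane c l) \<partial>G)"
      by (rule nn_integral_cmult) measurable
    finally show ?thesis unfolding l h_def .
  qed
  have "(\<integral>\<^sup>+e. \<integral>\<^sup>+l. \<integral>\<^sup>+r. weight (Node s1 u s2) (Node l e r) *
        f (Node (scale_plane c l) (c * e) (scale_plane c r)) \<partial>G \<partial>G \<partial>E) =
      (\<integral>\<^sup>+e. ?W e * (?\<kappa> ^ size s2 * (?\<kappa> ^ size s1 * h (c * e))) \<partial>E)"
    unfolding node r g_def[symmetric] lr ..
  also have "\<dots> = (\<integral>\<^sup>+e. (?\<kappa> ^ size s2 * ?\<kappa> ^ size s1) * (?W e * h (c * e)) \<partial>E)"
    by (simp only: mult_ac)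
  also have "\<dots> = (?\<kappa> ^ size s2 * ?\<kappa> ^ size s1) * (\<integral>\<^sup>+e. ?W e * h (c * e) \<partial>E)"
    by (rule nn_integral_cmult) measurable
  also have "(\<integral>\<^sup>+e. ?W e * h (c * e) \<partial>E) = ?\<kappa> * (\<integral>\<^sup>+e. ?W e * h e \<partial>E)"
    by (rule nn_integral_E_scale) (use c in auto)
  also have "(\<integral>\<^sup>+e. ?W e * h e \<partial>E) =
      (\<integral>\<^sup>+e. \<integral>\<^sup>+l. \<integral>\<^sup>+r. weight (Node s1 u s2) (Node l e r) * f (Node l e r) \<partial>G \<partial>G \<partial>E)"
    unfolding h_def g_def by (rule node[of 1, unfolded mult_1 tree.map_ident, symmetric])
  finally have node': "(\<integral>\<^sup>+e. \<integral>\<^sup>+l. \<integral>\<^sup>+r. weight (Node s1 u s2) (Node l e r) *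
        f (Node (scale_plane c l) (c * e) (scale_plane c r)) \<partial>G \<partial>G \<partial>E) =
      ?\<kappa> ^ Suc (size s1 + size s2) *
      (\<integral>\<^sup>+e. \<integral>\<^sup>+l. \<integral>\<^sup>+r. weight (Node s1 u s2) (Node l e r) * f (Node l e r) \<partial>G \<partial>G \<partial>E)"
    by (simp add: power_add mult_ac)
  have "(\<integral>\<^sup>+t. weight (Node s1 u s2) t * f (scale_plane c t) \<partial>G) =
      (\<integral>\<^sup>+e. weight (Node s1 u s2) (Node Leaf e Leaf) * f (Node Leaf (c * e) Leaf) \<partial>E) / 2 +
      (\<integral>\<^sup>+e. \<integral>\<^sup>+l. \<integral>\<^sup>+r. weight (Node s1 u s2) (Node l e r) *
        f (Node (scale_plane c l) (c * e) (scale_plane c r)) \<partial>G \<partial>G \<partial>E) / 2"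
    by (subst nn_integral_gw) simp_all
  also have "\<dots> = ?\<kappa> ^ Suc (size s1 + size s2) *
      ((\<integral>\<^sup>+e. weight (Node s1 u s2) (Node Leaf e Leaf) * f (Node Leaf e Leaf) \<partial>E) / 2 +
      (\<integral>\<^sup>+e. \<integral>\<^sup>+l. \<integral>\<^sup>+r. weight (Node s1 u s2) (Node l e r) * f (Node l e r) \<partial>G \<partial>G \<partial>E) / 2)"
    unfolding leaf node' by (simp only: distrib_left divide_ennreal_def mult.assoc)
  also have "\<dots> = ?\<kappa> ^ Suc (size s1 + size s2) * (\<integral>\<^sup>+t. weight (Node s1 u s2) t * f t \<partial>G)"
    by (subst nn_integral_gw) simp_all
  finally show ?case by simp
qed

lemma nn_integral_size_scale:
  assumes [measurable]: "f \<in> borel_measurable plane_space" and c: "0 < c" and f: "\<And>t. size t \<noteq> n \<Longrightarrow> f t = 0"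
  shows "(\<integral>\<^sup>+t. ennreal (exp (2 * \<gamma> * plane_length t)) * f (scale_plane c t) \<partial>G) =
    ennreal (1 / c) ^ n * (\<integral>\<^sup>+t. ennreal (exp (2 * \<gamma> * plane_length t)) * f t \<partial>G)"
proof -
  have w: "(if plane_shape t = s then ennreal (exp (2 * \<gamma> * plane_length t)) * x else 0) = weight s t * x" for s t x
    by (simp add: weight_def)
  have z: "weight s t * f t = 0" if "size s \<noteq> n" for s t
    using f[of t] that by (auto simp: weight_def)
  have "(\<integral>\<^sup>+t. weight s t * f (scale_plane c t) \<partial>G) = ennreal (1 / c) ^ n * (\<integral>\<^sup>+t. weight s t * f t \<partial>G)" for s
  proof (cases "size s = n")
    case True
    then show ?thesis using nn_integral_weight_scale[OF assms(1) c, of s] by simp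
  next
    case False
    then have "weight s t * f t = 0" for t using z by blast
    then have "(\<integral>\<^sup>+t. weight s t * f t \<partial>G) = (\<integral>\<^sup>+t. 0 \<partial>G)" by (intro nn_integral_cong)
    then show ?thesis using nn_integral_weight_scale[OF assms(1) c, of s] by simp
  qed
  then show ?thesis
    by (subst (1 2) nn_integral_fibres[OF G.sigma_finite_measure_axioms, where h = plane_shape])
      (auto simp: w nn_integral_cmult)
qed

text \<open>
  The weighted law of the total length is homogeneous of degree \<open>n\<close>, hence has density proportional
  to \<open>y\<^sup>n\<^sup>-\<^sup>1\<close>; removing the weight leaves the Erlang density. The event \<open>U\<close> only enters the constant.
\<close>

lemma emeasure_length_erlang:
  assumes U: "U \<in> sets plane_space" and n: "1 \<le> n" "\<And>t. t \<in> U \<Longrightarrow> size t = n"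
    and inv: "\<And>c t. 0 < c \<Longrightarrow> positive_plane t \<Longrightarrow> scale_plane c t \<in> U \<longleftrightarrow> t \<in> U"
    and B: "B \<in> sets borel"
  shows "emeasure G {t \<in> U. plane_length t \<in> B} =
    emeasure G U * (\<integral>\<^sup>+y\<in>B. ennreal (erlang_density (n - 1) (2 * \<gamma>) y) \<partial>lborel)"
proof -
  define W where "W y = ennreal (exp (2 * \<gamma> * y))" for y :: real
  have [measurable]: "W \<in> borel_measurable borel" unfolding W_def by measurable
  note U[measurable]
  define \<mu> where "\<mu> = distr (density G (indicator U)) borel plane_length"
  have \<mu>: "emeasure \<mu> B = emeasure G {t \<in> U. plane_length t \<in> B}" if [measurable]: "B \<in> sets borel" for B
  proof -
    have "plane_length -` B \<in> sets G"
      using measurable_sets[OF measurable_plane_length that] by simp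
    then have "emeasure \<mu> B = (\<integral>\<^sup>+t. indicator U t * indicator (plane_length -` B) t \<partial>G)"
      unfolding \<mu>_def by (subst emeasure_distr) (auto simp: emeasure_density)
    also have "\<dots> = (\<integral>\<^sup>+t. indicator {t \<in> U. plane_length t \<in> B} t \<partial>G)"
      by (intro nn_integral_cong) (auto simp: indicator_def)
    also have "\<dots> = emeasure G {t \<in> U. plane_length t \<in> B}"
      by (rule nn_integral_indicator) measurable
    finally show ?thesis .
  qed
  have sets_\<mu> [simp, measurable_cong]: "sets \<mu> = sets borel" by (simp add: \<mu>_def)
  define M where "M = density \<mu> W"
  have sets_M [simp, measurable_cong]: "sets M = sets borel" by (simp add: M_def)
  define m where "m a = (\<integral>\<^sup>+t. W (plane_length t) * (indicator U t * indicator {..a} (plane_length t)) \<partial>G)" for a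
  have M: "emeasure M {..a} = m a" for a
    unfolding M_def \<mu>_def m_def
    by (simp add: emeasure_density nn_integral_distr nn_integral_density mult_ac)
  \<comment> \<open>The weighted law of the length may have infinite total mass, but on lengths up
    to a the weight is bounded. Finiteness on half-lines suffices for uniqueness.\<close>
  have m_fin: "m a < \<infinity>" for a
  proof -
    have "m a \<le> (\<integral>\<^sup>+t. ennreal (exp (2 * \<gamma> * a)) \<partial>G)"
      unfolding m_def W_def using \<gamma>_pos by (intro nn_integral_mono) (auto simp: indicator_def intro!: ennreal_leI)
    also have "\<dots> < \<infinity>" by simp
    finally show ?thesis .
  qed
  have m_neg: "m a = 0" if "a \<le> 0" for a
  proof -
    have "AE t in G. W (plane_length t) * (indicator U t * indicator {..a} (plane_length t)) = 0"
      using AE_gw_positive AE_gw_not_Leaf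
      by eventually_elim (use that positive_plane_length in \<open>force simp: indicator_def\<close>)
    then show ?thesis unfolding m_def by (simp add: nn_integral_0_iff_AE)
  qed
  \<comment> \<open>Rescaling by 1 / a preserves U and maps lengths up to a to lengths up to 1; the
    n edges produce the factor \<open>a ^ n\<close>.\<close>
  have m_pos: "m a = ennreal (a ^ n) * m 1" if a: "0 < a" for a
  proof -
    have "m a = (\<integral>\<^sup>+t. W (plane_length t) * (\<lambda>t. indicator U t * indicator {..1} (plane_length t)) (scale_plane (1 / a) t) \<partial>G)"
      unfolding m_def
    proof (rule nn_integral_cong_AE)
      show "AE t in G. W (plane_length t) * (indicator U t * indicator {..a} (plane_length t)) =
        W (plane_length t) * (indicator U (scale_plane (1 / a) t) * indicator {..1} (plane_length (scale_plane (1 / a) t)))"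
        using AE_gw_positive
      proof eventually_elim
        case (elim t)
        have "scale_plane (1 / a) t \<in> U \<longleftrightarrow> t \<in> U"
          by (rule inv) (use a elim in auto)
        then have "indicator U (scale_plane (1 / a) t) = (indicator U t :: ennreal)"
          by (simp only: indicator_def)
        moreover have "plane_length (scale_plane (1 / a) t) \<le> 1 \<longleftrightarrow> plane_length t \<le> a"
          unfolding plane_length_scale using a by (simp add: field_simps)
        then have "indicator {..1} (plane_length (scale_plane (1 / a) t)) = (indicator {..a} (plane_length t) :: ennreal)"
          by (simp only: indicator_def atMost_iff)
        ultimately show ?case by (simp only:)
      qed
    qed
    also have "\<dots> = ennreal (1 / (1 / a)) ^ n * m 1"
      unfolding m_def W_def
      by (rule nn_integral_size_scale) (use a n(2) in \<open>auto simp: indicator_def\<close>)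
    finally show ?thesis using a by (simp add: ennreal_power)
  qed
  \<comment> \<open>The candidate for M: its density is \<open>m 1\<close> times the derivative of
    \<open>y ^ n\<close> on the positive half-line.\<close>
  define D where "D = density lborel (\<lambda>y. m 1 * ennreal (indicator {0..} y * (real n * y ^ (n - 1))))"
  have D: "emeasure D {..a} = m a" for a
  proof -
    have "emeasure D {..a} = (\<integral>\<^sup>+y. m 1 * (ennreal (indicator {0..} y * (real n * y ^ (n - 1))) * indicator {..a} y) \<partial>lborel)"
      unfolding D_def by (simp add: emeasure_density mult.assoc)
    also have "\<dots> = m 1 * (\<integral>\<^sup>+y. ennreal (indicator {0..} y * (real n * y ^ (n - 1))) * indicator {..a} y \<partial>lborel)"
      by (rule nn_integral_cmult) measurable
    also have "(\<integral>\<^sup>+y. ennreal (indicator {0..} y * (real n * y ^ (n - 1))) * indicator {..a} y \<partial>lborel) =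
        (\<integral>\<^sup>+y. ennreal (real n * y ^ (n - 1)) * indicator {0..a} y \<partial>lborel)"
      by (intro nn_integral_cong) (auto simp: indicator_def)
    also have "m 1 * \<dots> = m a"
    proof (cases "0 < a")
      case True
      have "(\<integral>\<^sup>+y. ennreal (real n * y ^ (n - 1)) * indicator {0..a} y \<partial>lborel) = ennreal (a ^ n - 0 ^ n)"
      proof (rule nn_integral_FTC_Icc)
        show "((\<lambda>y. y ^ n) has_real_derivative real n * y ^ (n - 1)) (at y)" for y :: real
          using DERIV_pow[of n y] by simp
      qed (use True in auto)
      then show ?thesis using True n(1) by (simp add: m_pos[OF True] mult.commute power_0_left)
    next
      case False
      have "(\<integral>\<^sup>+y. ennreal (real n * y ^ (n - 1)) * indicator {0..a} y \<partial>lborel) = (\<integral>\<^sup>+(y :: real). 0 \<partial>lborel)"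
      proof (rule nn_integral_cong_AE)
        have "AE y in lborel. y \<noteq> (0 :: real)" by (rule AE_lborel_singleton)
        then show "AE y in lborel. ennreal (real n * y ^ (n - 1)) * indicator {0..a} y = 0"
          by eventually_elim (use False in \<open>auto simp: indicator_def\<close>)
      qed
      then show ?thesis using False m_neg[of a] by simp
    qed
    finally show ?thesis .
  qed
  have MD: "M = D"
  proof (rule measure_eqI_generator_eq[where E = "range atMost" and \<Omega> = UNIV and A = "\<lambda>i :: nat. {..real i}"])
    show "Int_stable (range (atMost :: real \<Rightarrow> real set))"
      by (auto simp: Int_stable_def)
    show "sets M = sigma_sets UNIV (range atMost)" "sets D = sigma_sets UNIV (range atMost)"
      by (simp_all add: D_def borel_eq_atMost)
    show "(\<Union>i :: nat. {..real i}) = UNIV"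
      by (auto intro: real_arch_simple)
    show "emeasure M {..real i} \<noteq> \<infinity>" for i
      using m_fin[of i] by (simp add: M)
  qed (auto simp: M D)
  define \<epsilon> where "\<epsilon> y = ennreal (erlang_density (n - 1) (2 * \<gamma>) y)" for y
  have [measurable]: "\<epsilon> \<in> borel_measurable borel" unfolding \<epsilon>_def by measurable
  \<comment> \<open>Collects the constants by which n y^(n-1) exp (- 2 \<gamma> y) differs from the
    Erlang density.\<close>
  define C where "C = m 1 * ennreal (real n * fact (n - 1) / (2 * \<gamma>) ^ n)"
  have main: "emeasure \<mu> B = C * (\<integral>\<^sup>+y\<in>B. \<epsilon> y \<partial>lborel)" if [measurable]: "B \<in> sets borel" for B
  proof -
    have "emeasure \<mu> B = (\<integral>\<^sup>+y. W y * (ennreal (exp (- 2 * \<gamma> * y)) * indicator B y) \<partial>\<mu>)"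
    proof -
      have "W y * (ennreal (exp (- 2 * \<gamma> * y)) * x) = x" for y x
        by (simp add: W_def mult.assoc[symmetric] ennreal_mult[symmetric] exp_add[symmetric])
      then show ?thesis by simp
    qed
    also have "\<dots> = (\<integral>\<^sup>+y. ennreal (exp (- 2 * \<gamma> * y)) * indicator B y \<partial>M)"
      unfolding M_def by (rule nn_integral_density[symmetric]) auto
    also have "\<dots> = (\<integral>\<^sup>+y. m 1 * ennreal (indicator {0..} y * (real n * y ^ (n - 1))) *
        (ennreal (exp (- 2 * \<gamma> * y)) * indicator B y) \<partial>lborel)"
      unfolding MD D_def by (rule nn_integral_density) auto
    also have "\<dots> = (\<integral>\<^sup>+y. C * (\<epsilon> y * indicator B y) \<partial>lborel)"
    proof (rule nn_integral_cong)
      fix y :: real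
      have eq: "ennreal (indicator {0..} y * (real n * y ^ (n - 1))) * ennreal (exp (- 2 * \<gamma> * y)) =
        ennreal (real n * fact (n - 1) / (2 * \<gamma>) ^ n) * \<epsilon> y"
      proof (cases "0 \<le> y")
        case True
        have "real n * y ^ (n - 1) * exp (- 2 * \<gamma> * y) =
          real n * fact (n - 1) / (2 * \<gamma>) ^ n * erlang_density (n - 1) (2 * \<gamma>) y"
          using True \<gamma>_pos n(1) by (simp add: erlang_density_def)
        then show ?thesis using True \<gamma>_pos by (simp add: \<epsilon>_def ennreal_mult[symmetric])
      qed (simp add: \<epsilon>_def erlang_density_def)
      have "m 1 * ennreal (indicator {0..} y * (real n * y ^ (n - 1))) *
        (ennreal (exp (- 2 * \<gamma> * y)) * indicator B y) =
        m 1 * (ennreal (indicator {0..} y * (real n * y ^ (n - 1))) * ennreal (exp (- 2 * \<gamma> * y))) * indicator B y"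
        by (simp only: mult.assoc)
      also have "\<dots> = C * (\<epsilon> y * indicator B y)"
        unfolding eq C_def by (simp only: mult.assoc)
      finally show "m 1 * ennreal (indicator {0..} y * (real n * y ^ (n - 1))) *
        (ennreal (exp (- 2 * \<gamma> * y)) * indicator B y) = C * (\<epsilon> y * indicator B y)" .
    qed
    also have "\<dots> = C * (\<integral>\<^sup>+y\<in>B. \<epsilon> y \<partial>lborel)" by (rule nn_integral_cmult) measurable
    finally show ?thesis .
  qed
  have "(\<integral>\<^sup>+y\<in>UNIV. \<epsilon> y \<partial>lborel) = 1"
  proof -
    interpret prob_space "density lborel (erlang_density (n - 1) (2 * \<gamma>))"
      by (rule prob_space_erlang_density) (use \<gamma>_pos in simp)
    show ?thesis using emeasure_space_1 by (simp add: emeasure_density \<epsilon>_def)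
  qed
  \<comment> \<open>The Erlang density has total mass 1, so taking B to be everything identifies the
    constant without evaluating \<open>m 1\<close>.\<close>
  then have "C = emeasure G U" using main[of UNIV] \<mu>[of UNIV] by simp
  then show ?thesis using main[OF B] \<mu>[OF B] by (simp add: \<epsilon>_def)
qed

end

section \<open>Conditional laws of the Galton-Watson tree\<close>

lemma preorder_scale_nth:
  "i < size t \<Longrightarrow> preorder (scale_plane c t) ! i = c * preorder t ! i"
  by (simp add: preorder_map)

lemma tree_length_scale [simp]: "tree_length (map_utree (\<lambda>e. c * e) T) = c * tree_length T"
  by (rule unordered_surj[of T]) (simp add: map_utree.abs_eq)

lemma shape_scale [simp]: "shape (map_utree f T) = shape T"
  by (rule unordered_surj[of T]) (simp add: map_utree.abs_eq tree.map_comp comp_def)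

lemma edge_count_unordered [simp]: "edge_count (unordered t) = size t"
  by (rule edge_count.abs_eq)

text \<open>This is where independence of the embedding from the unit of length enters: without it
  the depth-first order of the edges could change with the scale.\<close>

lemma rel_lengths_scale:
  assumes emb: "proper_embedding emb" and T: "T \<in> length_trees" and c: "0 < c"
  shows "rel_lengths emb (map_utree (\<lambda>e. c * e) T) = rel_lengths emb T"
proof -
  have e: "emb (map_utree (\<lambda>e. c * e) T) = scale_plane c (emb T)" "unordered (emb T) = T"
    using emb T c by (auto simp: proper_embedding_def)
  have n: "edge_count (map_utree (\<lambda>e. c * e) T) = edge_count T"
    by (metis edge_count_shape shape_scale)
  have s: "size (emb T) = edge_count T"
    using e(2) by (metis edge_count_unordered)
  show ?thesis unfolding rel_lengths_def n e(1)
    using c by (intro restrict_ext) (simp add: preorder_scale_nth s del: tree.map)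
qed

lemma measurable_rel_lengths:
  assumes "emb \<in> utree_space \<rightarrow>\<^sub>M plane_space"
  shows "(\<lambda>T. \<lambda>i\<in>I. preorder (emb T) ! i / tree_length T) \<in> utree_space \<rightarrow>\<^sub>M Pi\<^sub>M I (\<lambda>_. borel)"
proof (rule measurable_restrict)
  fix i
  have [measurable]: "(\<lambda>T. preorder (emb T) ! i) \<in> borel_measurable utree_space"
    by (rule measurable_compose[OF assms measurable_preorder_nth])
  show "(\<lambda>T. preorder (emb T) ! i / tree_length T) \<in> borel_measurable utree_space"
    by measurable
qed

lemma rel_lengths_shape:
  "shape T = \<tau> \<Longrightarrow> rel_lengths emb T = (\<lambda>i\<in>{..<edge_count \<tau>}. preorder (emb T) ! i / tree_length T)"
  by (metis edge_count_shape rel_lengths_def)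

context galton_watson begin

abbreviation "P \<equiv> gw_law \<gamma>"

sublocale P: prob_space P
  unfolding gw_law_eq by (rule G.prob_space_distr) measurable

lemma sets_P [simp, measurable_cong]: "sets P = sets utree_space"
  by (simp add: gw_law_eq)

lemma space_P [simp]: "space P = UNIV"
  by (simp add: gw_law_eq)

lemma emeasure_P: "A \<in> sets utree_space \<Longrightarrow> emeasure P A = emeasure G {t. unordered t \<in> A}"
  unfolding gw_law_eq by (subst emeasure_distr) (auto simp: vimage_def)

lemma nn_integral_P: "f \<in> borel_measurable utree_space \<Longrightarrow> (\<integral>\<^sup>+T. f T \<partial>P) = (\<integral>\<^sup>+t. f (unordered t) \<partial>G)"
  unfolding gw_law_eq by (subst nn_integral_distr) auto

lemma tree_law_P: "tree_law P"
proof -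
  have "{T. T \<in> length_trees} \<in> sets utree_space"
    using measurable_positive_plane by (simp add: sets_utree_space vimage_def pred_def)
  then have "AE T in P. T \<in> length_trees"
    unfolding gw_law_eq using AE_gw_positive by (subst AE_distr_iff) auto
  then show ?thesis by (simp add: tree_law_def P.prob_space_axioms)
qed

text \<open>The index set is taken from \<tau> and not from the tree, so that the map has values in
  \<open>vec_space \<tau>\<close> everywhere. For shapes of probability zero the point mass at the
  zero vector is a filler, as a probability measure is demanded for every shape.\<close>

definition rel_law :: "(real utree \<Rightarrow> real tree) \<Rightarrow> unit utree \<Rightarrow> (nat \<Rightarrow> real) measure" where
  "rel_law emb \<tau> =
     (if emeasure P {T. shape T = \<tau>} = 0 then return (vec_space \<tau>) (\<lambda>i\<in>{..<edge_count \<tau>}. 0)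
      else distr (uniform_measure P {T. shape T = \<tau>}) (vec_space \<tau>)
        (\<lambda>T. \<lambda>i\<in>{..<edge_count \<tau>}. preorder (emb T) ! i / tree_length T))"

text \<open>Density of a sum of \<open>edge_count \<tau>\<close> independent edges; the Erlang
  parameter counts one less. It is constant in x because, given the shape, the length is independent
  of the relative lengths. For the empty shape the truncated subtraction gives the exponential
  density as a filler.\<close>

definition length_density :: "unit utree \<Rightarrow> (nat \<Rightarrow> real) \<Rightarrow> real \<Rightarrow> real" where
  "length_density \<tau> x y = erlang_density (edge_count \<tau> - 1) (2 * \<gamma>) y"

lemma shape_in_sets [measurable, simp]: "{T. shape T = \<tau>} \<in> sets utree_space"
  using measurable_sets[OF measurable_shape, of "{\<tau>}"] by (simp add: vimage_def)

lemma tree_order_in_sets [measurable, simp]: "{T. tree_order T = k} \<in> sets utree_space"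
  using measurable_sets[OF measurable_tree_order, of "{k}"] by (simp add: vimage_def)

lemma rel_law:
  assumes "proper_embedding emb"
  shows "prob_space (rel_law emb \<tau>)" "sets (rel_law emb \<tau>) = sets (vec_space \<tau>)"
proof -
  have e: "emb \<in> utree_space \<rightarrow>\<^sub>M plane_space" using assms by (simp add: proper_embedding_def)
  have m: "(\<lambda>T. \<lambda>i\<in>{..<edge_count \<tau>}. preorder (emb T) ! i / tree_length T) \<in>
      uniform_measure P {T. shape T = \<tau>} \<rightarrow>\<^sub>M vec_space \<tau>"
    using measurable_rel_lengths[OF e] by (simp cong: measurable_cong_sets)
  show "prob_space (rel_law emb \<tau>)"
  proof (cases "emeasure P {T. shape T = \<tau>} = 0")
    case True
    then show ?thesis by (auto simp: rel_law_def space_PiM intro!: prob_space_return)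
  next
    case False
    then have "prob_space (uniform_measure P {T. shape T = \<tau>})"
      by (intro prob_space_uniform_measure) auto
    then show ?thesis using False m by (auto simp: rel_law_def intro: prob_space.prob_space_distr)
  qed
  show "sets (rel_law emb \<tau>) = sets (vec_space \<tau>)" by (simp add: rel_law_def)
qed

lemma conditional_density_length: "conditional_density \<tau> (length_density \<tau>)"
proof -
  have "(\<integral>\<^sup>+y. ennreal (erlang_density k (2 * \<gamma>) y) \<partial>lborel) = 1" for k
  proof -
    interpret prob_space "density lborel (erlang_density k (2 * \<gamma>))"
      by (rule prob_space_erlang_density) (use \<gamma>_pos in simp)
    show ?thesis using emeasure_space_1 by (simp add: emeasure_density)
  qed
  then show ?thesis using \<gamma>_pos
    by (auto simp: conditional_density_def length_density_def)
qed

lemma conditional_event_in_sets: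
  assumes emb: "proper_embedding emb" and A: "A \<in> sets (vec_space \<tau>)" and B: "B \<in> sets borel"
  shows "{T. shape T = \<tau> \<and> rel_lengths emb T \<in> A \<and> tree_length T \<in> B} \<in> sets utree_space"
proof -
  let ?rel = "\<lambda>T. \<lambda>i\<in>{..<edge_count \<tau>}. preorder (emb T) ! i / tree_length T"
  have m: "?rel \<in> utree_space \<rightarrow>\<^sub>M vec_space \<tau>"
    using emb by (intro measurable_rel_lengths) (simp add: proper_embedding_def)
  have "{T. shape T = \<tau> \<and> rel_lengths emb T \<in> A \<and> tree_length T \<in> B} =
    {T. shape T = \<tau>} \<inter> (?rel -` A \<inter> space utree_space) \<inter> (tree_length -` B \<inter> space utree_space)"
    using rel_lengths_shape[of _ \<tau> emb] by auto
  then show ?thesis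
    using sets.Int[OF sets.Int[OF shape_in_sets measurable_sets[OF m A]] measurable_sets[OF measurable_tree_length B]]
    by simp
qed

text \<open>Fixing the shape and restricting the relative lengths to A defines a scale-invariant
  event, to which \<open>emeasure_length_erlang\<close> applies: its probability and the law of the
  length factor.\<close>

lemma has_conditional_laws_P:
  assumes emb: "proper_embedding emb" and \<tau>: "\<tau> \<noteq> \<phi>"
  shows "has_conditional_laws emb P \<tau> (rel_law emb \<tau>) (length_density \<tau>)"
  unfolding has_conditional_laws_def
proof (intro ballI)
  fix A B assume A: "A \<in> sets (vec_space \<tau>)" and B: "B \<in> sets (borel :: real measure)"
  let ?n = "edge_count \<tau>"
  let ?rel = "\<lambda>T. \<lambda>i\<in>{..<?n}. preorder (emb T) ! i / tree_length T"
  have m: "?rel \<in> utree_space \<rightarrow>\<^sub>M vec_space \<tau>"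
    using emb by (intro measurable_rel_lengths) (simp add: proper_embedding_def)
  define V where "V = {T. shape T = \<tau> \<and> rel_lengths emb T \<in> A}"
  have V: "V = {T. shape T = \<tau>} \<inter> (?rel -` A \<inter> space utree_space)"
    using rel_lengths_shape[of _ \<tau> emb] by (auto simp: V_def)
  have Vs: "V \<in> sets utree_space"
    using conditional_event_in_sets[OF emb A, of UNIV] by (simp add: V_def)
  have VBs: "{T \<in> V. tree_length T \<in> B} \<in> sets utree_space"
    using conditional_event_in_sets[OF emb A B] by (simp add: V_def conj_assoc)
  let ?b = "\<integral>\<^sup>+y\<in>B. ennreal (erlang_density (?n - 1) (2 * \<gamma>) y) \<partial>lborel"
  have "emeasure P {T. shape T = \<tau> \<and> rel_lengths emb T \<in> A \<and> tree_length T \<in> B} =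
      emeasure G {t \<in> {t. unordered t \<in> V}. plane_length t \<in> B}"
    using emeasure_P[OF VBs] by (simp add: V_def conj_assoc)
  also have "\<dots> = emeasure G {t. unordered t \<in> V} * ?b"
  proof (rule emeasure_length_erlang[OF _ _ _ _ B])
    show "{t. unordered t \<in> V} \<in> sets plane_space"
      using Vs by (simp add: sets_utree_space vimage_def)
    show "1 \<le> ?n"
    proof (rule unordered_surj[of \<tau>])
      fix s assume "\<tau> = unordered s"
      then show ?thesis using \<tau> by (cases s) auto
    qed
    show "size t = ?n" if "t \<in> {t. unordered t \<in> V}" for t
      using that edge_count_shape[of "unordered t"] by (auto simp: V_def)
    show "scale_plane c t \<in> {t. unordered t \<in> V} \<longleftrightarrow> t \<in> {t. unordered t \<in> V}"
      if "0 < c" "positive_plane t" for c t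
    proof -
      have "unordered (scale_plane c t) = map_utree (\<lambda>e. c * e) (unordered t)" by (simp add: map_utree.abs_eq)
      then show ?thesis using rel_lengths_scale[OF emb _ that(1), of "unordered t"] that(2)
        by (simp add: V_def)
    qed
  qed
  also have "emeasure G {t. unordered t \<in> V} = emeasure P V"
    by (rule emeasure_P[OF Vs, symmetric])
  also have "emeasure P V = emeasure P {T. shape T = \<tau>} * emeasure (rel_law emb \<tau>) A"
  proof (cases "emeasure P {T. shape T = \<tau>} = 0")
    case True
    have "emeasure P V \<le> emeasure P {T. shape T = \<tau>}"
      by (rule emeasure_mono) (auto simp: V_def)
    then show ?thesis using True by simp
  next
    case False
    have m': "?rel \<in> uniform_measure P {T. shape T = \<tau>} \<rightarrow>\<^sub>M vec_space \<tau>"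
      using m by (simp cong: measurable_cong_sets)
    have "emeasure (rel_law emb \<tau>) A = emeasure (uniform_measure P {T. shape T = \<tau>}) (?rel -` A \<inter> space utree_space)"
      using False by (simp add: rel_law_def emeasure_distr[OF m' A])
    also have "\<dots> = emeasure P V / emeasure P {T. shape T = \<tau>}"
      unfolding V using measurable_sets[OF m A] by (subst emeasure_uniform_measure) auto
    finally show ?thesis
      using False by (simp add: ennreal_times_divide mult.commute ennreal_mult_divide_eq)
  qed
  also have "emeasure P {T. shape T = \<tau>} * emeasure (rel_law emb \<tau>) A * ?b =
    emeasure P {T. shape T = \<tau>} * (\<integral>\<^sup>+x\<in>A. (\<integral>\<^sup>+y\<in>B. ennreal (length_density \<tau> x y) \<partial>lborel) \<partial>rel_law emb \<tau>)"
  proof -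
    have "A \<in> sets (rel_law emb \<tau>)" using A rel_law(2)[OF emb] by simp
    then show ?thesis
      by (simp add: length_density_def nn_integral_cmult_indicator mult.assoc) (simp only: mult_ac)
  qed
  finally show "emeasure P {T. shape T = \<tau> \<and> rel_lengths emb T \<in> A \<and> tree_length T \<in> B} =
        emeasure P {T. shape T = \<tau>} *
          (\<integral>\<^sup>+x\<in>A. (\<integral>\<^sup>+y\<in>B. ennreal (length_density \<tau> x y) \<partial>lborel) \<partial>rel_law emb \<tau>)" .
qed

end

section \<open>Pruning the Galton-Watson tree\<close>

definition extend_root :: "real \<Rightarrow> real tree \<Rightarrow> real tree" where
  "extend_root e t = (case t of Leaf \<Rightarrow> Leaf | Node l x r \<Rightarrow> Node l (e + x) r)"

lemma extend_root_Leaf [simp]: "extend_root e Leaf = Leaf"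
  by (simp add: extend_root_def)

lemma measurable_extend_root [measurable (raw)]:
  assumes [measurable]: "g \<in> borel_measurable M" "h \<in> M \<rightarrow>\<^sub>M plane_space"
  shows "(\<lambda>w. extend_root (g w) (h w)) \<in> M \<rightarrow>\<^sub>M plane_space"
  unfolding extend_root_def by measurable

text \<open>Separates the cases by which of the two subtrees has been pruned away. As f vanishes at
  \<open>Leaf\<close>, at most one of the four terms is nonzero, so the terms can be integrated one
  by one.\<close>

lemma attach_decomposition:
  assumes "f Leaf = (0 :: ennreal)"
  shows "f (attach e x y) = (if x = Leaf then 1 else 0) * (if y = Leaf then 1 else 0) * f (Node Leaf e Leaf) +
    (if x = Leaf then 1 else 0) * f (extend_root e y) + (if y = Leaf then 1 else 0) * f (extend_root e x) +
    f (graft x e y)"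
  using assms by (cases x; cases y) (auto simp: extend_root_def graft_def)

section \<open>The pruned Galton-Watson tree as a doubled Galton-Watson tree\<close>

context galton_watson begin

text \<open>
  The length of the root edge after pruning is a geometric sum of edges: given that the root edge
  survives, with probability 1/2 it is prolonged by a root edge of the pruned tree.
\<close>

lemma nn_integral_E_mixture:
  assumes [measurable]: "h \<in> borel_measurable borel"
  shows "(\<integral>\<^sup>+e. h e / 2 + (\<integral>\<^sup>+x. h (e + 2 * x) \<partial>E) / 2 \<partial>E) = (\<integral>\<^sup>+e. h (2 * e) \<partial>E)"
proof -
  define d where "d a y = ennreal (a * exp (- a * y)) * indicator {0..} y" for a y :: real
  have [measurable]: "d a \<in> borel_measurable borel" for a unfolding d_def by measurable
  have E: "(\<integral>\<^sup>+e. g e \<partial>E) = (\<integral>\<^sup>+e. d (2 * \<gamma>) e * g e \<partial>lborel)"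
    if [measurable]: "g \<in> borel_measurable borel" for g
  proof -
    have "(\<integral>\<^sup>+e. g e \<partial>E) = (\<integral>\<^sup>+e. ennreal (exponential_density (2 * \<gamma>) e) * g e \<partial>lborel)"
      by (rule nn_integral_density) measurable
    also have "\<dots> = (\<integral>\<^sup>+e. d (2 * \<gamma>) e * g e \<partial>lborel)"
      by (intro nn_integral_cong) (auto simp: d_def exponential_density_def indicator_def mult_ac)
    finally show ?thesis .
  qed
  have E2: "(\<integral>\<^sup>+x. h (e + 2 * x) \<partial>E) = (\<integral>\<^sup>+y. d \<gamma> (y - e) * h y \<partial>lborel)" for e
  proof -
    have "(\<integral>\<^sup>+y. d \<gamma> (y - e) * h y \<partial>lborel) = ennreal \<bar>2\<bar> * (\<integral>\<^sup>+x. d \<gamma> (e + 2 * x - e) * h (e + 2 * x) \<partial>lborel)"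
      by (rule nn_integral_real_affine) auto
    also have "\<dots> = (\<integral>\<^sup>+x. ennreal \<bar>2\<bar> * (d \<gamma> (e + 2 * x - e) * h (e + 2 * x)) \<partial>lborel)"
      by (rule nn_integral_cmult[symmetric]) measurable
    also have "\<dots> = (\<integral>\<^sup>+x. d (2 * \<gamma>) x * h (e + 2 * x) \<partial>lborel)"
    proof (rule nn_integral_cong)
      fix x :: real
      have "ennreal \<bar>2\<bar> * d \<gamma> (e + 2 * x - e) = d (2 * \<gamma>) x"
        using \<gamma>_pos by (auto simp: d_def indicator_def ennreal_mult[symmetric] mult_ac simp flip: ennreal_numeral)
      then show "ennreal \<bar>2\<bar> * (d \<gamma> (e + 2 * x - e) * h (e + 2 * x)) = d (2 * \<gamma>) x * h (e + 2 * x)"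
        by (simp only: mult.assoc[symmetric])
    qed
    also have "\<dots> = (\<integral>\<^sup>+x. h (e + 2 * x) \<partial>E)" by (rule E[symmetric]) measurable
    finally show ?thesis ..
  qed
  \<comment> \<open>Convolution of the laws of an edge (rate \<open>2 * \<gamma>\<close>) and of a
    doubled edge (rate \<gamma>).\<close>
  have conv: "(\<integral>\<^sup>+e. d (2 * \<gamma>) e * d \<gamma> (y - e) \<partial>lborel) =
      ennreal (2 * \<gamma> * exp (- \<gamma> * y) * (1 - exp (- \<gamma> * y))) * indicator {0..} y" for y
  proof (cases "0 \<le> y")
    case True
    have "(\<integral>\<^sup>+e. d (2 * \<gamma>) e * d \<gamma> (y - e) \<partial>lborel) =
      (\<integral>\<^sup>+e. ennreal (2 * \<gamma> * \<gamma> * exp (- \<gamma> * y) * exp (- \<gamma> * e)) * indicator {0..y} e \<partial>lborel)"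
    proof (rule nn_integral_cong)
      fix e :: real
      have "2 * \<gamma> * exp (- (2 * \<gamma>) * e) * (\<gamma> * exp (- \<gamma> * (y - e))) =
        2 * \<gamma> * \<gamma> * exp (- \<gamma> * y) * exp (- \<gamma> * e)"
        by (simp add: exp_add[symmetric] algebra_simps)
      then show "d (2 * \<gamma>) e * d \<gamma> (y - e) =
        ennreal (2 * \<gamma> * \<gamma> * exp (- \<gamma> * y) * exp (- \<gamma> * e)) * indicator {0..y} e"
        using \<gamma>_pos by (auto simp: d_def indicator_def ennreal_mult[symmetric])
    qed
    also have "\<dots> = ennreal (- 2 * \<gamma> * exp (- \<gamma> * y) * exp (- \<gamma> * y) - (- 2 * \<gamma> * exp (- \<gamma> * y) * exp (- \<gamma> * 0)))"
    proof (rule nn_integral_FTC_Icc)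
      show "((\<lambda>e. - 2 * \<gamma> * exp (- \<gamma> * y) * exp (- \<gamma> * e)) has_real_derivative
          2 * \<gamma> * \<gamma> * exp (- \<gamma> * y) * exp (- \<gamma> * e)) (at e)" for e
        by (auto intro!: derivative_eq_intros)
    qed (use True \<gamma>_pos in auto)
    also have "- 2 * \<gamma> * exp (- \<gamma> * y) * exp (- \<gamma> * y) - (- 2 * \<gamma> * exp (- \<gamma> * y) * exp (- \<gamma> * 0)) =
        2 * \<gamma> * exp (- \<gamma> * y) * (1 - exp (- \<gamma> * y))" by (simp add: algebra_simps)
    finally show ?thesis using True by simp
  next
    case False
    then have "(\<integral>\<^sup>+e. d (2 * \<gamma>) e * d \<gamma> (y - e) \<partial>lborel) = (\<integral>\<^sup>+(e :: real). 0 \<partial>lborel)"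
      by (intro nn_integral_cong) (auto simp: d_def indicator_def)
    then show ?thesis using False by simp
  qed
  have "(\<integral>\<^sup>+e. \<integral>\<^sup>+x. h (e + 2 * x) \<partial>E \<partial>E) = (\<integral>\<^sup>+e. d (2 * \<gamma>) e * (\<integral>\<^sup>+y. d \<gamma> (y - e) * h y \<partial>lborel) \<partial>lborel)"
    unfolding E2 by (rule E) measurable
  also have "\<dots> = (\<integral>\<^sup>+e. \<integral>\<^sup>+y. d (2 * \<gamma>) e * d \<gamma> (y - e) * h y \<partial>lborel \<partial>lborel)"
    by (simp add: nn_integral_cmult[symmetric] mult.assoc)
  also have "\<dots> = (\<integral>\<^sup>+y. \<integral>\<^sup>+e. d (2 * \<gamma>) e * d \<gamma> (y - e) * h y \<partial>lborel \<partial>lborel)"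
    by (rule nn_integral_swap) (auto intro: sigma_finite_lborel)
  also have "\<dots> = (\<integral>\<^sup>+y. ennreal (2 * \<gamma> * exp (- \<gamma> * y) * (1 - exp (- \<gamma> * y))) * indicator {0..} y * h y \<partial>lborel)"
    unfolding conv[symmetric] by (intro nn_integral_cong nn_integral_multc) measurable
  finally have second: "(\<integral>\<^sup>+e. \<integral>\<^sup>+x. h (e + 2 * x) \<partial>E \<partial>E) = \<dots>" .
  have "(\<integral>\<^sup>+e. h e / 2 + (\<integral>\<^sup>+x. h (e + 2 * x) \<partial>E) / 2 \<partial>E) =
      ((\<integral>\<^sup>+e. h e \<partial>E) + (\<integral>\<^sup>+e. \<integral>\<^sup>+x. h (e + 2 * x) \<partial>E \<partial>E)) / 2"
    by (simp add: divide_ennreal_def nn_integral_add nn_integral_multc distrib_right)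
  also have "(\<integral>\<^sup>+e. h e \<partial>E) + (\<integral>\<^sup>+e. \<integral>\<^sup>+x. h (e + 2 * x) \<partial>E \<partial>E) =
      (\<integral>\<^sup>+y. d (2 * \<gamma>) y * h y + ennreal (2 * \<gamma> * exp (- \<gamma> * y) * (1 - exp (- \<gamma> * y))) * indicator {0..} y * h y \<partial>lborel)"
    unfolding second by (subst E) (auto simp: nn_integral_add)
  also have "\<dots> = (\<integral>\<^sup>+y. 2 * (d \<gamma> (y - 0) * h y) \<partial>lborel)"
  proof (rule nn_integral_cong)
    fix y :: real
    \<comment> \<open>The average of the edge density and the convolution is the exponential density
      of rate \<gamma>, that is, of a doubled edge. This identity is the origin of the scaling
      exponent 2.\<close>
    have "d (2 * \<gamma>) y + ennreal (2 * \<gamma> * exp (- \<gamma> * y) * (1 - exp (- \<gamma> * y))) * indicator {0..} y = 2 * d \<gamma> (y - 0)"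
    proof (cases "0 \<le> y")
      case True
      have "2 * \<gamma> * exp (- (2 * \<gamma>) * y) + 2 * \<gamma> * exp (- \<gamma> * y) * (1 - exp (- \<gamma> * y)) = 2 * (\<gamma> * exp (- \<gamma> * y))"
        by (simp add: algebra_simps exp_add[symmetric])
      moreover have "0 \<le> 2 * \<gamma> * exp (- (2 * \<gamma>) * y)" "0 \<le> 2 * \<gamma> * exp (- \<gamma> * y) * (1 - exp (- \<gamma> * y))"
        using True \<gamma>_pos by auto
      ultimately have "ennreal (2 * \<gamma> * exp (- (2 * \<gamma>) * y)) + ennreal (2 * \<gamma> * exp (- \<gamma> * y) * (1 - exp (- \<gamma> * y))) =
        ennreal (2 * (\<gamma> * exp (- \<gamma> * y)))"
        by (simp only: ennreal_plus[symmetric])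
      also have "\<dots> = 2 * ennreal (\<gamma> * exp (- \<gamma> * y))"
        using \<gamma>_pos by (subst ennreal_mult) auto
      finally show ?thesis using True by (simp add: d_def)
    qed (simp add: d_def)
    then show "d (2 * \<gamma>) y * h y + ennreal (2 * \<gamma> * exp (- \<gamma> * y) * (1 - exp (- \<gamma> * y))) * indicator {0..} y * h y =
      2 * (d \<gamma> (y - 0) * h y)"
      by (simp only: distrib_right[symmetric] mult.assoc[symmetric])
  qed
  also have "\<dots> = 2 * (\<integral>\<^sup>+y. d \<gamma> (y - 0) * h y \<partial>lborel)" by (rule nn_integral_cmult) measurable
  also have "\<dots> / 2 = (\<integral>\<^sup>+y. d \<gamma> (y - 0) * h y \<partial>lborel)"
    by (simp add: mult.commute[of 2] ennreal_mult_divide_eq)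
  also have "\<dots> = (\<integral>\<^sup>+x. h (0 + 2 * x) \<partial>E)" by (rule E2[symmetric])
  finally show ?thesis by simp
qed

lemma AE_gw_size: "AE t in G. prune_plane t = Leaf \<longleftrightarrow> size t = 1"
  using AE_gw_positive AE_gw_not_Leaf
proof eventually_elim
  case (elim t)
  then obtain l e r where t: "t = Node l e r" by (cases t) auto
  have red: "reduced_plane t" using elim by (simp add: positive_plane_def)
  have "0 < strahler l" "0 < strahler r" if "l \<noteq> Leaf" using red that by (auto simp: t intro: Nat.gr0I)
  then have "strahler t \<le> 1 \<longleftrightarrow> l = Leaf" using red by (cases "l = Leaf") (auto simp: t max_def)
  then show ?case using red prune_plane_eq_Leaf_iff[OF red] by (auto simp: t)
qed

lemma emeasure_prune_Leaf: "(\<integral>\<^sup>+t. (if prune_plane t = Leaf then 1 else 0) \<partial>G) = 1 / 2"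
proof -
  have "(\<integral>\<^sup>+t. (if prune_plane t = Leaf then 1 else 0) \<partial>G) = (\<integral>\<^sup>+t. (if size t = 1 then 1 else 0) \<partial>G)"
    using AE_gw_size by (intro nn_integral_cong_AE) auto
  also have "\<dots> = (\<integral>\<^sup>+e. 1 \<partial>E) / 2 + (\<integral>\<^sup>+e. \<integral>\<^sup>+l. \<integral>\<^sup>+r. (if size (Node l e r) = 1 then 1 else 0) \<partial>G \<partial>G \<partial>E) / 2"
    by (subst nn_integral_gw) auto
  also have "(\<integral>\<^sup>+e. \<integral>\<^sup>+l. \<integral>\<^sup>+r. (if size (Node l e r) = 1 then 1 else 0) \<partial>G \<partial>G \<partial>E) = (\<integral>\<^sup>+e. \<integral>\<^sup>+l. 0 \<partial>G \<partial>E)"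
  proof (rule nn_integral_cong, rule nn_integral_cong_AE)
    fix e
    show "AE l in G. (\<integral>\<^sup>+r. (if size (Node l e r) = 1 then 1 else 0 :: ennreal) \<partial>G) = 0"
      using AE_gw_not_Leaf by eventually_elim simp
  qed
  finally show ?thesis by simp
qed

lemma nn_integral_scale_2:
  assumes [measurable]: "f \<in> borel_measurable plane_space"
  shows "(\<integral>\<^sup>+t. f (extend_root e (scale_plane 2 t)) \<partial>G) =
    (\<integral>\<^sup>+x. f (Node Leaf (e + 2 * x) Leaf) / 2 +
      (\<integral>\<^sup>+l. \<integral>\<^sup>+r. f (Node (scale_plane 2 l) (e + 2 * x) (scale_plane 2 r)) \<partial>G \<partial>G) / 2 \<partial>E)"
  by (subst nn_integral_gw) (auto simp: extend_root_def nn_integral_add divide_ennreal_def nn_integral_multc)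

text \<open>Truncation by the size of the unpruned tree gives an induction that also works when one
  subtree is pruned away and the other one merely has its root edge prolonged. The price is an
  inequality, because the truncated subtrees are replaced by untruncated ones.\<close>

lemma nn_integral_prune_size_le:
  assumes "f \<in> borel_measurable plane_space" and "f Leaf = 0"
  shows "(\<integral>\<^sup>+t. f (prune_plane t) * (if size t < n then 1 else 0) \<partial>G) \<le> (\<integral>\<^sup>+t. f (scale_plane 2 t) \<partial>G) / 2"
  using assms
proof (induction n arbitrary: f)
  case (Suc n)
  note [measurable] = Suc.prems(1)
  note f0 = Suc.prems(2)
  let ?s = "\<lambda>t :: real tree. (if size t < n then 1 else 0 :: ennreal)"
  let ?L = "\<lambda>t. (if prune_plane t = Leaf then 1 else 0 :: ennreal)"
  let ?F = "\<lambda>e x y. f (attach e x y)"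
  \<comment> \<open>\<open>h x\<close> averages f over a doubled tree whose root edge has been
    replaced by one of length x.\<close>
  define h where "h x = f (Node Leaf x Leaf) / 2 +
      (\<integral>\<^sup>+l. \<integral>\<^sup>+r. f (Node (scale_plane 2 l) x (scale_plane 2 r)) \<partial>G \<partial>G) / 2" for x
  have [measurable]: "h \<in> borel_measurable borel" unfolding h_def by measurable
  have ext: "(\<integral>\<^sup>+r. f (extend_root e (prune_plane r)) * ?s r \<partial>G) \<le> (\<integral>\<^sup>+x. h (e + 2 * x) \<partial>E) / 2" for e
    using Suc.IH[of "\<lambda>t. f (extend_root e t)"] f0
    by (simp add: nn_integral_scale_2 h_def)
  have inner: "(\<integral>\<^sup>+r. ?F e (prune_plane l) (prune_plane r) * ?s r \<partial>G) \<le>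
     ?L l * (f (Node Leaf e Leaf) / 2 + (\<integral>\<^sup>+x. h (e + 2 * x) \<partial>E) / 2) +
     (f (extend_root e (prune_plane l)) / 2 + (\<integral>\<^sup>+r. f (graft (prune_plane l) e (scale_plane 2 r)) \<partial>G) / 2)" for e l
  proof -
    have "(\<integral>\<^sup>+r. ?F e (prune_plane l) (prune_plane r) * ?s r \<partial>G) \<le>
      (\<integral>\<^sup>+r. ?L l * (?L r * f (Node Leaf e Leaf)) + ?L l * (f (extend_root e (prune_plane r)) * ?s r) +
        ?L r * f (extend_root e (prune_plane l)) + f (graft (prune_plane l) e (prune_plane r)) * ?s r \<partial>G)"
      by (intro nn_integral_mono) (auto simp: attach_decomposition[of f, OF f0])
    also have "\<dots> = ?L l * (1 / 2 * f (Node Leaf e Leaf)) +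
        ?L l * (\<integral>\<^sup>+r. f (extend_root e (prune_plane r)) * ?s r \<partial>G) +
        1 / 2 * f (extend_root e (prune_plane l)) +
        (\<integral>\<^sup>+r. f (graft (prune_plane l) e (prune_plane r)) * ?s r \<partial>G)"
      by (simp only: nn_integral_add nn_integral_cmult nn_integral_multc emeasure_prune_Leaf[symmetric]) (simp add: nn_integral_add nn_integral_cmult nn_integral_multc)
    also have "\<dots> \<le> ?L l * (1 / 2 * f (Node Leaf e Leaf)) + ?L l * ((\<integral>\<^sup>+x. h (e + 2 * x) \<partial>E) / 2) +
        1 / 2 * f (extend_root e (prune_plane l)) +
        (\<integral>\<^sup>+r. f (graft (prune_plane l) e (scale_plane 2 r)) \<partial>G) / 2"
      using f0 by (intro add_mono mult_left_mono ext Suc.IH order_refl) (auto simp: graft_def)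
    finally show ?thesis
      by (simp add: divide_ennreal_def distrib_left mult_ac add_ac)
  qed
  have graft: "(\<integral>\<^sup>+l. (\<integral>\<^sup>+r. f (graft (prune_plane l) e (scale_plane 2 r)) \<partial>G) * ?s l \<partial>G) \<le>
      (\<integral>\<^sup>+l. \<integral>\<^sup>+r. f (Node (scale_plane 2 l) e (scale_plane 2 r)) \<partial>G \<partial>G) / 2" for e
  proof -
    have "(\<integral>\<^sup>+l. (\<integral>\<^sup>+r. f (graft (prune_plane l) e (scale_plane 2 r)) \<partial>G) * ?s l \<partial>G) \<le>
      (\<integral>\<^sup>+l. \<integral>\<^sup>+r. f (graft (scale_plane 2 l) e (scale_plane 2 r)) \<partial>G \<partial>G) / 2"
      by (rule Suc.IH[of "\<lambda>l. \<integral>\<^sup>+r. f (graft l e (scale_plane 2 r)) \<partial>G"]) (auto simp: graft_def f0)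
    also have "\<dots> \<le> (\<integral>\<^sup>+l. \<integral>\<^sup>+r. f (Node (scale_plane 2 l) e (scale_plane 2 r)) \<partial>G \<partial>G) / 2"
      by (intro divide_right_mono_ennreal nn_integral_mono) (auto simp: graft_def f0)
    finally show ?thesis .
  qed
  have outer: "(\<integral>\<^sup>+l. (\<integral>\<^sup>+r. ?F e (prune_plane l) (prune_plane r) * ?s r \<partial>G) * ?s l \<partial>G) \<le>
      h e / 2 + (\<integral>\<^sup>+x. h (e + 2 * x) \<partial>E) / 2" for e
  proof -
    let ?c = "f (Node Leaf e Leaf) / 2 + (\<integral>\<^sup>+x. h (e + 2 * x) \<partial>E) / 2"
    let ?g = "\<lambda>l. (\<integral>\<^sup>+r. f (graft (prune_plane l) e (scale_plane 2 r)) \<partial>G)"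
    have "(\<integral>\<^sup>+l. (\<integral>\<^sup>+r. ?F e (prune_plane l) (prune_plane r) * ?s r \<partial>G) * ?s l \<partial>G) \<le>
      (\<integral>\<^sup>+l. ?L l * ?c + ((f (extend_root e (prune_plane l)) * ?s l) / 2 + (?g l * ?s l) / 2) \<partial>G)"
      using inner by (intro nn_integral_mono) (auto)
    also have "\<dots> = 1 / 2 * ?c + ((\<integral>\<^sup>+l. f (extend_root e (prune_plane l)) * ?s l \<partial>G) / 2 + (\<integral>\<^sup>+l. ?g l * ?s l \<partial>G) / 2)"
      by (simp add: divide_ennreal_def nn_integral_add nn_integral_multc emeasure_prune_Leaf)
    also have "\<dots> \<le> 1 / 2 * ?c + ((\<integral>\<^sup>+x. h (e + 2 * x) \<partial>E) / 2 / 2 +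
        (\<integral>\<^sup>+l. \<integral>\<^sup>+r. f (Node (scale_plane 2 l) e (scale_plane 2 r)) \<partial>G \<partial>G) / 2 / 2)"
      by (intro add_mono divide_right_mono_ennreal ext graft order_refl)
    \<comment> \<open>The terms for two vanishing and for two surviving subtrees add up to
      \<open>h e / 2\<close>; exactly one survivor, on the left or on the right, contributes a
      quarter of the integral each.\<close>
    also have "\<dots> = h e / 2 + ((\<integral>\<^sup>+x. h (e + 2 * x) \<partial>E) / 2 / 2 + (\<integral>\<^sup>+x. h (e + 2 * x) \<partial>E) / 2 / 2)"
      by (simp add: h_def divide_ennreal_def distrib_left distrib_right mult_ac add_ac)
    also have "(\<integral>\<^sup>+x. h (e + 2 * x) \<partial>E) / 2 / 2 + (\<integral>\<^sup>+x. h (e + 2 * x) \<partial>E) / 2 / 2 = (\<integral>\<^sup>+x. h (e + 2 * x) \<partial>E) / 2"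
    proof -
      have "inverse (2 :: ennreal) + inverse 2 = 1"
        unfolding ennreal_half[symmetric] by (subst ennreal_plus[symmetric]) auto
      then have "a / 2 + a / 2 = a" for a :: ennreal
        by (simp add: divide_ennreal_def distrib_left[symmetric])
      then show ?thesis .
    qed
    finally show ?thesis .
  qed
  have "(\<integral>\<^sup>+t. f (prune_plane t) * (if size t < Suc n then 1 else 0) \<partial>G) =
     (\<integral>\<^sup>+e. \<integral>\<^sup>+l. \<integral>\<^sup>+r. f (prune_plane (Node l e r)) * (if size (Node l e r) < Suc n then 1 else 0) \<partial>G \<partial>G \<partial>E) / 2"
    by (subst nn_integral_gw) (auto simp: f0)
  \<comment> \<open>A tree of size at most n has both subtrees of size less than n; truncating these
    separately is weaker and only enlarges the integral.\<close>
  also have "\<dots> \<le> (\<integral>\<^sup>+e. \<integral>\<^sup>+l. (\<integral>\<^sup>+r. ?F e (prune_plane l) (prune_plane r) * ?s r \<partial>G) * ?s l \<partial>G \<partial>E) / 2"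
  proof (rule divide_right_mono_ennreal, rule nn_integral_mono, rule nn_integral_mono_AE)
    fix e
    show "AE l in G. (\<integral>\<^sup>+r. f (prune_plane (Node l e r)) * (if size (Node l e r) < Suc n then 1 else 0) \<partial>G) \<le>
      (\<integral>\<^sup>+r. ?F e (prune_plane l) (prune_plane r) * ?s r \<partial>G) * ?s l"
      using AE_gw_not_Leaf
    proof eventually_elim
      case (elim l)
      show ?case
      proof (cases "size l < n")
        case True
        then show ?thesis using elim by (auto intro!: nn_integral_mono)
      qed simp
    qed
  qed
  also have "\<dots> \<le> (\<integral>\<^sup>+e. h e / 2 + (\<integral>\<^sup>+x. h (e + 2 * x) \<partial>E) / 2 \<partial>E) / 2"
    by (intro divide_right_mono_ennreal nn_integral_mono outer)
  also have "(\<integral>\<^sup>+e. h e / 2 + (\<integral>\<^sup>+x. h (e + 2 * x) \<partial>E) / 2 \<partial>E) = (\<integral>\<^sup>+e. h (2 * e) \<partial>E)"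
    by (rule nn_integral_E_mixture) measurable
  also have "\<dots> = (\<integral>\<^sup>+t. f (scale_plane 2 t) \<partial>G)"
    unfolding h_def by (subst nn_integral_gw) (auto simp: nn_integral_add divide_ennreal_def nn_integral_multc)
  finally show ?case .
qed simp

lemma nn_integral_prune_le:
  assumes [measurable]: "f \<in> borel_measurable plane_space" and f: "f Leaf = 0"
  shows "(\<integral>\<^sup>+t. f (prune_plane t) \<partial>G) \<le> (\<integral>\<^sup>+t. f (scale_plane 2 t) \<partial>G) / 2"
proof -
  let ?g = "\<lambda>n t. f (prune_plane t) * (if size t < n then 1 else 0)"
  have "f (prune_plane t) = (SUP n. ?g n t)" for t
    by (rule antisym) (auto intro!: SUP_upper2[of "Suc (size t)"] SUP_least)
  then have "(\<integral>\<^sup>+t. f (prune_plane t) \<partial>G) = (\<integral>\<^sup>+t. (SUP n. ?g n t) \<partial>G)" by simp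
  also have "\<dots> = (SUP n. \<integral>\<^sup>+t. ?g n t \<partial>G)"
    by (rule nn_integral_monotone_convergence_SUP) (auto simp: incseq_def le_fun_def)
  also have "\<dots> \<le> (\<integral>\<^sup>+t. f (scale_plane 2 t) \<partial>G) / 2"
    by (intro SUP_least nn_integral_prune_size_le assms)
  finally show ?thesis .
qed

text \<open>The inequality holds for A and for the nonempty trees outside A. The two right-hand
  sides add up to 1/2, and so do the two left-hand sides, as pruning empties the tree with
  probability 1/2. Hence both inequalities are equalities.\<close>

theorem emeasure_prune:
  assumes A: "A \<in> sets plane_space" and L: "Leaf \<notin> A"
  shows "emeasure G {t. prune_plane t \<in> A} = emeasure G {t. scale_plane 2 t \<in> A} / 2"
proof -
  have sets: "{t. prune_plane t \<in> B} \<in> sets plane_space" "{t. scale_plane 2 t \<in> B} \<in> sets plane_space"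
    if "B \<in> sets plane_space" for B
    using measurable_sets[OF measurable_prune_plane that] measurable_sets[OF measurable_scale_plane that, of 2]
    by (auto simp: vimage_def)
  have em: "emeasure G {t. g t \<in> B} = (\<integral>\<^sup>+t. indicator B (g t) \<partial>G)"
    if "{t. g t \<in> B} \<in> sets plane_space" for g :: "real tree \<Rightarrow> real tree" and B
  proof -
    have "(\<integral>\<^sup>+t. indicator B (g t) \<partial>G) = (\<integral>\<^sup>+t. indicator {t. g t \<in> B} t \<partial>G)"
      by (intro nn_integral_cong) (simp add: indicator_def)
    also have "\<dots> = emeasure G {t. g t \<in> B}"
      by (rule nn_integral_indicator) (use that in simp)
    finally show ?thesis ..
  qed
  have le: "measure G {t. prune_plane t \<in> B} \<le> measure G {t. scale_plane 2 t \<in> B} / 2"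
    if B [measurable]: "B \<in> sets plane_space" and "Leaf \<notin> B" for B
  proof -
    have "emeasure G {t. prune_plane t \<in> B} \<le> emeasure G {t. scale_plane 2 t \<in> B} / 2"
      unfolding em[OF sets(1)[OF B]] em[OF sets(2)[OF B]]
      by (rule nn_integral_prune_le) (use that(2) in auto)
    also have "\<dots> = ennreal (measure G {t. scale_plane 2 t \<in> B} / 2)"
      using divide_ennreal[of "measure G {t. scale_plane 2 t \<in> B}" 2] by (simp add: G.emeasure_eq_measure)
    finally show ?thesis by (simp add: G.emeasure_eq_measure)
  qed
  \<comment> \<open>\<open>Leaf\<close> is left out because the inequality is available for sets of
    nonempty trees only.\<close>
  define B where "B = UNIV - {Leaf} - A"
  have B: "B \<in> sets plane_space" "Leaf \<notin> B"
    using sets.Diff[OF sets.compl_sets[OF Leaf_in_tree_sigma] A] by (auto simp: B_def)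
  have leaf: "{Leaf} \<in> sets plane_space" by simp
  have "measure G {t. prune_plane t = Leaf} = 1 / 2"
  proof -
    have "emeasure G {t. prune_plane t \<in> {Leaf}} = 1 / 2"
      unfolding em[OF sets(1)[OF leaf]] emeasure_prune_Leaf[symmetric]
      by (intro nn_integral_cong) (auto simp: indicator_def)
    also have "1 / 2 = ennreal (1 / 2)" using divide_ennreal[of 1 2] by simp
    finally show ?thesis by (simp add: G.emeasure_eq_measure del: ennreal_half)
  qed
  moreover have split: "measure G {t. g t \<in> A} + measure G {t. g t \<in> B} = 1 - measure G {t. g t = Leaf}"
    if "\<And>A. A \<in> sets plane_space \<Longrightarrow> {t. g t \<in> A} \<in> sets plane_space" for g :: "real tree \<Rightarrow> real tree"
  proof -
    have "measure G {t. g t \<in> A} + measure G {t. g t \<in> B} = measure G ({t. g t \<in> A} \<union> {t. g t \<in> B})"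
    proof (rule G.finite_measure_Union[symmetric])
      show "{t. g t \<in> A} \<in> G.events" "{t. g t \<in> B} \<in> G.events"
        using that[OF A] that[OF B(1)] by simp_all
      show "{t. g t \<in> A} \<inter> {t. g t \<in> B} = {}" unfolding B_def by auto
    qed
    also have "{t. g t \<in> A} \<union> {t. g t \<in> B} = space G - {t. g t \<in> {Leaf}}"
      using L by (auto simp: B_def)
    also have "measure G \<dots> = 1 - measure G {t. g t \<in> {Leaf}}"
      using that[OF leaf] by (intro G.prob_compl) simp
    finally show ?thesis by simp
  qed
  have "measure G {t. scale_plane 2 t = Leaf} = 0"
  proof -
    have "{t. scale_plane 2 t = Leaf} \<in> G.events" using sets(2)[OF leaf] by simp
    moreover have "AE t in G. t \<notin> {t. scale_plane 2 t = Leaf}" using AE_gw_not_Leaf by simp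
    ultimately show ?thesis by (simp only: G.prob_eq_0)
  qed
  ultimately have "measure G {t. prune_plane t \<in> A} = measure G {t. scale_plane 2 t \<in> A} / 2"
    using split[OF sets(1)] split[OF sets(2)] le[OF A L] le[OF B] by linarith
  then show ?thesis
    using divide_ennreal[of "measure G {t. scale_plane 2 t \<in> A}" 2] by (simp add: G.emeasure_eq_measure)
qed

end

section \<open>Complete subtrees\<close>

text \<open>The search stops at the first vertex of order K on each path: orders do not increase
  downwards, so any further vertex of order K below it belongs to the same branch.\<close>

primrec plane_subtrees :: "nat \<Rightarrow> real tree \<Rightarrow> real utree multiset" where
  "plane_subtrees K Leaf = {#}"
| "plane_subtrees K (Node l e r) =
    (if strahler (Node l e r) = K then {#unordered (Node l e r)#} else plane_subtrees K l + plane_subtrees K r)"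

lemma plane_subtrees_small: "strahler t < K \<Longrightarrow> plane_subtrees K t = {#}"
  by (induction t) (auto split: if_splits)

text \<open>The exceptional case is a vertex of order K whose parent has order K too: it continues a
  branch, so neither it nor any of its descendants is the top of a branch of order K.\<close>

lemma filter_complete_from:
  "reduced_plane t \<Longrightarrow> {#S \<in># complete_from k t. tree_order S = K#} =
    (if strahler t = K \<and> k = K then {#} else plane_subtrees K t)"
proof (induction t arbitrary: k)
  case (Node l e r)
  let ?h = "strahler (Node l e r)"
  have o: "tree_order (unordered (Node l e r)) = ?h" by (rule tree_order_unordered[OF Node.prems])
  have IH: "{#S \<in># complete_from ?h l. tree_order S = K#} = (if strahler l = K \<and> ?h = K then {#} else plane_subtrees K l)"
    "{#S \<in># complete_from ?h r. tree_order S = K#} = (if strahler r = K \<and> ?h = K then {#} else plane_subtrees K r)"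
    using Node by auto
  have le: "strahler l \<le> ?h" "strahler r \<le> ?h" by auto
  have "{#S \<in># complete_from k (Node l e r). tree_order S = K#} =
    (if ?h \<noteq> k \<and> ?h = K then {#unordered (Node l e r)#} else {#}) +
    {#S \<in># complete_from ?h l. tree_order S = K#} + {#S \<in># complete_from ?h r. tree_order S = K#}"
    by (simp add: Let_def o del: strahler.simps)
  also have "\<dots> = (if ?h = K \<and> k = K then {#} else plane_subtrees K (Node l e r))"
  proof (cases "?h = K")
    case True
    have "(if strahler l = K \<and> ?h = K then {#} else plane_subtrees K l) = {#}"
      "(if strahler r = K \<and> ?h = K then {#} else plane_subtrees K r) = {#}"
      using le True plane_subtrees_small[of l K] plane_subtrees_small[of r K] by (auto simp del: strahler.simps)
    then show ?thesis unfolding IH using True by (simp del: strahler.simps)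
  next
    case False
    then show ?thesis unfolding IH by (simp del: strahler.simps)
  qed
  finally show ?case .
qed simp

lemma filter_complete_subtrees:
  "reduced_plane t \<Longrightarrow> 1 \<le> K \<Longrightarrow>
    {#S \<in># complete_subtrees (unordered t). tree_order S = K#} = plane_subtrees K t"
  by (simp add: complete_subtrees.abs_eq filter_complete_from)

text \<open>
  The skeleton of a tree forgets everything below the tops of its complete subtrees of order \<open>K\<close>.
  Given the skeleton, these subtrees are independent copies of the tree conditioned to have order \<open>K\<close>.
\<close>

primrec skeleton :: "nat \<Rightarrow> real tree \<Rightarrow> nat tree" where
  "skeleton K Leaf = Leaf"
| "skeleton K (Node l e r) =
    (if strahler (Node l e r) \<le> K then Node Leaf (strahler (Node l e r)) Leaf
     else Node (skeleton K l) (strahler (Node l e r)) (skeleton K r))"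

primrec marks :: "nat \<Rightarrow> nat tree \<Rightarrow> nat" where
  "marks K Leaf = 0"
| "marks K (Node l k r) = (if k = K then 1 else marks K l + marks K r)"

definition root_order :: "nat tree \<Rightarrow> nat" where
  "root_order s = (case s of Leaf \<Rightarrow> 0 | Node _ k _ \<Rightarrow> k)"

lemma root_order_skeleton [simp]: "root_order (skeleton K t) = strahler t"
  by (cases t) (auto simp: root_order_def)

lemma size_plane_subtrees: "size (plane_subtrees K t) = marks K (skeleton K t)"
proof (induction t)
  case (Node l e r)
  show ?case
  proof (cases "strahler (Node l e r) < K")
    case True
    then show ?thesis using plane_subtrees_small[OF True] by (simp del: strahler.simps plane_subtrees.simps)
  next
    case False
    then show ?thesis using Node by (simp del: strahler.simps)
  qed
qed simp

lemma marks_pos: "1 \<le> K \<Longrightarrow> K \<le> strahler t \<Longrightarrow> 1 \<le> marks K (skeleton K t)"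
proof (induction t)
  case (Node l e r)
  show ?case
  proof (cases "strahler (Node l e r) = K")
    case False
    then have "K < strahler (Node l e r)" using Node.prems by simp
    then have "K \<le> strahler l \<or> K \<le> strahler r" by (auto split: if_splits)
    then have "1 \<le> marks K (skeleton K l) \<or> 1 \<le> marks K (skeleton K r)" using Node by blast
    then show ?thesis using False \<open>K < strahler (Node l e r)\<close> by (auto simp del: strahler.simps)
  qed (simp del: strahler.simps)
qed simp

lemma skeleton_plane_shape:
  "\<exists>g. \<forall>t. skeleton K t = g (plane_shape t)"
proof -
  have "plane_shape s = plane_shape t \<Longrightarrow> skeleton K s = skeleton K t" for s t
  proof (induction s arbitrary: t)
    case (Node l e r)
    then obtain l' e' r' where t: "t = Node l' e' r'" "plane_shape l = plane_shape l'" "plane_shape r = plane_shape r'"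
      by (cases t) auto
    have "strahler l = strahler l'" "strahler r = strahler r'"
      using t strahler_plane_shape by metis+
    then have "strahler (Node l e r) = strahler t" by (simp add: t)
    then show ?case using Node.IH(1)[OF t(2)] Node.IH(2)[OF t(3)] by (simp add: t(1) del: strahler.simps)
  qed (cases t; simp)
  then have "skeleton K t = (\<lambda>s. skeleton K (SOME t. plane_shape t = s)) (plane_shape t)" for t
    by (metis (mono_tags, lifting) someI)
  then show ?thesis by (intro exI[of _ "\<lambda>s. skeleton K (SOME t. plane_shape t = s)"]) simp
qed

lemma measurable_skeleton [measurable]: "skeleton K \<in> plane_space \<rightarrow>\<^sub>M count_space UNIV"
  using skeleton_plane_shape[of K] measurable_of_plane_shape[of "skeleton K"] by blast

definition hits :: "nat \<Rightarrow> real utree set \<Rightarrow> real tree \<Rightarrow> nat" where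
  "hits K A t = size {#S \<in># plane_subtrees K t. S \<in> A#}"

lemma hits_simps [simp]:
  "hits K A Leaf = 0"
  "hits K A (Node l e r) = (if strahler (Node l e r) = K then (if unordered (Node l e r) \<in> A then 1 else 0)
     else hits K A l + hits K A r)"
  by (simp_all add: hits_def)

lemma measurable_hits [measurable]:
  assumes "A \<in> sets utree_space"
  shows "hits K A \<in> plane_space \<rightarrow>\<^sub>M count_space UNIV"
proof -
  have [measurable]: "Measurable.pred plane_space (\<lambda>t. unordered t \<in> A)"
    using assms by (simp add: sets_utree_space vimage_def pred_def)
  have eq: "hits K A t = rec_tree 0 (\<lambda>l v r al ar. if strahler (Node l v r) = K then
      (if unordered (Node l v r) \<in> A then 1 else 0) else al + ar) t" for t
    by (induction t) (simp_all del: strahler.simps)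
  have [measurable]: "(\<lambda>w. strahler (f w)) \<in> M \<rightarrow>\<^sub>M count_space UNIV"
    "Measurable.pred M (\<lambda>w. unordered (f w) \<in> A)" if "f \<in> M \<rightarrow>\<^sub>M plane_space"
    for f :: "real tree \<times> real tree \<times> real \<times> real tree \<times> nat \<times> nat \<Rightarrow> real tree" and M
    using measurable_compose[OF that measurable_strahler]
      measurable_compose[OF that, of "\<lambda>t. unordered t \<in> A"] by simp_all
  show ?thesis unfolding eq by measurable
qed

text \<open>The selection kernel has to be measurable on all trees, including unreduced ones, for
  which the recursion for \<open>strahler\<close> does not describe \<open>tree_order\<close>. On
  each of the countably many shapes all orders are constants, and only membership in A
  varies.\<close>

lemma complete_from_shape:
  assumes A: "A \<in> sets utree_space"
  shows "\<exists>g \<in> plane_space \<rightarrow>\<^sub>M count_space UNIV. \<forall>t. plane_shape t = s \<longrightarrow>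
    size {#S \<in># complete_from k t. tree_order S = K \<and> S \<in> A#} = g t"
proof (induction s arbitrary: k)
  case Leaf
  show ?case by (intro bexI[of _ "\<lambda>_. 0"]) auto
next
  case (Node s1 u s2)
  define h where "h = tree_order (unordered (Node s1 u s2))"
  from Node.IH(1)[of h] obtain g1 where g1 [measurable]: "g1 \<in> plane_space \<rightarrow>\<^sub>M count_space UNIV"
    "\<And>t. plane_shape t = s1 \<Longrightarrow> size {#S \<in># complete_from h t. tree_order S = K \<and> S \<in> A#} = g1 t" by blast
  from Node.IH(2)[of h] obtain g2 where g2 [measurable]: "g2 \<in> plane_space \<rightarrow>\<^sub>M count_space UNIV"
    "\<And>t. plane_shape t = s2 \<Longrightarrow> size {#S \<in># complete_from h t. tree_order S = K \<and> S \<in> A#} = g2 t" by blast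
  have [measurable]: "Measurable.pred plane_space (\<lambda>t. unordered t \<in> A)"
    using A by (simp add: sets_utree_space vimage_def pred_def)
  define g where "g t = (if h \<noteq> k \<and> h = K then (if unordered t \<in> A then 1 else 0) else 0) +
    (case t of Leaf \<Rightarrow> 0 | Node l e r \<Rightarrow> g1 l + g2 r)" for t
  have "g \<in> plane_space \<rightarrow>\<^sub>M count_space UNIV" unfolding g_def by measurable
  moreover have "size {#S \<in># complete_from k t. tree_order S = K \<and> S \<in> A#} = g t"
    if t: "plane_shape t = Node s1 u s2" for t
  proof -
    obtain l e r where lr: "t = Node l e r" "plane_shape l = s1" "plane_shape r = s2"
      using t by (cases t) auto
    have "tree_order (unordered t) = tree_order (shape (unordered t))" by simp
    also have "\<dots> = h" by (simp only: shape_unordered t h_def)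
    finally have o: "tree_order (unordered (Node l e r)) = h" by (simp add: lr)
    show ?thesis using g1(2)[OF lr(2)] g2(2)[OF lr(3)]
      by (auto simp: lr(1) Let_def o g_def)
  qed
  ultimately show ?case by blast
qed

lemma measurable_complete_subtrees:
  assumes A: "A \<in> sets utree_space"
  shows "(\<lambda>T. size {#S \<in># complete_subtrees T. tree_order S = K \<and> S \<in> A#}) \<in> utree_space \<rightarrow>\<^sub>M count_space UNIV"
proof -
  have "\<forall>s. \<exists>g. g \<in> plane_space \<rightarrow>\<^sub>M count_space UNIV \<and> (\<forall>t. plane_shape t = s \<longrightarrow>
      size {#S \<in># complete_from 0 t. tree_order S = K \<and> S \<in> A#} = g t)"
    using complete_from_shape[OF A] unfolding Bex_def by (intro allI)
  then have "\<exists>g. \<forall>s. g s \<in> plane_space \<rightarrow>\<^sub>M count_space UNIV \<and> (\<forall>t. plane_shape t = s \<longrightarrow>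
      size {#S \<in># complete_from 0 t. tree_order S = K \<and> S \<in> A#} = g s t)"
    by (rule choice)
  then obtain g where [measurable]: "\<And>s. g s \<in> plane_space \<rightarrow>\<^sub>M count_space UNIV"
    and g: "\<And>s t. plane_shape t = s \<Longrightarrow> size {#S \<in># complete_from 0 t. tree_order S = K \<and> S \<in> A#} = g s t"
    by blast
  have "(\<lambda>t. g (plane_shape t) t) \<in> plane_space \<rightarrow>\<^sub>M count_space UNIV"
    by (rule measurable_compose_countable[where f = g and g = plane_shape]) measurable
  then show ?thesis using g by (simp add: measurable_utree_iff complete_subtrees.abs_eq)
qed

lemma emeasure_pmf_of_multiset:
  assumes M: "M \<noteq> {#}"
  shows "emeasure (measure_pmf (pmf_of_multiset M)) A = ennreal (real (size {#x \<in># M. x \<in> A#}) / real (size M))"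
proof -
  have "measure (measure_pmf (pmf_of_multiset M)) A = (\<Sum>x\<in>A \<inter> set_mset M. count M x / size M)"
    using M measure_Int_set_pmf[of "pmf_of_multiset M" A]
    by (simp add: measure_measure_pmf_finite Int_commute)
  also have "\<dots> = (\<Sum>x\<in>A \<inter> set_mset M. real (count M x)) / size M"
    by (simp add: sum_divide_distrib)
  also have "(\<Sum>x\<in>A \<inter> set_mset M. real (count M x)) = real (size {#x \<in># M. x \<in> A#})"
    by (auto simp: size_multiset_overloaded_eq intro!: sum.cong)
  finally show ?thesis by (simp add: measure_pmf.emeasure_eq_measure)
qed

definition subtree_kernel :: "nat \<Rightarrow> real utree \<Rightarrow> real utree measure" where
  "subtree_kernel K T =
     distr (measure_pmf (pmf_of_multiset {#S \<in># complete_subtrees T. tree_order S = K#})) utree_space (\<lambda>S. S)"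

lemma measurable_subtree_kernel [measurable]: "subtree_kernel K \<in> utree_space \<rightarrow>\<^sub>M subprob_algebra utree_space"
proof (rule measurable_subprob_algebra)
  fix T :: "real utree"
  show "subprob_space (subtree_kernel K T)" unfolding subtree_kernel_def
    by (intro prob_space_imp_subprob_space measure_pmf.prob_space_distr) simp
  show "sets (subtree_kernel K T) = sets utree_space" by (simp add: subtree_kernel_def)
next
  fix A :: "real utree set" assume A: "A \<in> sets utree_space"
  have U: "UNIV \<in> sets utree_space" using sets.top[of utree_space] by simp
  let ?n = "\<lambda>B T. size {#S \<in># complete_subtrees T. tree_order S = K \<and> S \<in> B#}"
  note [measurable] = measurable_complete_subtrees[OF A, of K] measurable_complete_subtrees[OF U, of K]
  \<comment> \<open>Without complete subtrees of order K the uniform choice is unspecified, but it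
    is the same for all such trees and hence a measurable constant.\<close>
  have eq: "emeasure (subtree_kernel K T) A =
    (if ?n UNIV T = 0 then emeasure (measure_pmf (pmf_of_multiset {#})) A else ennreal (real (?n A T) / real (?n UNIV T)))" for T
  proof -
    define M where "M = {#S \<in># complete_subtrees T. tree_order S = K#}"
    have n: "?n B T = size {#S \<in># M. S \<in> B#}" for B
      by (simp add: M_def filter_filter_mset conj_commute)
    have "emeasure (subtree_kernel K T) A = emeasure (measure_pmf (pmf_of_multiset M)) A"
      unfolding subtree_kernel_def M_def using A by (subst emeasure_distr) auto
    then show ?thesis unfolding n
      by (cases "M = {#}") (simp_all add: emeasure_pmf_of_multiset)
  qed
  show "(\<lambda>T. emeasure (subtree_kernel K T) A) \<in> borel_measurable utree_space"
    unfolding eq by measurable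
qed

lemma emeasure_subtree_kernel:
  assumes "reduced_plane t" "1 \<le> K" "K \<le> strahler t" "A \<in> sets utree_space"
  shows "emeasure (subtree_kernel K (unordered t)) A = of_nat (hits K A t) / of_nat (marks K (skeleton K t))"
proof -
  have ne: "plane_subtrees K t \<noteq> {#}"
    using marks_pos[OF assms(2,3)] size_plane_subtrees[of K t] by auto
  have "emeasure (subtree_kernel K (unordered t)) A = emeasure (measure_pmf (pmf_of_multiset (plane_subtrees K t))) A"
    unfolding subtree_kernel_def filter_complete_subtrees[OF assms(1,2)]
    using assms(4) by (subst emeasure_distr) auto
  also have "\<dots> = ennreal (real (hits K A t) / real (marks K (skeleton K t)))"
    using emeasure_pmf_of_multiset[OF ne] by (simp add: hits_def size_plane_subtrees)
  also have "\<dots> = ennreal (real (hits K A t)) / ennreal (real (marks K (skeleton K t)))"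
    using marks_pos[OF assms(2,3)] by (intro divide_ennreal[symmetric]) auto
  finally show ?thesis by (simp add: ennreal_of_nat_eq_real_of_nat)
qed

section \<open>Law of the complete subtrees given the skeleton\<close>

context galton_watson begin

abbreviation order_mass :: "nat \<Rightarrow> ennreal" where
  "order_mass K \<equiv> \<integral>\<^sup>+t. (if strahler t = K then 1 else 0) \<partial>G"

text \<open>Cleared of denominators: given the skeleton, the expected number of complete subtrees in
  A is the number of marks times the probability of A given order K. Only expectations are compared,
  and these are additive over the two subtrees at the root, so the recursion closes without
  mentioning the joint law of the complete subtrees.\<close>

lemma nn_integral_hits:
  assumes A [measurable]: "A \<in> sets utree_space" and K: "1 \<le> K"
  shows "(\<integral>\<^sup>+t. (if skeleton K t = \<sigma> then of_nat (hits K A t) else 0) \<partial>G) * order_mass K =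
    of_nat (marks K \<sigma>) * (\<integral>\<^sup>+t. (if skeleton K t = \<sigma> then 1 else 0) \<partial>G) *
    (\<integral>\<^sup>+t. (if strahler t = K \<and> unordered t \<in> A then 1 else 0) \<partial>G)"
proof (induction \<sigma>)
  case Leaf
  have "(if skeleton K t = Leaf then of_nat (hits K A t) else 0) = (0 :: ennreal)" for t
    by (cases t) auto
  then show ?case by simp
next
  case (Node \<sigma>1 k \<sigma>2)
  let ?\<sigma> = "Node \<sigma>1 k \<sigma>2"
  let ?I = "\<lambda>\<sigma>. \<integral>\<^sup>+t. (if skeleton K t = \<sigma> then of_nat (hits K A t) else 0) \<partial>G"
  let ?g = "\<lambda>\<sigma>. \<integral>\<^sup>+t. (if skeleton K t = \<sigma> then 1 else 0 :: ennreal) \<partial>G"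
  let ?q = "\<integral>\<^sup>+t. (if strahler t = K \<and> unordered t \<in> A then 1 else 0) \<partial>G"
  have label: "strahler t = k" if "skeleton K t = ?\<sigma>" for t
    using that root_order_skeleton[of K t] by (simp add: root_order_def)
  have small: "\<sigma>1 = Leaf \<and> \<sigma>2 = Leaf" if "skeleton K t = ?\<sigma>" "k \<le> K" for t
    using that label[OF that(1)] by (cases t) (auto simp del: strahler.simps)
  have [measurable]: "Measurable.pred plane_space (\<lambda>t. unordered t \<in> A)"
    using A by (simp add: sets_utree_space vimage_def pred_def)
  \<comment> \<open>Labels up to K occur only at leaves of a skeleton. So \<open>none\<close> is
    unattainable, \<open>below\<close> has neither hits nor marks, \<open>top\<close> is itself one
    complete subtree, and \<open>above\<close> is the recursive case.\<close>
  consider (none) "k \<le> K" "\<not> (\<sigma>1 = Leaf \<and> \<sigma>2 = Leaf)" | (below) "k < K" "\<sigma>1 = Leaf" "\<sigma>2 = Leaf"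
    | (top) "k = K" "\<sigma>1 = Leaf" "\<sigma>2 = Leaf" | (above) "K < k" by fastforce
  then show ?case
  proof cases
    case none
    then have "skeleton K t \<noteq> ?\<sigma>" for t using small by blast
    then show ?thesis by simp
  next
    case below
    have z: "(if skeleton K t = ?\<sigma> then of_nat (hits K A t) else 0) = (0 :: ennreal)" for t
      using label[of t] below(1) plane_subtrees_small[of t K] by (auto simp: hits_def)
    show ?thesis unfolding z using below by simp
  next
    case top
    have iff: "skeleton K t = ?\<sigma> \<longleftrightarrow> strahler t = K" for t
      using K top label[of t] by (cases t) (auto simp del: strahler.simps(2))
    have I: "(if skeleton K t = ?\<sigma> then of_nat (hits K A t) else 0) =
      (if strahler t = K \<and> unordered t \<in> A then 1 else 0 :: ennreal)" for t
      unfolding iff using K by (cases t) (auto simp del: strahler.simps(2))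
    have "marks K ?\<sigma> = 1" using top by simp
    then show ?thesis unfolding I unfolding iff by (simp only: of_nat_1 mult_1 mult.commute)
  next
    case above
    \<comment> \<open>Records whether the label k is the order forced by the two subtrees; if not,
      the skeleton is unattainable and both sides vanish.\<close>
    define ok :: ennreal where "ok = (if k = (if root_order \<sigma>1 = root_order \<sigma>2 then Suc (root_order \<sigma>1)
        else max (root_order \<sigma>1) (root_order \<sigma>2)) then 1 else 0)"
    have leaf: "skeleton K (Node Leaf e Leaf) \<noteq> ?\<sigma>" for e
      using above K by auto
    have iff: "skeleton K (Node l e r) = ?\<sigma> \<longleftrightarrow> skeleton K l = \<sigma>1 \<and> skeleton K r = \<sigma>2 \<and> ok = 1" for l e r
    proof -
      have "skeleton K (Node l e r) = ?\<sigma> \<longleftrightarrow>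
          skeleton K l = \<sigma>1 \<and> skeleton K r = \<sigma>2 \<and> strahler (Node l e r) = k"
        using above by (auto simp del: strahler.simps split: if_splits)
      also have "\<dots> \<longleftrightarrow> skeleton K l = \<sigma>1 \<and> skeleton K r = \<sigma>2 \<and> ok = 1"
        by (auto simp: ok_def)
      finally show ?thesis .
    qed
    have ok01: "ok = 0 \<or> ok = 1" by (simp add: ok_def)
    have g: "?g ?\<sigma> = ok * (?g \<sigma>1 * ?g \<sigma>2) / 2"
    proof -
      have "?g ?\<sigma> = (\<integral>\<^sup>+e. \<integral>\<^sup>+l. \<integral>\<^sup>+r. (if skeleton K (Node l e r) = ?\<sigma> then 1 else 0) \<partial>G \<partial>G \<partial>E) / 2"
        by (subst nn_integral_gw) (simp_all add: leaf del: skeleton.simps)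
      also have "(\<integral>\<^sup>+e. \<integral>\<^sup>+l. \<integral>\<^sup>+r. (if skeleton K (Node l e r) = ?\<sigma> then 1 else 0) \<partial>G \<partial>G \<partial>E) =
        (\<integral>\<^sup>+(e::real). \<integral>\<^sup>+l. \<integral>\<^sup>+r. ok * ((if skeleton K l = \<sigma>1 then 1 else 0) * (if skeleton K r = \<sigma>2 then 1 else 0)) \<partial>G \<partial>G \<partial>E)"
        unfolding iff using ok01 by (intro nn_integral_cong) auto
      also have "\<dots> = ok * (?g \<sigma>1 * ?g \<sigma>2)"
        by (simp add: nn_integral_cmult nn_integral_multc)
      finally show ?thesis .
    qed
    have I: "?I ?\<sigma> = ok * (?I \<sigma>1 * ?g \<sigma>2 + ?g \<sigma>1 * ?I \<sigma>2) / 2"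
    proof -
      have "?I ?\<sigma> = (\<integral>\<^sup>+e. \<integral>\<^sup>+l. \<integral>\<^sup>+r. (if skeleton K (Node l e r) = ?\<sigma> then of_nat (hits K A (Node l e r)) else 0) \<partial>G \<partial>G \<partial>E) / 2"
        by (subst nn_integral_gw) (simp_all add: leaf del: skeleton.simps hits_simps)
      also have "(\<integral>\<^sup>+e. \<integral>\<^sup>+l. \<integral>\<^sup>+r. (if skeleton K (Node l e r) = ?\<sigma> then of_nat (hits K A (Node l e r)) else 0) \<partial>G \<partial>G \<partial>E) =
        (\<integral>\<^sup>+(e::real). \<integral>\<^sup>+l. \<integral>\<^sup>+r. ok * ((if skeleton K l = \<sigma>1 then of_nat (hits K A l) else 0) * (if skeleton K r = \<sigma>2 then 1 else 0) +
          (if skeleton K l = \<sigma>1 then 1 else 0) * (if skeleton K r = \<sigma>2 then of_nat (hits K A r) else 0)) \<partial>G \<partial>G \<partial>E)"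
      proof (intro nn_integral_cong)
        fix e :: real and l r
        show "(if skeleton K (Node l e r) = ?\<sigma> then of_nat (hits K A (Node l e r)) else 0) =
          ok * ((if skeleton K l = \<sigma>1 then of_nat (hits K A l) else 0) * (if skeleton K r = \<sigma>2 then 1 else 0) +
          (if skeleton K l = \<sigma>1 then 1 else 0) * (if skeleton K r = \<sigma>2 then of_nat (hits K A r) else 0))"
        proof (cases "skeleton K (Node l e r) = ?\<sigma>")
          case True
          have "strahler (Node l e r) \<noteq> K" using label[OF True] above by simp
          then show ?thesis using True unfolding iff by (simp del: strahler.simps)
        next
          case False
          then show ?thesis unfolding iff using ok01 by auto
        qed
      qed
      also have "\<dots> = ok * (?I \<sigma>1 * ?g \<sigma>2 + ?g \<sigma>1 * ?I \<sigma>2)"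
        by (simp add: nn_integral_add nn_integral_cmult nn_integral_multc)
      finally show ?thesis .
    qed
    have "?I ?\<sigma> * order_mass K = ok * ((?I \<sigma>1 * order_mass K) * ?g \<sigma>2 + ?g \<sigma>1 * (?I \<sigma>2 * order_mass K)) / 2"
      unfolding I by (simp add: divide_ennreal_def distrib_left distrib_right mult_ac)
    also have "\<dots> = of_nat (marks K ?\<sigma>) * ?g ?\<sigma> * ?q"
      unfolding Node.IH g using above by (simp add: divide_ennreal_def distrib_left distrib_right mult_ac)
    finally show ?thesis .
  qed
qed

text \<open>Two subtrees of order K at the end of the root edge give a tree of order K + 1.
  Positivity makes conditioning on every order meaningful.\<close>

lemma order_mass_pos: "1 \<le> K \<Longrightarrow> order_mass K \<noteq> 0"
proof (induction K rule: nat_induct_at_least)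
  case base
  have "1 / 2 \<le> order_mass 1"
    by (subst nn_integral_gw) simp_all
  then show ?case by (auto simp: divide_ennreal_def)
next
  case (Suc K)
  have "order_mass K * order_mass K / 2 = (\<integral>\<^sup>+(e :: real). \<integral>\<^sup>+l. \<integral>\<^sup>+r.
      (if strahler l = K then 1 else 0) * (if strahler r = K then 1 else 0) \<partial>G \<partial>G \<partial>E) / 2"
    by (simp add: nn_integral_cmult nn_integral_multc)
  also have "\<dots> \<le> (\<integral>\<^sup>+e. \<integral>\<^sup>+l. \<integral>\<^sup>+r. (if strahler (Node l e r) = Suc K then 1 else 0) \<partial>G \<partial>G \<partial>E) / 2"
    by (intro divide_right_mono_ennreal nn_integral_mono) auto
  also have "\<dots> \<le> order_mass (Suc K)"
    by (subst nn_integral_gw) simp_all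
  finally show ?case using Suc.IH by (auto simp: divide_ennreal_def)
qed

lemma order_mass_eq: "order_mass K = emeasure P {T. tree_order T = K}"
proof -
  have "emeasure P {T. tree_order T = K} = (\<integral>\<^sup>+T. indicator {T. tree_order T = K} T \<partial>P)" by simp
  also have "\<dots> = (\<integral>\<^sup>+t. indicator {T. tree_order T = K} (unordered t) \<partial>G)"
    by (rule nn_integral_P) measurable
  also have "\<dots> = order_mass K"
  proof (rule nn_integral_cong_AE)
    show "AE t in G. indicator {T. tree_order T = K} (unordered t) = (if strahler t = K then 1 else 0 :: ennreal)"
      using AE_gw_positive
      by eventually_elim (auto simp: indicator_def tree_order_unordered positive_plane_def)
  qed
  finally show ?thesis ..
qed

text \<open>On one skeleton the uniform choice amounts to division by the constant number of marks,
  which cancels the factor from \<open>nn_integral_hits\<close>. What remains is the conditional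
  probability of A given order K, the same for all skeletons, so averaging over the skeletons of
  root order H does not change it.\<close>

theorem complete_subtree_law_eq:
  assumes K: "1 \<le> K" "K \<le> H"
  shows "complete_subtree_law (given_order P H) K = given_order P K"
proof (rule measure_eqI)
  have sg: "sets (given_order P H) = sets utree_space" for H by (simp add: given_order_def)
  have kernel: "subtree_kernel K \<in> given_order P H \<rightarrow>\<^sub>M subprob_algebra utree_space"
    using measurable_subtree_kernel by (simp add: sg cong: measurable_cong_sets)
  have law: "complete_subtree_law (given_order P H) K = given_order P H \<bind> subtree_kernel K"
    by (simp add: complete_subtree_law_def subtree_kernel_def[abs_def])
  have sp: "space (given_order P H) \<noteq> {}" by (simp add: given_order_def)
  show s: "sets (complete_subtree_law (given_order P H) K) = sets (given_order P K)"
    unfolding law sg by (rule sets_bind) (use sp in \<open>auto simp: subtree_kernel_def\<close>)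
  fix A assume "A \<in> sets (complete_subtree_law (given_order P H) K)"
  then have A [measurable]: "A \<in> sets utree_space" using s sg by simp
  let ?q = "\<integral>\<^sup>+t. (if strahler t = K \<and> unordered t \<in> A then 1 else 0) \<partial>G"
  let ?I = "\<lambda>\<sigma>. \<integral>\<^sup>+t. (if skeleton K t = \<sigma> then of_nat (hits K A t) else 0) \<partial>G"
  let ?g = "\<lambda>\<sigma>. \<integral>\<^sup>+t. (if skeleton K t = \<sigma> then 1 else 0 :: ennreal) \<partial>G"
  have [measurable]: "Measurable.pred plane_space (\<lambda>t. unordered t \<in> A)"
    using A by (simp add: sets_utree_space vimage_def pred_def)
  have H: "1 \<le> H" using K by simp
  have pos: "order_mass K \<noteq> 0" "order_mass H \<noteq> 0" by (rule order_mass_pos[OF K(1)] order_mass_pos[OF H])+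
  have fin: "order_mass k < \<top>" for k unfolding order_mass_eq by (simp add: P.emeasure_eq_measure)
  have em: "emeasure (subtree_kernel K (unordered t)) A * indicator {T. tree_order T = H} (unordered t) =
      (if strahler t = H then of_nat (hits K A t) / of_nat (marks K (skeleton K t)) else 0)"
    if "positive_plane t" for t
    using that emeasure_subtree_kernel[of t K A] K A
    by (auto simp: positive_plane_def tree_order_unordered indicator_def)
  have fibre: "(\<integral>\<^sup>+t. (if skeleton K t = \<sigma> then (if strahler t = H then of_nat (hits K A t) / of_nat (marks K (skeleton K t)) else 0) else 0) \<partial>G) =
     (\<integral>\<^sup>+t. (if skeleton K t = \<sigma> then (if strahler t = H then ?q / order_mass K else 0) else 0) \<partial>G)" for \<sigma>
  \<comment> \<open>An actual tree with this skeleton guarantees at least one mark to divide by; for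
    unattainable skeletons or other root orders both integrands vanish.\<close>
  proof (cases "root_order \<sigma> = H \<and> (\<exists>t. skeleton K t = \<sigma>)")
    case True
    then obtain t0 where t0: "skeleton K t0 = \<sigma>" "root_order \<sigma> = H" by blast
    then have "strahler t0 = H" by auto
    then have m: "1 \<le> marks K \<sigma>" using marks_pos[OF K(1), of t0] K(2) t0(1) by simp
    have st: "strahler t = H" if "skeleton K t = \<sigma>" for t using that t0(2) by auto
    have "(\<integral>\<^sup>+t. (if skeleton K t = \<sigma> then (if strahler t = H then of_nat (hits K A t) / of_nat (marks K (skeleton K t)) else 0) else 0) \<partial>G) =
      (\<integral>\<^sup>+t. (if skeleton K t = \<sigma> then of_nat (hits K A t) else 0) / of_nat (marks K \<sigma>) \<partial>G)"
      by (intro nn_integral_cong) (auto simp: st)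
    also have "\<dots> = ?I \<sigma> / of_nat (marks K \<sigma>)"
      by (simp add: divide_ennreal_def nn_integral_multc)
    also have "\<dots> = ?g \<sigma> * (?q / order_mass K)"
    proof -
      have "?I \<sigma> = ?I \<sigma> * order_mass K / order_mass K"
        using pos(1) fin[of K] by (intro ennreal_mult_divide_eq[symmetric]) auto
      also have "\<dots> = of_nat (marks K \<sigma>) * (?g \<sigma> * (?q / order_mass K))"
        unfolding nn_integral_hits[OF A K(1)] by (simp add: divide_ennreal_def mult_ac)
      finally show ?thesis using m
        by (simp add: mult.commute[of "of_nat (marks K \<sigma>)"] ennreal_mult_divide_eq)
    qed
    also have "\<dots> = (\<integral>\<^sup>+t. (if skeleton K t = \<sigma> then 1 else 0) * (?q / order_mass K) \<partial>G)"
      by (simp add: nn_integral_multc)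
    also have "\<dots> = (\<integral>\<^sup>+t. (if skeleton K t = \<sigma> then (if strahler t = H then ?q / order_mass K else 0) else 0) \<partial>G)"
      by (intro nn_integral_cong) (auto simp: st)
    finally show ?thesis .
  next
    case False
    then have "\<not> (skeleton K t = \<sigma> \<and> strahler t = H)" for t by auto
    then show ?thesis by (intro nn_integral_cong) auto
  qed
  have "emeasure (complete_subtree_law (given_order P H) K) A =
      (\<integral>\<^sup>+T. emeasure (subtree_kernel K T) A \<partial>given_order P H)"
    unfolding law by (rule emeasure_bind[OF sp kernel A])
  also have "\<dots> = (\<integral>\<^sup>+T. emeasure (subtree_kernel K T) A * indicator {T. tree_order T = H} T \<partial>P) / order_mass H"
    unfolding given_order_def order_mass_eq
    by (rule nn_integral_uniform_measure) (use A in measurable)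
  also have "(\<integral>\<^sup>+T. emeasure (subtree_kernel K T) A * indicator {T. tree_order T = H} T \<partial>P) =
      (\<integral>\<^sup>+t. emeasure (subtree_kernel K (unordered t)) A * indicator {T. tree_order T = H} (unordered t) \<partial>G)"
    by (rule nn_integral_P) (use A in measurable)
  also have "\<dots> = (\<integral>\<^sup>+t. (if strahler t = H then of_nat (hits K A t) / of_nat (marks K (skeleton K t)) else 0) \<partial>G)"
    by (intro nn_integral_cong_AE eventually_mono[OF AE_gw_positive] em)
  also have "\<dots> = (\<integral>\<^sup>+t. (if strahler t = H then ?q / order_mass K else 0) \<partial>G)"
    by (subst (1 2) nn_integral_fibres[OF G.sigma_finite_measure_axioms, where h = "skeleton K"])
      (simp_all add: fibre)
  also have "\<dots> = (\<integral>\<^sup>+t. (if strahler t = H then 1 else 0) * (?q / order_mass K) \<partial>G)"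
    by (intro nn_integral_cong) auto
  also have "\<dots> = order_mass H * (?q / order_mass K)"
    by (rule nn_integral_multc) measurable
  also have "\<dots> / order_mass H = ?q / order_mass K"
    using pos(2) fin[of H] by (simp add: mult.commute[of "order_mass H"] ennreal_mult_divide_eq)
  also have "?q = emeasure P ({T. tree_order T = K} \<inter> A)"
  proof -
    have "emeasure P ({T. tree_order T = K} \<inter> A) = (\<integral>\<^sup>+T. indicator ({T. tree_order T = K} \<inter> A) T \<partial>P)"
      using A by (subst nn_integral_indicator) auto
    also have "\<dots> = (\<integral>\<^sup>+t. indicator ({T. tree_order T = K} \<inter> A) (unordered t) \<partial>G)"
      by (rule nn_integral_P) measurable
    also have "\<dots> = ?q"
    proof (rule nn_integral_cong_AE)
      show "AE t in G. indicator ({T. tree_order T = K} \<inter> A) (unordered t) =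
          (if strahler t = K \<and> unordered t \<in> A then 1 else 0 :: ennreal)"
        using AE_gw_positive
        by eventually_elim (auto simp: indicator_def tree_order_unordered positive_plane_def)
    qed
    finally show ?thesis ..
  qed
  also have "\<dots> / order_mass K = emeasure (given_order P K) A"
    unfolding given_order_def order_mass_eq using A by (subst emeasure_uniform_measure) auto
  finally show "emeasure (complete_subtree_law (given_order P H) K) A = emeasure (given_order P K) A" .
qed

end

section \<open>Self-similarity\<close>

context galton_watson begin

text \<open>The order is a function of the shape, so conditioning on it rescales all events within
  one shape by the same constant.\<close>

lemma has_conditional_laws_given_order:
  assumes emb: "proper_embedding emb" and K: "1 \<le> K" and \<tau>: "tree_order \<tau> = K"
  shows "has_conditional_laws emb (given_order P K) \<tau> (rel_law emb \<tau>) (length_density \<tau>)"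
  unfolding has_conditional_laws_def
proof (intro ballI)
  fix A B assume A: "A \<in> sets (vec_space \<tau>)" and B: "B \<in> sets (borel :: real measure)"
  have "\<tau> \<noteq> \<phi>" using K \<tau> tree_order_unordered[of "Leaf :: unit tree"] by (auto simp: empty_tree_def)
  note laws = has_conditional_laws_P[OF emb this, unfolded has_conditional_laws_def, rule_format, OF A B]
  have g: "emeasure (given_order P K) V = emeasure P V / emeasure P {T. tree_order T = K}"
    if "V \<in> sets utree_space" "V \<subseteq> {T. shape T = \<tau>}" for V
  proof -
    have "{T. tree_order T = K} \<inter> V = V" using that(2) \<tau> tree_order_shape by fastforce
    then show ?thesis unfolding given_order_def using that(1) by (subst emeasure_uniform_measure) auto
  qed
  show "emeasure (given_order P K) {T. shape T = \<tau> \<and> rel_lengths emb T \<in> A \<and> tree_length T \<in> B} =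
        emeasure (given_order P K) {T. shape T = \<tau>} *
          (\<integral>\<^sup>+x\<in>A. (\<integral>\<^sup>+y\<in>B. ennreal (length_density \<tau> x y) \<partial>lborel) \<partial>rel_law emb \<tau>)"
    using g[OF conditional_event_in_sets[OF emb A B]] g[OF shape_in_sets]
    by (auto simp: laws divide_ennreal_def mult_ac)
qed

lemma emeasure_prune_P:
  assumes V: "V \<in> sets utree_space" "\<phi> \<notin> V"
  shows "emeasure P {T. prune T \<in> V} = emeasure P {T. map_utree (\<lambda>e. 2 * e) T \<in> V} / 2"
proof -
  have U: "{t. unordered t \<in> V} \<in> sets plane_space" using V(1) by (simp add: sets_utree_space vimage_def)
  have L: "Leaf \<notin> {t. unordered t \<in> V}" using V(2) by (simp add: empty_tree_def)
  have s: "{T. prune T \<in> V} \<in> sets utree_space" "{T. map_utree (\<lambda>e. 2 * e) T \<in> V} \<in> sets utree_space"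
    using measurable_sets[OF measurable_prune V(1)]
      measurable_sets[OF measurable_map_utree[of "\<lambda>e. 2 * e"] V(1)]
    by (auto simp: vimage_def)
  show ?thesis
    using emeasure_prune[OF U L]
    by (simp add: emeasure_P[OF s(1)] emeasure_P[OF s(2)] prune.abs_eq map_utree.abs_eq)
qed

text \<open>Doubling the lengths does not affect shapes, so pruning halves the mass of every set of
  nonempty shapes; conditioning on a nonempty result undoes the factor.\<close>

lemma prune_invariant_shapes:
  "uniform_measure (distr (shape_law P) (count_space UNIV) prune) {\<tau>. \<tau> \<noteq> \<phi>} = shape_law P"
proof (rule measure_eqI)
  show "sets (uniform_measure (distr (shape_law P) (count_space UNIV) prune) {\<tau>. \<tau> \<noteq> \<phi>}) = sets (shape_law P)"
    by (simp add: shape_law_def)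
  fix B :: "unit utree set"
  let ?D = "distr (shape_law P) (count_space UNIV) prune"
  have sh: "shape \<in> P \<rightarrow>\<^sub>M count_space UNIV"
    using measurable_shape by (simp cong: measurable_cong_sets)
  have shs: "{T. shape T \<in> B} \<in> sets utree_space" for B
    using measurable_sets[OF measurable_shape, of B] by (simp add: vimage_def)
  have law: "emeasure (shape_law P) B = emeasure P {T. shape T \<in> B}" for B
    unfolding shape_law_def by (subst emeasure_distr[OF sh]) (auto simp: vimage_def)
  have D: "emeasure ?D B = emeasure P {T. shape T \<in> B} / 2" if "\<phi> \<notin> B" for B
  proof -
    have "emeasure ?D B = emeasure (shape_law P) (prune -` B)"
      by (subst emeasure_distr) (auto simp: shape_law_def)
    also have "\<dots> = emeasure P {T. prune T \<in> {T. shape T \<in> B}}"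
      by (simp add: law shape_prune vimage_def)
    also have "\<dots> = emeasure P {T. map_utree (\<lambda>e. 2 * e) T \<in> {T. shape T \<in> B}} / 2"
      by (rule emeasure_prune_P[OF shs]) (use that in \<open>auto simp: shape_eq_phi_iff[THEN iffD2]\<close>)
    finally show ?thesis by simp
  qed
  have ne: "emeasure P {T. shape T \<in> B} = emeasure P {T. shape T \<in> B - {\<phi>}}" for B
  proof (rule emeasure_eq_AE)
    show "AE T in P. T \<in> {T. shape T \<in> B} \<longleftrightarrow> T \<in> {T. shape T \<in> B - {\<phi>}}"
    proof -
      have "AE t in G. unordered t \<noteq> \<phi>" using AE_gw_not_Leaf by simp
      moreover have "{T :: real utree. T \<noteq> \<phi>} \<in> sets utree_space"
        using shs[of "- {\<phi>}"] by simp
      ultimately have "AE T in P. T \<noteq> \<phi>" unfolding gw_law_eq by (subst AE_distr_iff) auto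
      then show ?thesis by eventually_elim simp
    qed
    show "{T. shape T \<in> B} \<in> sets P" "{T. shape T \<in> B - {\<phi>}} \<in> sets P"
      by (simp_all only: sets_P shs)
  qed
  have "emeasure ?D {\<tau>. \<tau> \<noteq> \<phi>} = 1 / 2"
    using D[of "{\<tau>. \<tau> \<noteq> \<phi>}"] ne[of UNIV] P.emeasure_space_1 by (simp add: Compl_eq_Diff_UNIV[symmetric] Compl_eq)
  moreover have "emeasure ?D ({\<tau>. \<tau> \<noteq> \<phi>} \<inter> B) = emeasure P {T. shape T \<in> B} / 2"
  proof -
    have "{\<tau>. \<tau> \<noteq> \<phi>} \<inter> B = B - {\<phi>}" by auto
    then show ?thesis using D[of "B - {\<phi>}"] ne[of B] by simp
  qed
  moreover have "x / 2 / (1 / 2) = x" for x :: ennreal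
  proof -
    have "x / 2 = x * (1 / 2)" by (simp add: divide_ennreal_def)
    moreover have "x * (1 / 2) / (1 / 2) = x"
      by (rule ennreal_mult_divide_eq) (auto simp: divide_ennreal_def)
    ultimately show ?thesis by simp
  qed
  ultimately show "emeasure (uniform_measure ?D {\<tau>. \<tau> \<noteq> \<phi>}) B = emeasure (shape_law P) B"
    by (subst emeasure_uniform_measure) (auto simp: law)
qed

text \<open>On nonempty trees the pruned law is half the law of the doubled tree. Doubling keeps the
  shape and the relative lengths, so only the law of the total length is transformed, by y to 2 y;
  the factor 1/2 appears on both sides.\<close>

lemma has_conditional_laws_prune:
  assumes emb: "proper_embedding emb" and \<tau>: "\<tau> \<noteq> \<phi>"
  shows "has_conditional_laws emb (distr P utree_space prune) \<tau> (rel_law emb \<tau>) (\<lambda>x y. length_density \<tau> x (y / 2) / 2)"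
  unfolding has_conditional_laws_def
proof (intro ballI)
  fix A B assume A: "A \<in> sets (vec_space \<tau>)" and B: "B \<in> sets (borel :: real measure)"
  define B' where "B' = (\<lambda>y. 2 * y) -` B"
  have B': "B' \<in> sets borel"
    using measurable_sets[of "\<lambda>y :: real. 2 * y" borel borel B] B by (simp add: B'_def)
  have pm: "prune \<in> P \<rightarrow>\<^sub>M utree_space" using measurable_prune by (simp cong: measurable_cong_sets)
  have dist: "emeasure (distr P utree_space prune) V = emeasure P {T. map_utree (\<lambda>e. 2 * e) T \<in> V} / 2"
    if "V \<in> sets utree_space" "V \<subseteq> {T. shape T = \<tau>}" for V
  proof -
    have "\<phi> \<notin> V" using that(2) \<tau> by (auto dest!: subsetD simp: shape_eq_phi_iff[THEN iffD2])
    then show ?thesis using emeasure_prune_P[OF that(1)] emeasure_distr[OF pm that(1)] by (simp add: vimage_def)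
  qed
  let ?V = "\<lambda>B. {T. shape T = \<tau> \<and> rel_lengths emb T \<in> A \<and> tree_length T \<in> B}"
  have V: "?V B \<in> sets utree_space" if "B \<in> sets borel" for B
    by (rule conditional_event_in_sets[OF emb A that])
  have halve: "(\<integral>\<^sup>+y\<in>B'. ennreal (length_density \<tau> x y) \<partial>lborel) =
      (\<integral>\<^sup>+y\<in>B. ennreal (length_density \<tau> x (y / 2) / 2) \<partial>lborel)" for x
  proof -
    note [measurable] = B
    have "(\<integral>\<^sup>+y\<in>B. ennreal (length_density \<tau> x (y / 2) / 2) \<partial>lborel) =
      ennreal \<bar>2\<bar> * (\<integral>\<^sup>+y. ennreal (length_density \<tau> x ((0 + 2 * y) / 2) / 2) * indicator B (0 + 2 * y) \<partial>lborel)"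
      unfolding length_density_def by (rule nn_integral_real_affine) auto
    also have "\<dots> = (\<integral>\<^sup>+y. ennreal \<bar>2\<bar> * (ennreal (length_density \<tau> x ((0 + 2 * y) / 2) / 2) * indicator B (0 + 2 * y)) \<partial>lborel)"
      unfolding length_density_def by (rule nn_integral_cmult[symmetric]) measurable
    also have "\<dots> = (\<integral>\<^sup>+y\<in>B'. ennreal (length_density \<tau> x y) \<partial>lborel)"
    proof (rule nn_integral_cong)
      fix y :: real
      have "ennreal \<bar>2\<bar> * ennreal (length_density \<tau> x y / 2) = ennreal (\<bar>2\<bar> * (length_density \<tau> x y / 2))"
        by (rule ennreal_mult'[symmetric]) simp
      then have "ennreal \<bar>2\<bar> * ennreal (length_density \<tau> x y / 2) = ennreal (length_density \<tau> x y)"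
        by simp
      moreover have "indicator B (0 + 2 * y) = (indicator B' y :: ennreal)" by (simp add: B'_def indicator_def)
      ultimately show "ennreal \<bar>2\<bar> * (ennreal (length_density \<tau> x ((0 + 2 * y) / 2) / 2) * indicator B (0 + 2 * y)) =
        ennreal (length_density \<tau> x y) * indicator B' y"
        by (simp add: mult.assoc[symmetric])
    qed
    finally show ?thesis ..
  qed
  have "emeasure P {T. map_utree (\<lambda>e. 2 * e) T \<in> ?V B} = emeasure P (?V B')"
  proof (rule emeasure_eq_AE)
    have "AE T in P. T \<in> length_trees" using tree_law_P by (simp add: tree_law_def)
    then show "AE T in P. T \<in> {T. map_utree (\<lambda>e. 2 * e) T \<in> ?V B} \<longleftrightarrow> T \<in> ?V B'"
      by eventually_elim (simp add: rel_lengths_scale[OF emb] B'_def)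
    show "{T. map_utree (\<lambda>e. 2 * e) T \<in> ?V B} \<in> sets P"
      using measurable_sets[OF measurable_map_utree[of "\<lambda>e. 2 * e"] V[OF B]] by (simp add: vimage_def)
    show "?V B' \<in> sets P" using V[OF B'] by simp
  qed
  also have "\<dots> = emeasure P {T. shape T = \<tau>} *
          (\<integral>\<^sup>+x\<in>A. (\<integral>\<^sup>+y\<in>B'. ennreal (length_density \<tau> x y) \<partial>lborel) \<partial>rel_law emb \<tau>)"
    by (rule has_conditional_laws_P[OF emb \<tau>, unfolded has_conditional_laws_def, rule_format, OF A B'])
  also have "\<dots> = emeasure P {T. shape T = \<tau>} *
    (\<integral>\<^sup>+x\<in>A. (\<integral>\<^sup>+y\<in>B. ennreal (length_density \<tau> x (y / 2) / 2) \<partial>lborel) \<partial>rel_law emb \<tau>)"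
    by (simp only: halve)
  finally have "emeasure P {T. map_utree (\<lambda>e. 2 * e) T \<in> ?V B} = emeasure P {T. shape T = \<tau>} *
    (\<integral>\<^sup>+x\<in>A. (\<integral>\<^sup>+y\<in>B. ennreal (length_density \<tau> x (y / 2) / 2) \<partial>lborel) \<partial>rel_law emb \<tau>)" .
  moreover have "emeasure (distr P utree_space prune) (?V B) = emeasure P {T. map_utree (\<lambda>e. 2 * e) T \<in> ?V B} / 2"
    by (rule dist[OF V[OF B]]) auto
  moreover have "emeasure (distr P utree_space prune) {T. shape T = \<tau>} = emeasure P {T. shape T = \<tau>} / 2"
    using dist[OF shape_in_sets] by simp
  ultimately show "emeasure (distr P utree_space prune) (?V B) =
      emeasure (distr P utree_space prune) {T. shape T = \<tau>} *
      (\<integral>\<^sup>+x\<in>A. (\<integral>\<^sup>+y\<in>B. ennreal (length_density \<tau> x (y / 2) / 2) \<partial>lborel) \<partial>rel_law emb \<tau>)"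
    by (simp add: divide_ennreal_def mult_ac)
qed

theorem self_similar_gw:
  assumes emb: "proper_embedding emb"
  shows "self_similar emb P 2"
  unfolding self_similar_def
proof (intro conjI exI[of _ "rel_law emb"] exI[of _ length_density] allI impI)
  fix H K :: nat assume K: "1 \<le> K" "K \<le> H"
  show "shape_law (complete_subtree_law (given_order P H) K) = shape_law (given_order P K)"
    by (simp only: complete_subtree_law_eq[OF K])
  fix \<tau> :: "unit utree" assume "tree_order \<tau> = K"
  then show "has_conditional_laws emb (complete_subtree_law (given_order P H) K) \<tau> (rel_law emb \<tau>) (length_density \<tau>)"
    unfolding complete_subtree_law_eq[OF K] by (rule has_conditional_laws_given_order[OF emb K(1)])
qed (simp_all add: tree_law_P rel_law[OF emb] conditional_density_length has_conditional_laws_P[OF emb]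
    prune_invariant_shapes has_conditional_laws_prune[OF emb])

end

theorem theorem8:
  fixes \<gamma> :: real and lam Tk :: "nat \<Rightarrow> real" and p :: "nat pmf"
    and emb :: "real utree \<Rightarrow> real tree"
  assumes "0 < \<gamma>"
    and "\<And>j. 1 \<le> j \<Longrightarrow> lam j = \<gamma> * 2 powr (2 - real j)"
    and "\<And>K. 1 \<le> K \<Longrightarrow> pmf p K = 2 powr (- real K)"
    and "\<And>k. 1 \<le> k \<Longrightarrow> Tk k = 2 ^ (k - 1)"
    and "proper_embedding emb"
  shows "hbp_law p Tk lam = gw_law \<gamma> \<and>
         self_similar emb (hbp_law p Tk lam) 2 \<and>
         critical_hbp p Tk lam \<and>
         time_invariant_hbp p Tk lam \<and>
         (\<exists>!w. horton_root Tk w) \<and> horton_R Tk = 4 \<and>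
         tokunaga_L Tk = 2"
proof -
  interpret geometric_hbp \<gamma> lam Tk p
    using assms(1-4) by unfold_locales
  have "\<exists>!w. horton_root Tk w" unfolding horton_root_iff by (rule ex1_eq)
  then show ?thesis
    unfolding hbp_law_eq_gw_law
    using self_similar_gw[OF assms(5)] critical time_invariant horton_R_eq tokunaga_L_eq by blast
qed

end
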